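(* Let $X$ be a finite connected symmetric digraph with all $d_v\ge1$, let $\alpha:E(X)\to\Gamma\simeq\mathbb Z_p^d$ be a voltage assignment, and let $U_n$ be the Grover transition matrix on $X_n$. For every $n\ge0$, \[ \det(AI_{2lq_n}-U_n)=(A^2-1)^{-q_n\chi(X)}\prod_{\zeta\in W_n^d}\mathcal F_X(A,\zeta-1). \]
   Context: Let $p$ be a prime, $d\ge1$, $\overline{\mathbb Q}_p$ a fixed algebraic closure of $\mathbb Q_p$. The identity is one of rational functions in the variable $A$ over $\overline{\mathbb Q}_p$. Graphs. A finite symmetric digraph $X$ has a finite vertex set $V(X)=\{v_1,\dots,v_m\}$ and a finite set $E(X)$ of directed edges (loops and multiple edges allowed) with origin $o(e)$, terminus $t(e)$ and an inversion $e\mapsto\bar e\ne e$ with $\bar{\bar e}=e$, $o(\bar e)=t(e)$. Put $\#E(X)=2l$, $\chi(X)=m-l$, $d_v=\#\{e:o(e)=v\}$, and let $w(e)=2/d_{o(e)}$ be the Grover weight. Tower. A voltage assignment is a map $\alpha:E(X)\to\Gamma\simeq\mathbb Z_p^d$ with $\alpha(\bar e)=-\alpha(e)$. Let $\Gamma_n=\Gamma/p^n\Gamma$, $q_n=p^{dn}$, $\alpha_n$ the reduction of $\alpha$. $X_n$ has vertex set $V(X)\times\Gamma_n$ and directed edges $(e,g):(o(e),g)\to(t(e),g+\alpha_n(e))$, with $\overline{(e,g)}=(\bar e,g+\alpha_n(e))$. The Grover transition matrix $U_n$, indexed by $E(X_n)$ and of size $2lq_n$, has $(U_n)_{e,f}=\frac{2}{d_{t(f)}}-\delta_{f,\bar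 e}$ if $t(f)=o(e)$ and $0$ otherwise (degrees taken in $X_n$). Spectral polynomial. For $\gamma\in\Gamma\simeq\mathbb Z_p^d$ put $\tau(\gamma)=\prod_i(1+T_i)^{\gamma_i}\in\mathbb Z_p[[T_1,\dots,T_d]]$. Let $W_{\tau,\alpha}$ be the $m\times m$ matrix with $(i,j)$ entry $\sum_{e:v_i\to v_j}w(e)\tau(\alpha(e))$ and $\mathcal F_X(A,T)=\det\bigl((A^2+1)I_m-AW_{\tau,\alpha}\bigr)$. $W_n=\mu_{p^n}(\overline{\mathbb Q}_p)$; for $\zeta\in W_n^d$, $\zeta-1=(\zeta_1-1,\dots,\zeta_d-1)$, and $\mathcal F_X(A,\zeta-1)$ is the specialization at $T=\zeta-1$. *)

theory Defs
  imports
    "HOL-Algebra.Algebraic_Closure_Type"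
    "HOL-Computational_Algebra.Computational_Algebra"
    "Jordan_Normal_Form.Determinant"
    "Berlekamp_Zassenhaus.Finite_Field"
    "Graph_Theory.Digraph_Component"
    "Graph_Theory.Bidirected_Digraph"
begin

section \<open>The $p$-adic integers\<close>

text \<open>
  The prime is the cardinality of a type parameter. The ring is the inverse limit of the rings of
  integers modulo $p^n$; the $n$-th component is the representative in $\{0,\dots,p^n-1\}$
  (which the compatibility condition below enforces).
\<close>

typedef (overloaded) 'p padic_int =
  "{x :: nat \<Rightarrow> int. \<forall>n. x (Suc n) mod int CARD('p :: prime_card) ^ n = x n}"
  morphisms padic_residue Abs_padic_int
  by (rule exI[of _ "\<lambda>_. 0"]) simp

setup_lifting type_definition_padic_int

lemma padic_int_mod_mod:
  "(a mod int CARD('p :: prime_card) ^ Suc n) mod int CARD('p) ^ n = a mod int CARD('p) ^ n"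
  by (intro mod_mod_cancel le_imp_power_dvd) simp

lemma padic_residue_Suc:
  fixes x :: "'p :: prime_card padic_int"
  shows "padic_residue x (Suc n) mod int CARD('p) ^ n = padic_residue x n"
  using padic_residue[of x] by simp

lemma padic_residue_mod [simp]:
  fixes x :: "'p :: prime_card padic_int"
  shows "padic_residue x n mod int CARD('p) ^ n = padic_residue x n"
  by (metis padic_residue_Suc mod_mod_trivial)

lemma padic_residue_add:
  fixes x :: "'p :: prime_card padic_int"
  shows "padic_residue x (n + k) mod int CARD('p) ^ n = padic_residue x n"
proof (induction k)
  case (Suc k)
  have "padic_residue x (n + Suc k) mod int CARD('p) ^ n =
      padic_residue x (Suc (n + k)) mod int CARD('p) ^ (n + k) mod int CARD('p) ^ n"
    by (simp add: mod_mod_cancel le_imp_power_dvd)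
  then show ?case using Suc by (simp add: padic_residue_Suc)
qed simp

instantiation padic_int :: (prime_card) comm_ring_1
begin

lift_definition zero_padic_int :: "'a padic_int" is "\<lambda>_. 0" by simp
lift_definition one_padic_int :: "'a padic_int" is "\<lambda>n. 1 mod int CARD('a) ^ n"
  by (simp only: padic_int_mod_mod)
lift_definition plus_padic_int :: "'a padic_int \<Rightarrow> 'a padic_int \<Rightarrow> 'a padic_int"
  is "\<lambda>x y n. (x n + y n) mod int CARD('a) ^ n"
  by (simp only: padic_int_mod_mod) (metis mod_add_eq)
lift_definition minus_padic_int :: "'a padic_int \<Rightarrow> 'a padic_int \<Rightarrow> 'a padic_int"
  is "\<lambda>x y n. (x n - y n) mod int CARD('a) ^ n"
  by (simp only: padic_int_mod_mod) (metis mod_diff_eq)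
lift_definition uminus_padic_int :: "'a padic_int \<Rightarrow> 'a padic_int"
  is "\<lambda>x n. (- x n) mod int CARD('a) ^ n"
  by (simp only: padic_int_mod_mod) (metis mod_minus_eq)
lift_definition times_padic_int :: "'a padic_int \<Rightarrow> 'a padic_int \<Rightarrow> 'a padic_int"
  is "\<lambda>x y n. (x n * y n) mod int CARD('a) ^ n"
  by (simp only: padic_int_mod_mod) (metis mod_mult_eq)

instance
proof
  fix a b c :: "'a padic_int"
  show "a * b * c = a * (b * c)"
    by transfer (simp add: fun_eq_iff mod_mult_left_eq mod_mult_right_eq mult.assoc)
  show "a * b = b * a" by transfer (simp add: mult.commute)
  show "1 * a = a"
    by transfer (auto simp: fun_eq_iff mod_mult_left_eq, metis mod_mod_trivial)
  show "a + b + c = a + (b + c)"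
    by transfer (simp add: fun_eq_iff mod_add_left_eq mod_add_right_eq add.assoc)
  show "a + b = b + a" by transfer (simp add: add.commute)
  show "0 + a = a"
    by transfer (auto simp: fun_eq_iff, metis mod_mod_trivial)
  show "- a + a = 0"
    by transfer (simp add: fun_eq_iff mod_add_left_eq)
  show "a - b = a + - b"
    by transfer (simp add: fun_eq_iff mod_add_right_eq)
  show "(a + b) * c = a * c + b * c"
    by transfer (simp add: fun_eq_iff mod_mult_left_eq mod_add_eq distrib_right)
  have "1 < int CARD('a)" using prime_gt_1_nat[OF prime_card[where 'a='a]] by simp
  then show "(0 :: 'a padic_int) \<noteq> 1"
    by transfer (auto simp: fun_eq_iff intro!: exI[of _ 1])
qed

end

lemma padic_residue_nonzero:
  fixes x :: "'p :: prime_card padic_int"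
  assumes "x \<noteq> 0"
  obtains a where "\<And>k. \<not> int CARD('p) ^ a dvd padic_residue x (a + k)"
proof -
  from assms obtain a where a: "padic_residue x a \<noteq> 0"
    by (auto simp: padic_residue_inject[symmetric] zero_padic_int.rep_eq fun_eq_iff)
  have "\<not> int CARD('p) ^ a dvd padic_residue x (a + k)" for k
    using a by (simp add: dvd_eq_mod_eq_0 padic_residue_add)
  then show thesis using that by blast
qed

instance padic_int :: (prime_card) idom
proof
  fix x y :: "'a padic_int"
  assume "x \<noteq> 0" "y \<noteq> 0"
  then obtain a b where ab: "\<And>k. \<not> int CARD('a) ^ a dvd padic_residue x (a + k)"
      "\<And>k. \<not> int CARD('a) ^ b dvd padic_residue y (b + k)"
    by (metis padic_residue_nonzero)
  define u v where "u = padic_residue x (a + b)" and "v = padic_residue y (a + b)"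
  have u: "\<not> int CARD('a) ^ a dvd u" and v: "\<not> int CARD('a) ^ b dvd v"
    using ab(1)[of b] ab(2)[of a] by (simp_all add: u_def v_def add.commute)
  have p: "prime (int CARD('a))" using prime_card[where 'a='a] by simp
  have nz: "u \<noteq> 0" "v \<noteq> 0" using u v by auto
  have "multiplicity (int CARD('a)) u < a" "multiplicity (int CARD('a)) v < b"
    using u v multiplicity_dvd' by (metis not_le)+
  then have "multiplicity (int CARD('a)) (u * v) < a + b"
    using p nz by (simp add: prime_elem_multiplicity_mult_distrib)
  then have "\<not> int CARD('a) ^ (a + b) dvd u * v"
    using p nz by (metis multiplicity_geI not_le prime_elem_not_unit prime_imp_prime_elem no_zero_divisors
        not_prime_unit)
  then have "padic_residue (x * y) (a + b) \<noteq> 0"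
    by (simp add: times_padic_int.rep_eq u_def v_def dvd_eq_mod_eq_0)
  then show "x * y \<noteq> 0"
    by (auto simp: zero_padic_int.rep_eq)
qed

lemma padic_residue_of_nat:
  "padic_residue (of_nat m :: 'p :: prime_card padic_int) n = int m mod int CARD('p) ^ n"
  by (induction m)
    (simp_all add: zero_padic_int.rep_eq one_padic_int.rep_eq plus_padic_int.rep_eq mod_add_eq)

instance padic_int :: (prime_card) ring_char_0
proof
  show "inj (of_nat :: nat \<Rightarrow> 'a padic_int)"
  proof (rule injI)
    fix m n assume eq: "(of_nat m :: 'a padic_int) = of_nat n"
    define N where "N = m + n"
    have "1 < CARD('a)" using prime_gt_1_nat[OF prime_card[where 'a='a]] .
    then have "N < CARD('a) ^ N" by (simp add: power_gt_expt)
    then have "m < CARD('a) ^ N" "n < CARD('a) ^ N" by (simp_all add: N_def)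
    then have "int m mod int CARD('a) ^ N = int m" "int n mod int CARD('a) ^ N = int n"
      by (simp_all flip: of_nat_power of_nat_mod)
    then show "m = n" using arg_cong[OF eq, of "\<lambda>z. padic_residue z N"]
      by (simp add: padic_residue_of_nat)
  qed
qed

instance fract :: ("{idom, ring_char_0}") field_char_0
proof
  show "inj (of_nat :: nat \<Rightarrow> 'a fract)"
    by (rule injI) (simp add: of_nat_fract eq_fract)
qed


section \<open>The $p$-adic field, its algebraic closure and the $p$-adic topology\<close>

type_synonym 'p padic = "'p padic_int fract"

type_synonym 'p padic_closure = "'p padic alg_closure"

definition padic_integral :: "'p :: prime_card padic_closure \<Rightarrow> bool" where
  "padic_integral x \<longleftrightarrow>
     (\<exists>q :: 'p padic_int poly. lead_coeff q = 1 \<and> poly (map_poly (\<lambda>c. to_ac (to_fract c)) q) x = 0)"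

text \<open>
  The closed unit disc of the unique extension of the $p$-adic absolute value to the algebraic
  closure is the integral closure of the $p$-adic integers. Hence the discs
  $|x - s| \le p^{-N}$ below form a neighbourhood base of $s$.
\<close>

definition padic_nhds :: "'p :: prime_card padic_closure \<Rightarrow> 'p padic_closure filter" where
  "padic_nhds s = (INF N :: nat. principal {x. padic_integral ((x - s) / of_nat CARD('p) ^ N)})"

definition padic_has_sum :: "('i \<Rightarrow> 'p :: prime_card padic_closure) \<Rightarrow> 'p padic_closure \<Rightarrow> bool" where
  "padic_has_sum f s \<longleftrightarrow> filterlim (sum f) (padic_nhds s) (finite_subsets_at_top UNIV)"


section \<open>Formal power series in finitely many variables\<close>

text \<open>The variables are indexed by a finite type, a monomial is given by its exponents.\<close>

typedef ('a, 'd) mfps = "UNIV :: (('d \<Rightarrow> nat) \<Rightarrow> 'a) set"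
  morphisms mfps_coeff Abs_mfps ..

setup_lifting type_definition_mfps

definition exponent_splits :: "('d \<Rightarrow> nat) \<Rightarrow> (('d \<Rightarrow> nat) \<times> ('d \<Rightarrow> nat)) set" where
  "exponent_splits k = {(a, b). \<forall>i. a i + b i = k i}"

lemma finite_exponent_splits [simp]: "finite (exponent_splits (k :: 'd :: finite \<Rightarrow> nat))"
proof -
  have "exponent_splits k \<subseteq> (UNIV \<rightarrow>\<^sub>E {..Max (range k)}) \<times> (UNIV \<rightarrow>\<^sub>E {..Max (range k)})"
  proof -
    have "a i \<le> Max (range k) \<and> b i \<le> Max (range k)" if "\<forall>i. a i + b i = k i" for a b i
      using that Max_ge[of "range k" "k i"] by (metis add_leE finite_imageI finite rangeI)
    then show ?thesis by (auto simp: exponent_splits_def PiE_def Pi_def extensional_def)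
  qed
  then show ?thesis
    by (rule finite_subset) (intro finite_cartesian_product finite_PiE; simp)
qed

instantiation mfps :: (comm_ring_1, finite) comm_ring_1
begin

lift_definition zero_mfps :: "('a, 'b) mfps" is "\<lambda>_. 0" .
lift_definition one_mfps :: "('a, 'b) mfps" is "\<lambda>k. if k = (\<lambda>_. 0) then 1 else 0" .
lift_definition plus_mfps :: "('a, 'b) mfps \<Rightarrow> ('a, 'b) mfps \<Rightarrow> ('a, 'b) mfps"
  is "\<lambda>f g k. f k + g k" .
lift_definition minus_mfps :: "('a, 'b) mfps \<Rightarrow> ('a, 'b) mfps \<Rightarrow> ('a, 'b) mfps"
  is "\<lambda>f g k. f k - g k" .
lift_definition uminus_mfps :: "('a, 'b) mfps \<Rightarrow> ('a, 'b) mfps"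
  is "\<lambda>f k. - f k" .
lift_definition times_mfps :: "('a, 'b) mfps \<Rightarrow> ('a, 'b) mfps \<Rightarrow> ('a, 'b) mfps"
  is "\<lambda>f g k. \<Sum>(a, b)\<in>exponent_splits k. f a * g b" .

instance
proof
  fix f g h :: "('a, 'b) mfps"
  show "f * g * h = f * (g * h)"
  proof (transfer, rule ext)
    fix f g h :: "('b \<Rightarrow> nat) \<Rightarrow> 'a" and k
    have "(\<Sum>(x, c)\<in>exponent_splits k. (\<Sum>(a, b)\<in>exponent_splits x. f a * g b) * h c) =
        (\<Sum>(z, w)\<in>Sigma (exponent_splits k) (\<lambda>(x, c). exponent_splits x).
          f (fst w) * g (snd w) * h (snd z))"
      by (simp add: sum.Sigma sum_distrib_right case_prod_unfold)
    also have "\<dots> = (\<Sum>(z, w)\<in>Sigma (exponent_splits k) (\<lambda>(a, y). exponent_splits y).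
          f (fst z) * g (fst w) * h (snd w))"
      by (rule sum.reindex_bij_witness[where
            i = "\<lambda>((a, y), (b, c)). (((\<lambda>i. a i + b i), c), (a, b))" and
            j = "\<lambda>((x, c), (a, b)). ((a, (\<lambda>i. b i + c i)), (b, c))"])
        (auto simp: exponent_splits_def fun_eq_iff add.assoc, metis add.assoc)
    also have "\<dots> = (\<Sum>(a, y)\<in>exponent_splits k. f a * (\<Sum>(b, c)\<in>exponent_splits y. g b * h c))"
      by (simp add: sum.Sigma sum_distrib_left case_prod_unfold mult.assoc)
    finally show "(\<Sum>(x, c)\<in>exponent_splits k. (\<Sum>(a, b)\<in>exponent_splits x. f a * g b) * h c) =
        (\<Sum>(a, y)\<in>exponent_splits k. f a * (\<Sum>(b, c)\<in>exponent_splits y. g b * h c))" .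
  qed
  show "f * g = g * f"
  proof (transfer, rule ext)
    fix f g :: "('b \<Rightarrow> nat) \<Rightarrow> 'a" and k
    show "(\<Sum>(a, b)\<in>exponent_splits k. f a * g b) = (\<Sum>(a, b)\<in>exponent_splits k. g a * f b)"
      by (rule sum.reindex_bij_witness[where i = prod.swap and j = prod.swap])
        (auto simp: exponent_splits_def add.commute mult.commute)
  qed
  show "1 * f = f"
  proof (transfer, rule ext)
    fix f :: "('b \<Rightarrow> nat) \<Rightarrow> 'a" and k
    have "(\<Sum>(a, b)\<in>exponent_splits k. (if a = (\<lambda>_. 0) then 1 else 0) * f b) =
        (\<Sum>(a, b)\<in>{((\<lambda>_ :: 'b. 0 :: nat), k)}. (if a = (\<lambda>_. 0) then 1 else 0) * f b)"
      proof (rule sum.mono_neutral_right)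
      show "{((\<lambda>_. 0), k)} \<subseteq> exponent_splits k" by (simp add: exponent_splits_def)
      show "\<forall>z\<in>exponent_splits k - {((\<lambda>_. 0), k)}.
          (case z of (a, b) \<Rightarrow> (if a = (\<lambda>_. 0) then 1 else 0) * f b) = 0"
        by (auto simp: exponent_splits_def fun_eq_iff split: if_splits)
    qed simp
    then show "(\<Sum>(a, b)\<in>exponent_splits k. (if a = (\<lambda>_. 0) then 1 else 0) * f b) = f k"
      by simp
  qed
  show "f + g + h = f + (g + h)" by transfer (simp add: add.assoc)
  show "f + g = g + f" by transfer (simp add: add.commute)
  show "0 + f = f" by transfer simp
  show "- f + f = 0" by transfer simp
  show "f - g = f + - g" by transfer simp
  show "(f + g) * h = f * h + g * h"
    by transfer (simp add: distrib_right sum.distrib case_prod_beta)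
  show "(0 :: ('a, 'b) mfps) \<noteq> 1"
    by transfer (auto simp: fun_eq_iff)
qed

end

lift_definition mfps_const :: "'a \<Rightarrow> ('a :: zero, 'd) mfps"
  is "\<lambda>c k. if k = (\<lambda>_. 0) then c else 0" .

text \<open>The binomial series $(1 + T_i)^a$.\<close>

lift_definition mfps_binomial :: "'d \<Rightarrow> 'a :: field_char_0 \<Rightarrow> ('a, 'd) mfps"
  is "\<lambda>i a k. if \<forall>j. j \<noteq> i \<longrightarrow> k j = 0 then a gchoose k i else 0" .

text \<open>
  Specialization at a point, as a convergent sum in the $p$-adic topology.
\<close>

definition mfps_eval ::
    "('p :: prime_card padic, 'd :: finite) mfps \<Rightarrow> ('d \<Rightarrow> 'p padic_closure) \<Rightarrow> 'p padic_closure" where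
  "mfps_eval f x =
     (THE s. padic_has_sum (\<lambda>k. to_ac (mfps_coeff f k) * (\<Prod>i\<in>UNIV. x i ^ k i)) s)"


section \<open>Voltage assignments and the tower of derived graphs\<close>

text \<open>
  A symmetric digraph with its inversion is a \<^locale>\<open>bidirected_digraph\<close> of the library,
  with inversion \<open>arev\<close>, origin \<^const>\<open>tail\<close> and terminus \<^const>\<open>head\<close>.
  The group $\Gamma = \mathbb{Z}_p^d$ is the type \<open>'d \<Rightarrow> 'p padic_int\<close> with $d$ the cardinality
  of \<open>'d\<close>.
\<close>

definition voltage_assignment ::
    "('v, 'e) pre_digraph \<Rightarrow> ('e \<Rightarrow> 'e) \<Rightarrow> ('e \<Rightarrow> 'd \<Rightarrow> 'p :: prime_card padic_int) \<Rightarrow> bool" where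
  "voltage_assignment G arev \<alpha> \<longleftrightarrow> (\<forall>e\<in>arcs G. \<forall>i. \<alpha> (arev e) i = - \<alpha> e i)"

definition coset :: "nat \<Rightarrow> ('d \<Rightarrow> 'p :: prime_card padic_int) \<Rightarrow> ('d \<Rightarrow> 'p padic_int) set" where
  "coset n \<gamma> = {(\<lambda>i. \<gamma> i + of_nat CARD('p) ^ n * \<eta> i) |\<eta>. True}"

definition quotient_group :: "nat \<Rightarrow> ('d \<Rightarrow> 'p :: prime_card padic_int) set set" where
  "quotient_group n = range (coset n)"

definition coset_add ::
    "('d \<Rightarrow> 'p :: prime_card padic_int) set \<Rightarrow> ('d \<Rightarrow> 'p padic_int) set \<Rightarrow> ('d \<Rightarrow> 'p padic_int) set" where
  "coset_add g h = {(\<lambda>i. x i + y i) |x y. x \<in> g \<and> y \<in> h}"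

definition derived_digraph ::
    "('v, 'e) pre_digraph \<Rightarrow> ('e \<Rightarrow> 'd \<Rightarrow> 'p :: prime_card padic_int) \<Rightarrow> nat \<Rightarrow>
     ('v \<times> ('d \<Rightarrow> 'p padic_int) set, 'e \<times> ('d \<Rightarrow> 'p padic_int) set) pre_digraph" where
  "derived_digraph G \<alpha> n =
     \<lparr>verts = verts G \<times> quotient_group n, arcs = arcs G \<times> quotient_group n,
      tail = (\<lambda>(e, g). (tail G e, g)),
      head = (\<lambda>(e, g). (head G e, coset_add g (coset n (\<alpha> e))))\<rparr>"

definition derived_arev ::
    "('e \<Rightarrow> 'e) \<Rightarrow> ('e \<Rightarrow> 'd \<Rightarrow> 'p :: prime_card padic_int) \<Rightarrow> nat \<Rightarrow>
     'e \<times> ('d \<Rightarrow> 'p padic_int) set \<Rightarrow> 'e \<times> ('d \<Rightarrow> 'p padic_int) set" where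
  "derived_arev arev \<alpha> n = (\<lambda>(e, g). (arev e, coset_add g (coset n (\<alpha> e))))"

text \<open>Matrices indexed by arcs or vertices are written with respect to an enumeration.\<close>

definition grover_matrix :: "('v, 'e) pre_digraph \<Rightarrow> ('e \<Rightarrow> 'e) \<Rightarrow> 'e list \<Rightarrow> 'a :: field mat" where
  "grover_matrix G arev es =
     mat (length es) (length es) (\<lambda>(i, j).
       let e = es ! i; f = es ! j in
       if head G f = tail G e
       then 2 / of_nat (out_degree G (head G f)) - (if f = arev e then 1 else 0)
       else 0)"


section \<open>The spectral polynomial\<close>

definition grover_weight :: "('v, 'e) pre_digraph \<Rightarrow> 'e \<Rightarrow> 'a :: field" where
  "grover_weight G e = 2 / of_nat (out_degree G (tail G e))"

definition voltage_series ::
    "('d :: finite \<Rightarrow> 'p :: prime_card padic_int) \<Rightarrow> ('p padic, 'd) mfps" where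
  "voltage_series \<gamma> = (\<Prod>i\<in>UNIV. mfps_binomial i (to_fract (\<gamma> i)))"

definition weighted_matrix ::
    "('v, 'e) pre_digraph \<Rightarrow> ('e \<Rightarrow> 'd :: finite \<Rightarrow> 'p :: prime_card padic_int) \<Rightarrow> 'v list \<Rightarrow>
     ('p padic, 'd) mfps mat" where
  "weighted_matrix G \<alpha> vs =
     mat (length vs) (length vs) (\<lambda>(i, j).
       \<Sum>e | e \<in> arcs G \<and> tail G e = vs ! i \<and> head G e = vs ! j.
         mfps_const (grover_weight G e) * voltage_series (\<alpha> e))"

text \<open>
  A polynomial in $A$ over the power series ring. The coefficients of the power series are in the
  $p$-adic field, since the weights need not be $p$-adic integers.
\<close>

definition spectral_poly ::
    "('v, 'e) pre_digraph \<Rightarrow> ('e \<Rightarrow> 'd :: finite \<Rightarrow> 'p :: prime_card padic_int) \<Rightarrow> 'v list \<Rightarrow>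
     ('p padic, 'd) mfps poly" where
  "spectral_poly G \<alpha> vs =
     det ([:1, 0, 1:] \<cdot>\<^sub>m 1\<^sub>m (length vs)
          - [:0, 1:] \<cdot>\<^sub>m map_mat (\<lambda>c. [:c:]) (weighted_matrix G \<alpha> vs))"

definition specialize ::
    "('p :: prime_card padic, 'd :: finite) mfps poly \<Rightarrow> ('d \<Rightarrow> 'p padic_closure) \<Rightarrow>
     'p padic_closure poly" where
  "specialize F x = map_poly (\<lambda>f. mfps_eval f x) F"

end

theory Submission
  imports Defs "Jordan_Normal_Form.Char_Poly" "HOL-Number_Theory.Cong"
begin

text \<open>
  Write $U = PQ - J$ with $J$ the inversion of edges, $P$ the incidence of edges with their origins
  and $Q$ the weighted incidence with their termini. Since $(A + J)(A - J) = A^2 - 1$, multiplying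
  the block matrix with rows $(A + J, P)$ and $(Q, 1)$ from the right in two ways expresses
  $\det(A - U)$ through $\det((A^2 + 1) - A W)$ for the weighted adjacency matrix $W$ of the
  same graph (Ihara-Bass). For $W$ on the derived graph, the characters of the finite group
  $\Gamma_n$ block-diagonalize the second determinant, the block at $\zeta$ being the
  adjacency matrix twisted by $\zeta$. The twisted matrix is the specialization of
  $W_{\tau,\alpha}$, because $(1 + T)^a$ at $T = \zeta - 1$ sums to $\zeta^{a \bmod p^n}$:
  $(\zeta - 1)^{p^n}$ is divisible by $p$, so modulo $p^N$ only finitely many binomial coefficients
  matter, and by $p$-adic continuity these agree with those of a natural number close to $a$.
  All power series involved are linear combinations of such binomial series, so that no
  completeness of a field containing the $\zeta_i$ is needed.
\<close>

section \<open>Determinants of matrices indexed by lists\<close>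

text \<open>The closure carries no absolute value: closeness means integrality of
  \<open>(x - s) / p ^ N\<close>, so each analytic fact is reduced to algebra in the integral
  closure. Two facts make this topology usable: \<open>1 / p\<close> is not integral, and every
  element becomes integral after multiplication by a power of \<open>p\<close>. Together they make
  sums unique, without which the definite description in \<open>mfps_eval\<close> would determine
  nothing. The main obstacle is that \<open>mfps_eval\<close> is not a ring homomorphism on all
  series: a series may diverge, and products of infinite sums would need a theory of their own. But
  \<tau>(\<gamma>) and the character value at \<gamma> are both multiplicative in \<gamma>, so
  products stay among finite combinations of the \<tau>(\<gamma>), and a determinant specializes
  because it is a polynomial in its entries. Neither determinant computation inverts a matrix: A - J
  serves as an inverse of A + J up to a scalar, and of the character matrix only the nonvanishing of
  its determinant is used. Hence everything is an identity of polynomials in A. Division by a power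
  of A^2 - 1 comes last, in the fraction field, since \<chi> may have either sign.\<close>

definition mat_of :: "'i list \<Rightarrow> 'j list \<Rightarrow> ('i \<Rightarrow> 'j \<Rightarrow> 'a) \<Rightarrow> 'a mat" where
  "mat_of xs ys f = mat (length xs) (length ys) (\<lambda>(i, j). f (xs ! i) (ys ! j))"

lemma mat_of_carrier [simp]: "mat_of xs ys f \<in> carrier_mat (length xs) (length ys)"
  by (simp add: mat_of_def)

lemma dim_mat_of [simp]: "dim_row (mat_of xs ys f) = length xs" "dim_col (mat_of xs ys f) = length ys"
  by (simp_all add: mat_of_def)

lemma mat_of_cong:
  "(\<And>x y. x \<in> set xs \<Longrightarrow> y \<in> set ys \<Longrightarrow> f x y = g x y) \<Longrightarrow> mat_of xs ys f = mat_of xs ys g"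
  by (auto simp: mat_of_def intro!: eq_matI)

text \<open>Distinctness of the middle list turns the sum over positions into a sum over the indices
  themselves, so that entries can be computed with edges, vertices and characters and never with
  positions.\<close>

lemma mat_of_mult:
  fixes f :: "'i \<Rightarrow> 'j \<Rightarrow> 'a :: comm_ring_1"
  assumes "distinct ys"
  shows "mat_of xs ys f * mat_of ys zs g = mat_of xs zs (\<lambda>x z. \<Sum>y\<in>set ys. f x y * g y z)"
proof (rule eq_matI)
  fix i j assume "i < dim_row (mat_of xs zs (\<lambda>x z. \<Sum>y\<in>set ys. f x y * g y z))"
    and "j < dim_col (mat_of xs zs (\<lambda>x z. \<Sum>y\<in>set ys. f x y * g y z))"
  then show "(mat_of xs ys f * mat_of ys zs g) $$ (i, j) =
      mat_of xs zs (\<lambda>x z. \<Sum>y\<in>set ys. f x y * g y z) $$ (i, j)"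
    using sum.reindex_bij_betw[OF bij_betw_nth[OF assms refl refl],
        where g = "\<lambda>y. f (xs ! i) y * g y (zs ! j)"]
    by (simp add: mat_of_def scalar_prod_def atLeast0LessThan)
qed auto

lemma mat_of_one:
  assumes "distinct xs"
  shows "c \<cdot>\<^sub>m 1\<^sub>m (length xs) = mat_of xs xs (\<lambda>x y. if x = y then c else (0 :: 'a :: comm_ring_1))"
  by (rule eq_matI) (use assms in \<open>auto simp: mat_of_def nth_eq_iff_index_eq\<close>)

lemma mat_of_minus:
  "mat_of xs ys f - mat_of xs ys g = mat_of xs ys (\<lambda>x y. f x y - (g x y :: 'a :: comm_ring_1))"
  by (rule eq_matI) (auto simp: mat_of_def)

lemma map_mat_mat_of: "map_mat h (mat_of xs ys f) = mat_of xs ys (\<lambda>x y. h (f x y))"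
  by (rule eq_matI) (auto simp: mat_of_def)

lemma smult_mat_of: "c \<cdot>\<^sub>m mat_of xs ys f = mat_of xs ys (\<lambda>x y. c * f x y)"
  by (rule eq_matI) (auto simp: mat_of_def)

lemma mat_of_append:
  "mat_of (xs @ xs') (ys @ ys') f =
     four_block_mat (mat_of xs ys f) (mat_of xs ys' f) (mat_of xs' ys f) (mat_of xs' ys' f)"
  by (rule eq_matI) (auto simp: mat_of_def nth_append)

text \<open>Peeling off the first key gives a block triangular matrix. Its lower left block vanishes
  because distinctness of \<open>ks\<close> separates the keys of those rows from
  \<open>k\<close>.\<close>

lemma det_mat_of_block_diagonal:
  fixes f :: "'k \<times> 'i \<Rightarrow> 'k \<times> 'i \<Rightarrow> 'a :: idom"
  assumes "distinct ks"
    and "\<And>k l x y. k \<noteq> l \<Longrightarrow> f (k, x) (l, y) = 0"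
  shows "det (mat_of (List.product ks xs) (List.product ks xs) f) =
    (\<Prod>k\<in>set ks. det (mat_of xs xs (\<lambda>x y. f (k, x) (k, y))))"
  using assms(1)
proof (induction ks)
  case Nil
  then show ?case by (simp add: mat_of_def)
next
  case (Cons k ks)
  let ?r = "List.product ks xs"
  have z: "mat_of ?r (map (Pair k) xs) f = 0\<^sub>m (length ?r) (length xs)"
  proof (rule eq_matI)
    fix i j
    assume "i < dim_row (0\<^sub>m (length ?r) (length xs))" "j < dim_col (0\<^sub>m (length ?r) (length xs))"
    then have ij: "i < length ?r" "j < length xs" by simp_all
    obtain l y where ly: "?r ! i = (l, y)" by fastforce
    then have "l \<in> set ks" using nth_mem[OF ij(1)] by auto
    then have "f (l, y) (k, xs ! j) = 0" using Cons.prems assms(2)[of l k] by auto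
    then show "mat_of ?r (map (Pair k) xs) f $$ (i, j) = 0\<^sub>m (length ?r) (length xs) $$ (i, j)"
      using ij ly by (simp add: mat_of_def)
  qed simp_all
  have b: "mat_of (map (Pair k) xs) (map (Pair k) xs) f = mat_of xs xs (\<lambda>x y. f (k, x) (k, y))"
    by (intro eq_matI) (auto simp: mat_of_def)
  have "det (mat_of (List.product (k # ks) xs) (List.product (k # ks) xs) f) =
      det (mat_of xs xs (\<lambda>x y. f (k, x) (k, y))) * det (mat_of ?r ?r f)"
    unfolding product.simps mat_of_append z b
    by (rule det_four_block_mat_lower_left_zero[of _ "length xs" _ "length ?r"])
      (simp_all add: mat_of_def)
  with Cons show ?case by simp
qed

text \<open>A Schur complement identity freed of denominators. The right factor \<open>E\<close>
  clears the lower left block of \<open>B\<close> and has determinant 1. The right factor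
  \<open>F\<close> clears the upper right block; scaling the last block column by \<open>c\<close>
  lets \<open>M'\<close> replace the inverse of \<open>M\<close>, at the price of the determinant
  \<open>c ^ m\<close>.\<close>

lemma det_minus_mult_scaled:
  fixes M :: "'a :: idom mat"
  assumes M: "M \<in> carrier_mat n n" and M': "M' \<in> carrier_mat n n"
    and P: "P \<in> carrier_mat n m" and Q: "Q \<in> carrier_mat m n"
    and MM': "M * M' = c \<cdot>\<^sub>m 1\<^sub>m n"
  shows "det (M - P * Q) * c ^ m = det M * det (c \<cdot>\<^sub>m 1\<^sub>m m - Q * (M' * P))"
proof -
  define B where "B = four_block_mat M P Q (1\<^sub>m m)"
  define E where "E = four_block_mat (1\<^sub>m n) (0\<^sub>m n m) (- Q) (1\<^sub>m m)"
  define F where "F = four_block_mat (1\<^sub>m n) (- (M' * P)) (0\<^sub>m m n) (c \<cdot>\<^sub>m 1\<^sub>m m)"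
  have carr: "B \<in> carrier_mat (n + m) (n + m)" "E \<in> carrier_mat (n + m) (n + m)"
    "F \<in> carrier_mat (n + m) (n + m)"
    using M M' P Q by (auto simp: B_def E_def F_def)
  have PQ: "P * - Q = - (P * Q)" using P Q by simp
  have "B * E = four_block_mat (M * 1\<^sub>m n + P * - Q) (M * 0\<^sub>m n m + P * 1\<^sub>m m)
      (Q * 1\<^sub>m n + 1\<^sub>m m * - Q) (Q * 0\<^sub>m n m + 1\<^sub>m m * 1\<^sub>m m)"
    unfolding B_def E_def
    by (rule mult_four_block_mat) (use M P Q in auto)
  also have "\<dots> = four_block_mat (M - P * Q) P (0\<^sub>m m n) (1\<^sub>m m)"
  proof (rule cong_four_block_mat)
    show "M * 1\<^sub>m n + P * - Q = M - P * Q"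
      unfolding PQ using M P Q by (intro eq_matI) simp_all
    show "M * 0\<^sub>m n m + P * 1\<^sub>m m = P" using M P by simp
    show "Q * 1\<^sub>m n + 1\<^sub>m m * - Q = 0\<^sub>m m n" using Q by (intro eq_matI) simp_all
    show "Q * 0\<^sub>m n m + 1\<^sub>m m * 1\<^sub>m m = 1\<^sub>m m" using Q by simp
  qed
  finally have BE: "det (B * E) = det (M - P * Q)"
    using M P Q by (simp add: det_four_block_mat_lower_left_zero[of _ n _ m] minus_carrier_mat)
  have detE: "det E = 1"
    unfolding E_def using Q by (subst det_four_block_mat_upper_right_zero[of _ n _ m]) auto
  have detF: "det F = c ^ m"
    unfolding F_def using M' P by (subst det_four_block_mat_lower_left_zero[of _ n _ m]) auto
  have MP: "M * - (M' * P) = - (c \<cdot>\<^sub>m P)"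
  proof -
    have "M * - (M' * P) = - (M * (M' * P))"
      by (rule uminus_mult_right_mat) (use M M' in simp)
    also have "M * (M' * P) = (M * M') * P" using assoc_mult_mat[OF M M' P] by simp
    also have "\<dots> = c \<cdot>\<^sub>m P" using P unfolding MM' by (subst mult_smult_assoc_mat[of _ n n _ m]) auto
    finally show ?thesis .
  qed
  have QMP: "Q * (M' * P) \<in> carrier_mat m m" and MP': "M' * P \<in> carrier_mat n m"
    using mult_carrier_mat[OF M' P] mult_carrier_mat[OF Q mult_carrier_mat[OF M' P]] by simp_all
  have cm: "c \<cdot>\<^sub>m 1\<^sub>m m \<in> carrier_mat m m" by (rule smult_carrier_mat) simp
  have QP: "Q * - (M' * P) = - (Q * (M' * P))"
    by (rule uminus_mult_right_mat) (use Q M' in simp)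
  have "B * F = four_block_mat (M * 1\<^sub>m n + P * 0\<^sub>m m n) (M * - (M' * P) + P * (c \<cdot>\<^sub>m 1\<^sub>m m))
      (Q * 1\<^sub>m n + 1\<^sub>m m * 0\<^sub>m m n) (Q * - (M' * P) + 1\<^sub>m m * (c \<cdot>\<^sub>m 1\<^sub>m m))"
    unfolding B_def F_def
    by (rule mult_four_block_mat[OF M P Q one_carrier_mat])
      (rule one_carrier_mat uminus_carrier_mat[OF MP'] zero_carrier_mat cm)+
  also have "\<dots> = four_block_mat M (0\<^sub>m n m) Q (c \<cdot>\<^sub>m 1\<^sub>m m - Q * (M' * P))"
  proof (rule cong_four_block_mat)
    show "M * 1\<^sub>m n + P * 0\<^sub>m m n = M" using M P by simp
    show "Q * 1\<^sub>m n + 1\<^sub>m m * 0\<^sub>m m n = Q" using Q by simp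
    have "P * (c \<cdot>\<^sub>m 1\<^sub>m m) = c \<cdot>\<^sub>m P"
      using P by (simp add: mult_smult_distrib[of _ n m _ m])
    then show "M * - (M' * P) + P * (c \<cdot>\<^sub>m 1\<^sub>m m) = 0\<^sub>m n m"
      unfolding MP by (intro eq_matI) (use P in auto)
    have "1\<^sub>m m * (c \<cdot>\<^sub>m 1\<^sub>m m) = c \<cdot>\<^sub>m 1\<^sub>m m" by (rule left_mult_one_mat[OF cm])
    then show "Q * - (M' * P) + 1\<^sub>m m * (c \<cdot>\<^sub>m 1\<^sub>m m) = c \<cdot>\<^sub>m 1\<^sub>m m - Q * (M' * P)"
      unfolding QP
      by (simp add: minus_add_uminus_mat[OF cm QMP] comm_add_mat[OF uminus_carrier_mat[OF QMP] cm])
  qed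
  finally have BF: "det (B * F) = det M * det (c \<cdot>\<^sub>m 1\<^sub>m m - Q * (M' * P))"
    using M Q QMP
    by (simp add: det_four_block_mat_upper_right_zero[of _ n _ m] minus_carrier_mat)
  have "det (M - P * Q) * c ^ m = det (B * E) * det F" by (simp only: BE detF)
  also have "\<dots> = det B * det F"
    unfolding det_mult[OF carr(1,2)] detE by simp
  also have "\<dots> = det (B * F)" using carr by (simp add: det_mult)
  finally show ?thesis unfolding BF .
qed

section \<open>The determinant of a Grover matrix\<close>

lemma sum_if_eq_mult:
  fixes h :: "'i \<Rightarrow> 'a :: comm_ring_1"
  assumes "finite A" "a \<in> A"
  shows "(\<Sum>x\<in>A. (if a = x then c else 0) * h x) = c * h a"
    and "(\<Sum>x\<in>A. (if x = a then c else 0) * h x) = c * h a"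
proof -
  have "(\<Sum>x\<in>A. (if a = x then c else 0) * h x) = (\<Sum>x\<in>A. if a = x then c * h x else 0)"
    by (rule sum.cong) auto
  then show 1: "(\<Sum>x\<in>A. (if a = x then c else 0) * h x) = c * h a"
    using assms by simp
  then show "(\<Sum>x\<in>A. (if x = a then c else 0) * h x) = c * h a"
    by (simp add: eq_commute[of a])
qed

lemma mat_of_diag_mult:
  fixes d :: "'i \<Rightarrow> 'a :: comm_ring_1"
  assumes "distinct xs"
  shows "mat_of xs xs (\<lambda>x y. if x = y then d x else 0) * mat_of xs ys f = mat_of xs ys (\<lambda>x y. d x * f x y)"
    and "mat_of ys xs g * mat_of xs xs (\<lambda>x y. if x = y then d x else 0) = mat_of ys xs (\<lambda>x y. g x y * d y)"
proof -
  show "mat_of xs xs (\<lambda>x y. if x = y then d x else 0) * mat_of xs ys f = mat_of xs ys (\<lambda>x y. d x * f x y)"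
    unfolding mat_of_mult[OF assms] by (rule mat_of_cong) (simp add: sum_if_eq_mult)
  have *: "(\<Sum>y\<in>set xs. g x y * (if y = z then d y else 0)) = g x z * d z" if "z \<in> set xs" for x z
  proof -
    have "(\<Sum>y\<in>set xs. g x y * (if y = z then d y else 0)) = (\<Sum>y\<in>set xs. (if y = z then d z else 0) * g x y)"
      by (rule sum.cong) auto
    also have "\<dots> = d z * g x z" using that by (simp only: sum_if_eq_mult List.finite_set)
    finally show ?thesis by (simp only: mult.commute)
  qed
  show "mat_of ys xs g * mat_of xs xs (\<lambda>x y. if x = y then d x else 0) = mat_of ys xs (\<lambda>x y. g x y * d y)"
    unfolding mat_of_mult[OF assms] by (rule mat_of_cong) (simp add: *)
qed

text \<open>With J the permutation matrix of \<open>arev\<close>, \<open>M 1\<close> is A + J and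
  \<open>M (- 1)\<close> is A - J. Grouping edges into inverse pairs would show \<open>L\<close>
  blocks of determinant A^2 - 1; the proof gets the same value without reordering the list.\<close>

lemma det_involution:
  fixes arev :: "'e \<Rightarrow> 'e" and es :: "'e list"
  assumes es: "distinct es"
    and rev: "\<And>e. e \<in> set es \<Longrightarrow> arev e \<in> set es" "\<And>e. e \<in> set es \<Longrightarrow> arev e \<noteq> e"
      "\<And>e. e \<in> set es \<Longrightarrow> arev (arev e) = e"
    and len: "length es = 2 * L"
  defines "M \<equiv> \<lambda>s. mat_of es es (\<lambda>e f. (if e = f then [:0, 1:] else 0) + (if f = arev e then [:s:] else 0))"
  shows "M 1 * M (- 1 :: 'a :: field_char_0) = [:-1, 0, 1:] \<cdot>\<^sub>m 1\<^sub>m (length es)"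
    and "det (M (1 :: 'a)) = [:-1, 0, 1:] ^ L"
proof -
  let ?X = "[:0, 1:] :: 'a poly"
  show M: "M 1 * M (- 1 :: 'a) = [:-1, 0, 1:] \<cdot>\<^sub>m 1\<^sub>m (length es)"
    unfolding M_def mat_of_mult[OF es] mat_of_one[OF es]
  proof (rule mat_of_cong)
    fix e f assume ef: "e \<in> set es" "f \<in> set es"
    have "(\<Sum>g\<in>set es. ((if e = g then ?X else 0) + (if g = arev e then [:1:] else 0)) *
          ((if g = f then ?X else 0) + (if f = arev g then [:- 1:] else 0))) =
        ?X * ((if e = f then ?X else 0) + (if f = arev e then [:- 1:] else 0)) +
        [:1:] * ((if arev e = f then ?X else 0) + (if f = arev (arev e) then [:- 1:] else 0))"
      unfolding distrib_right[of "if e = _ then ?X else 0"] sum.distrib using ef rev(1)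
      by (simp only: sum_if_eq_mult List.finite_set)
    also have "\<dots> = (if e = f then [:-1, 0, 1:] else 0)"
      using rev(2)[OF ef(1)] rev(3)[OF ef(1)] by (auto simp: one_pCons)
    finally show "(\<Sum>g\<in>set es. ((if e = g then ?X else 0) + (if g = arev e then [:1:] else 0)) *
          ((if g = f then ?X else 0) + (if f = arev g then [:- 1:] else 0))) =
        (if e = f then [:-1, 0, 1:] else 0)" .
  qed
  txt \<open>
    Conjugation by the signs of an orientation turns $J$ into $-J$; together with the product
    formula above this determines the determinant up to sign.
  \<close>
  define \<epsilon> where "\<epsilon> e = (if e = (SOME x. x \<in> {e, arev e}) then 1 else - 1 :: 'a poly)" for e
  have \<epsilon>_sq: "\<epsilon> e * \<epsilon> e = 1" for e by (simp add: \<epsilon>_def)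
  have \<epsilon>_rev: "\<epsilon> (arev e) = - \<epsilon> e" if "e \<in> set es" for e
  proof -
    define s where "s = (SOME x. x \<in> {e, arev e})"
    have "s \<in> {e, arev e}" unfolding s_def by (rule someI[of _ e]) simp
    \<comment> \<open>The choice is made from the unordered pair, so \<open>e\<close> and
      \<open>arev e\<close> share the chosen element and receive opposite signs.\<close>
    moreover have "{arev e, arev (arev e)} = {e, arev e}" using rev(3)[OF that] by auto
    then have "\<epsilon> (arev e) = (if arev e = s then 1 else - 1)" by (simp only: \<epsilon>_def s_def)
    moreover have "\<epsilon> e = (if e = s then 1 else - 1)" by (simp only: \<epsilon>_def s_def)
    ultimately show ?thesis using rev(2)[OF that] by auto
  qed
  define D where "D = mat_of es es (\<lambda>e f. if e = f then \<epsilon> e else 0)"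
  have "D * D = mat_of es es (\<lambda>e f. if e = f then 1 else 0)"
    unfolding D_def mat_of_diag_mult(1)[OF es] by (rule mat_of_cong) (simp add: \<epsilon>_sq)
  also have "\<dots> = 1\<^sub>m (length es)"
    unfolding mat_of_one[OF es, symmetric] by (rule eq_matI) auto
  finally have DD: "D * D = 1\<^sub>m (length es)" .
  have DMD: "D * M 1 * D = M (- 1)"
    unfolding D_def M_def mat_of_diag_mult[OF es]
  proof (rule mat_of_cong)
    fix e f assume ef: "e \<in> set es" "f \<in> set es"
    have "\<epsilon> e * [:1:] * \<epsilon> (arev e) = [:- 1:]"
      unfolding \<epsilon>_rev[OF ef(1)] using \<epsilon>_sq[of e] by (simp add: one_pCons)
    moreover have "\<epsilon> e * ?X * \<epsilon> e = ?X" using \<epsilon>_sq[of e] by (simp add: mult.commute mult.left_commute)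
    ultimately show "\<epsilon> e * ((if e = f then ?X else 0) + (if f = arev e then [:1:] else 0)) * \<epsilon> f =
        (if e = f then ?X else 0) + (if f = arev e then [:- 1:] else 0)"
      using rev(2)[OF ef(1)] by auto
  qed
  have carr: "M s \<in> carrier_mat (length es) (length es)" "D \<in> carrier_mat (length es) (length es)" for s
    by (simp_all add: M_def D_def)
  have "det (D * M 1 * D) = det (D * D) * det (M 1)"
    unfolding det_mult[OF mult_carrier_mat[OF carr(2,1)] carr(2)] det_mult[OF carr(2,1)] det_mult[OF carr(2,2)]
    by (simp only: ac_simps)
  then have "det (M (- 1)) = det (M 1)" by (simp add: DMD DD)
  moreover have "det (M 1) * det (M (- 1)) = [:-1, 0, 1:] ^ length es"
    unfolding det_mult[OF carr(1) carr(1), symmetric] M by simp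
  ultimately have "(det (M 1))\<^sup>2 = ([:-1, 0, 1:] ^ L)\<^sup>2"
    by (simp only: power2_eq_square len mult_2 power_add)
  then have "det (M 1) = [:-1, 0, 1:] ^ L \<or> det (M 1) = - ([:-1, 0, 1:] ^ L)"
    by (rule power2_eq_iff[THEN iffD1])
  \<comment> \<open>The sign is decided here: A + J is the characteristic matrix of -J, so its
    determinant is monic.\<close>
  moreover have "lead_coeff (det (M 1)) = 1"
  proof -
    have "M 1 = char_poly_matrix (mat_of es es (\<lambda>e f. if f = arev e then - 1 else 0))"
    proof (rule eq_matI)
      fix i j assume "i < dim_row (char_poly_matrix (mat_of es es (\<lambda>e f. if f = arev e then - 1 else 0 :: 'a)))"
        "j < dim_col (char_poly_matrix (mat_of es es (\<lambda>e f. if f = arev e then - 1 else 0 :: 'a)))"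
      then have ij: "i < length es" "j < length es" by (simp_all add: char_poly_matrix_def)
      then show "M 1 $$ (i, j) = char_poly_matrix (mat_of es es (\<lambda>e f. if f = arev e then - 1 else 0)) $$ (i, j)"
        by (simp add: M_def char_poly_matrix_def mat_of_def nth_eq_iff_index_eq[OF es] split del: if_split)
          (cases "i = j"; cases "es ! j = arev (es ! i)"; simp)
    qed (simp_all add: M_def char_poly_matrix_def)
    then have "det (M 1) = char_poly (mat_of es es (\<lambda>e f. if f = arev e then - 1 else 0))"
      by (simp add: char_poly_def)
    then show ?thesis
      using degree_monic_char_poly[OF mat_of_carrier[of es es "\<lambda>e f. if f = arev e then - 1 else 0 :: 'a"]]
      by simp
  qed
  moreover have "lead_coeff ([:-1, 0, 1:] ^ L :: 'a poly) = 1" by (subst lead_coeff_power) simp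
  ultimately show "det (M 1) = [:-1, 0, 1:] ^ L"
    by (metis add.inverse_inverse lead_coeff_minus one_neq_neg_one)
qed

text \<open>The scaled Schur complement with c = A^2 - 1. The product
  \<open>Q * (M (- 1) * P)\<close> equals A W - 2 I: the part of A - J along A counts edges between
  two vertices, while J moves the origin to the terminus and leaves the total weight of the edges
  ending at a vertex. Powers of A^2 - 1 stand on both sides so that no division occurs.\<close>

lemma det_grover_matrix:
  fixes G :: "('v, 'e) pre_digraph" and arev :: "'e \<Rightarrow> 'e"
  assumes es: "distinct es" "set es = arcs G" and vs: "distinct vs" "set vs = verts G"
    and tail: "\<And>e. e \<in> arcs G \<Longrightarrow> tail G e \<in> verts G"
    and rev: "\<And>e. e \<in> arcs G \<Longrightarrow> arev e \<in> arcs G" "\<And>e. e \<in> arcs G \<Longrightarrow> arev e \<noteq> e"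
      "\<And>e. e \<in> arcs G \<Longrightarrow> arev (arev e) = e" "\<And>e. e \<in> arcs G \<Longrightarrow> tail G (arev e) = head G e"
    and deg: "\<And>v. v \<in> verts G \<Longrightarrow> 1 \<le> out_degree G v"
    and len: "length es = 2 * L"
  shows "det ([:0, 1:] \<cdot>\<^sub>m 1\<^sub>m (length es) - map_mat (\<lambda>c. [:c:]) (grover_matrix G arev es :: 'a :: field_char_0 mat))
      * [:-1, 0, 1:] ^ length vs =
    [:-1, 0, 1:] ^ L * det (mat_of vs vs (\<lambda>v w. (if v = w then [:1, 0, 1:] else 0) -
      [:0, 1:] * [:\<Sum>e | e \<in> arcs G \<and> tail G e = v \<and> head G e = w. grover_weight G e:]))"
proof -
  let ?X = "[:0, 1:] :: 'a poly"
  define d :: "'v \<Rightarrow> 'a" where "d v = 2 / of_nat (out_degree G v)" for v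
  define M where "M s = mat_of es es (\<lambda>e f. (if e = f then ?X else 0) + (if f = arev e then [:s:] else 0))" for s :: 'a
  define P where "P = mat_of es vs (\<lambda>e v. if tail G e = v then 1 else 0 :: 'a poly)"
  define Q where "Q = mat_of vs es (\<lambda>v f. if head G f = v then [:d v:] else 0)"
  have fin: "finite (arcs G)" using es by (metis List.finite_set)
  have head: "head G e \<in> verts G" "head G (arev e) = tail G e" if "e \<in> arcs G" for e
    using tail[of "arev e"] rev(1,4)[OF that] rev(4)[of "arev e"] rev(3)[OF that] by simp_all
  have carr: "M s \<in> carrier_mat (length es) (length es)" "P \<in> carrier_mat (length es) (length vs)"
    "Q \<in> carrier_mat (length vs) (length es)" for s
    by (simp_all add: M_def P_def Q_def)
  have PQ: "P * Q = mat_of es es (\<lambda>e f. if head G f = tail G e then [:d (tail G e):] else 0)"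
    unfolding P_def Q_def mat_of_mult[OF vs(1)]
    by (rule mat_of_cong) (use es tail in \<open>simp add: sum_if_eq_mult vs(2)[symmetric] eq_commute[of "head G _"]\<close>)
  have grover: "grover_matrix G arev es = mat_of es es (\<lambda>e f. if head G f = tail G e
      then 2 / of_nat (out_degree G (head G f)) - (if f = arev e then 1 else 0) else (0 :: 'a))"
    by (simp add: grover_matrix_def mat_of_def Let_def)
  have MPQ: "?X \<cdot>\<^sub>m 1\<^sub>m (length es) - map_mat (\<lambda>c. [:c:]) (grover_matrix G arev es) = M 1 - P * Q"
    unfolding M_def mat_of_one[OF es(1)] grover map_mat_mat_of PQ mat_of_minus
  proof (rule mat_of_cong)
    fix e f assume ef: "e \<in> set es" "f \<in> set es"
    \<comment> \<open>The Grover entry subtracts 1 only inside the branch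
      \<open>head G f = tail G e\<close>; as \<open>arev e\<close> always satisfies that condition,
      J splits off as a separate summand.\<close>
    have "head G f = tail G e" if "f = arev e" using ef es rev that by metis
    then show "(if e = f then ?X else 0) -
        [:if head G f = tail G e then 2 / of_nat (out_degree G (head G f)) - (if f = arev e then 1 else 0) else 0:] =
        (if e = f then ?X else 0) + (if f = arev e then [:1:] else 0) -
        (if head G f = tail G e then [:d (tail G e):] else 0)"
      by (auto simp: d_def one_pCons)
  qed
  have inv: "M 1 * M (- 1) = [:-1, 0, 1:] \<cdot>\<^sub>m 1\<^sub>m (length es)" "det (M 1) = [:-1, 0, 1:] ^ L"
    unfolding M_def
    by (rule det_involution[where arev = arev]; use es rev len in simp)+
  have MP: "M (- 1) * P = mat_of es vs (\<lambda>e w. (if tail G e = w then ?X else 0) - (if head G e = w then 1 else 0))"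
    unfolding M_def P_def mat_of_mult[OF es(1)]
  proof (rule mat_of_cong)
    fix e w assume "e \<in> set es"
    then have e: "e \<in> arcs G" "arev e \<in> arcs G" using es rev(1) by auto
    have "(\<Sum>g\<in>arcs G. ((if e = g then ?X else 0) + (if g = arev e then [:- 1:] else 0)) *
          (if tail G g = w then 1 else 0)) =
        ?X * (if tail G e = w then 1 else 0) + [:- 1:] * (if tail G (arev e) = w then 1 else 0)"
      unfolding distrib_right sum.distrib by (simp only: sum_if_eq_mult fin e)
    then show "(\<Sum>g\<in>set es. ((if e = g then ?X else 0) + (if g = arev e then [:- 1:] else 0)) *
          (if tail G g = w then 1 else 0)) =
        (if tail G e = w then ?X else 0) - (if head G e = w then 1 else 0)"
      by (simp add: rev(4)[OF e(1)] es(2) one_pCons)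
  qed
  have "[:-1, 0, 1:] \<cdot>\<^sub>m 1\<^sub>m (length vs) - Q * (M (- 1) * P) =
      mat_of vs vs (\<lambda>v w. (if v = w then [:1, 0, 1:] else 0) -
      ?X * [:\<Sum>e | e \<in> arcs G \<and> tail G e = v \<and> head G e = w. grover_weight G e:])"
    unfolding MP unfolding Q_def mat_of_mult[OF es(1)] mat_of_one[OF vs(1)] mat_of_minus
  proof (rule mat_of_cong)
    fix v w assume vw: "v \<in> set vs" "w \<in> set vs"
    \<comment> \<open>Inversion exchanges edges ending at \<open>v\<close> with edges starting
      there. This makes the in-degree equal to the out-degree and turns the weights in
      \<open>Q\<close>, attached to termini, into Grover weights, attached to origins.\<close>
    have card_in: "card {e \<in> arcs G. head G e = v \<and> Pr (tail G e)} = card {e \<in> arcs G. tail G e = v \<and> Pr (head G e)}" for Pr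
      by (rule bij_betw_same_card[of arev], rule bij_betw_byWitness[of _ arev])
        (use rev(1) in \<open>simp_all add: rev(3,4) head(2) image_subset_iff\<close>)
    have nz: "of_nat (out_degree G v) \<noteq> (0 :: 'a)" using deg[of v] vw vs by simp
    have "(\<Sum>y\<in>set es. (if head G y = v then [:d v:] else 0) *
            ((if tail G y = w then ?X else 0) - (if head G y = w then 1 else 0))) =
        (\<Sum>y\<in>arcs G. if head G y = v \<and> tail G y = w then [:d v:] * ?X else 0) -
        (\<Sum>y\<in>arcs G. if head G y = v \<and> v = w then [:d v:] else 0)"
      unfolding es sum_subtractf[symmetric] by (rule sum.cong) (auto simp: algebra_simps)
    moreover have "(\<Sum>y\<in>arcs G. if head G y = v \<and> tail G y = w then [:d v:] * ?X else 0) =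
        of_nat (card {e \<in> arcs G. tail G e = v \<and> head G e = w}) * ([:d v:] * ?X)"
      unfolding card_in[of "\<lambda>x. x = w", symmetric] sum.inter_filter[OF fin, symmetric] sum_constant ..
    moreover have "(\<Sum>y\<in>arcs G. if head G y = v \<and> v = w then [:d v:] else 0) = (if v = w then [:2:] else 0)"
    proof -
      have "(\<Sum>y\<in>arcs G. if head G y = v then [:d v:] else 0) =
          of_nat (card {e \<in> arcs G. head G e = v}) * [:d v:]"
        unfolding sum.inter_filter[OF fin, symmetric] sum_constant ..
      also have "card {e \<in> arcs G. head G e = v} = out_degree G v"
        using card_in[of "\<lambda>_. True"] by (simp add: out_degree_def out_arcs_def)
      also have "of_nat (out_degree G v) * [:d v:] = [:2:]"
        using nz by (simp add: d_def of_nat_poly)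
      finally show ?thesis by (cases "v = w") simp_all
    qed
    ultimately have QMP: "(\<Sum>y\<in>set es. (if head G y = v then [:d v:] else 0) *
            ((if tail G y = w then ?X else 0) - (if head G y = w then 1 else 0))) =
        of_nat (card {e \<in> arcs G. tail G e = v \<and> head G e = w}) * ([:d v:] * ?X) - (if v = w then [:2:] else 0)"
      by (simp only:)
    have W: "[:\<Sum>e | e \<in> arcs G \<and> tail G e = v \<and> head G e = w. grover_weight G e:] =
        of_nat (card {e \<in> arcs G. tail G e = v \<and> head G e = w}) * [:d v:]"
    proof -
      have "(\<Sum>e | e \<in> arcs G \<and> tail G e = v \<and> head G e = w. grover_weight G e) =
          (\<Sum>e | e \<in> arcs G \<and> tail G e = v \<and> head G e = w. d v)"
        by (rule sum.cong) (auto simp: grover_weight_def d_def)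
      then show ?thesis by (simp add: of_nat_poly)
    qed
    \<comment> \<open>The 2 is the total weight of the edges ending at a vertex: as many as its
      degree, each of weight 2 divided by the degree. It changes A^2 - 1 into A^2 + 1.\<close>
    have 1: "[:1, 0, 1:] = [:-1, 0, 1:] + [:2 :: 'a:]" by simp
    show "(if v = w then [:-1, 0, 1:] else 0) - (\<Sum>y\<in>set es. (if head G y = v then [:d v:] else 0) *
            ((if tail G y = w then ?X else 0) - (if head G y = w then 1 else 0))) =
        (if v = w then [:1, 0, 1:] else 0) -
      ?X * [:\<Sum>e | e \<in> arcs G \<and> tail G e = v \<and> head G e = w. grover_weight G e:]"
      unfolding QMP W 1 by (cases "v = w") (simp_all only: algebra_simps if_True if_False refl add_0)
  qed
  then show ?thesis
    using det_minus_mult_scaled[OF carr(1,1,2,3) inv(1)] by (simp add: MPQ inv(2))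
qed

section \<open>Integrality over the $p$-adic integers\<close>

definition padic_of :: "'p :: prime_card padic_int \<Rightarrow> 'p padic_closure" where
  "padic_of c = to_ac (to_fract c)"

interpretation padic_of: inj_comm_ring_hom "padic_of :: 'p :: prime_card padic_int \<Rightarrow> _"
  by unfold_locales (auto simp: padic_of_def)

declare padic_of.hom_zero [simp] padic_of.hom_one [simp]

lemma to_fract_of_nat [simp]: "to_fract (of_nat n) = of_nat n"
  by (induction n) simp_all

lemma padic_of_of_nat [simp]: "padic_of (of_nat n) = of_nat n"
  by (simp add: padic_of_def)

text \<open>The determinant trick: \<open>f\<close> is a nonzero eigenvector with eigenvalue
  \<open>x\<close> of a matrix over the p-adic integers, so \<open>x\<close> is a root of the monic
  characteristic polynomial.\<close>

lemma padic_integralI_matrix: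
  fixes f :: "'i \<Rightarrow> 'p :: prime_card padic_closure"
  assumes I: "finite I" and nz: "i0 \<in> I" "f i0 \<noteq> 0"
    and eq: "\<And>i. i \<in> I \<Longrightarrow> x * f i = (\<Sum>j\<in>I. padic_of (c i j) * f j)"
  shows "padic_integral x"
proof -
  obtain js where js: "set js = I" "distinct js" using finite_distinct_list[OF I] by blast
  let ?n = "length js"
  define A where "A = mat_of js js c"
  define v where "v = vec ?n (\<lambda>i. f (js ! i))"
  have A: "A \<in> carrier_mat ?n ?n" and hA: "map_mat padic_of A \<in> carrier_mat ?n ?n" by (simp_all add: A_def)
  obtain k where k: "k < ?n" "js ! k = i0" using nz(1) js(1) by (auto simp: in_set_conv_nth)
  have "v $ k \<noteq> 0" using k nz by (simp add: v_def)
  then have "v \<noteq> 0\<^sub>v ?n" using k(1) by auto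
  moreover have "map_mat padic_of A *\<^sub>v v = x \<cdot>\<^sub>v v"
  proof (rule eq_vecI)
    fix i assume "i < dim_vec (x \<cdot>\<^sub>v v)"
    then have i: "i < ?n" by (simp add: v_def)
    then have "js ! i \<in> I" using js(1) nth_mem by blast
    then have "(x \<cdot>\<^sub>v v) $ i = (\<Sum>j\<in>set js. padic_of (c (js ! i) j) * f j)"
      unfolding js(1) using eq[of "js ! i"] i by (simp add: v_def)
    also have "\<dots> = (\<Sum>j<?n. padic_of (c (js ! i) (js ! j)) * f (js ! j))"
      using sum.reindex_bij_betw[OF bij_betw_nth[OF js(2) refl refl],
          where g = "\<lambda>j. padic_of (c (js ! i) j) * f j"] by simp
    also have "\<dots> = (map_mat padic_of A *\<^sub>v v) $ i"
      using i by (simp add: A_def mat_of_def v_def scalar_prod_def atLeast0LessThan)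
    finally show "(map_mat padic_of A *\<^sub>v v) $ i = (x \<cdot>\<^sub>v v) $ i" ..
  qed (simp add: A_def v_def)
  ultimately have "eigenvalue (map_mat padic_of A) x"
    unfolding eigenvalue_def eigenvector_def using hA by (intro exI[of _ v]) (auto simp: v_def A_def)
  then have "poly (map_poly padic_of (char_poly A)) x = 0"
    using eigenvalue_root_char_poly[OF hA] padic_of.char_poly_hom[OF A] by simp
  then show ?thesis
    unfolding padic_integral_def using degree_monic_char_poly[OF A]
    by (intro exI[of _ "char_poly A"]) (simp add: padic_of_def[abs_def])
qed

definition padic_span :: "'i set \<Rightarrow> ('i \<Rightarrow> 'p :: prime_card padic_closure) \<Rightarrow> 'p padic_closure set" where
  "padic_span I f = range (\<lambda>c. \<Sum>i\<in>I. padic_of (c i) * f i)"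

lemma padic_spanI: "x = (\<Sum>i\<in>I. padic_of (c i) * f i) \<Longrightarrow> x \<in> padic_span I f"
  by (auto simp: padic_span_def)

lemma padic_span_base:
  assumes "finite I" "i \<in> I"
  shows "f i \<in> padic_span I f"
proof -
  have "f i = (\<Sum>j\<in>I. padic_of (if j = i then 1 else 0) * f j)"
    using assms by (simp add: if_distrib[of padic_of] sum_if_eq_mult cong: if_cong)
  then show ?thesis by (rule padic_spanI)
qed

lemma padic_span_add:
  assumes "x \<in> padic_span I f" "y \<in> padic_span I f"
  shows "x + y \<in> padic_span I f"
proof -
  obtain c d where cd: "x = (\<Sum>i\<in>I. padic_of (c i) * f i)" "y = (\<Sum>i\<in>I. padic_of (d i) * f i)"
    using assms unfolding padic_span_def by blast
  then have "x + y = (\<Sum>i\<in>I. padic_of (c i + d i) * f i)"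
    by (simp add: sum.distrib distrib_right padic_of.hom_add)
  then show ?thesis by (rule padic_spanI)
qed

lemma padic_span_scale:
  assumes "x \<in> padic_span I f"
  shows "padic_of a * x \<in> padic_span I f"
proof -
  obtain c where c: "x = (\<Sum>i\<in>I. padic_of (c i) * f i)"
    using assms unfolding padic_span_def by blast
  then have "padic_of a * x = (\<Sum>i\<in>I. padic_of (a * c i) * f i)"
    by (simp add: sum_distrib_left padic_of.hom_mult mult.assoc)
  then show ?thesis by (rule padic_spanI)
qed

lemma padic_span_0: "0 \<in> padic_span I f"
  by (rule padic_spanI[where c = "\<lambda>_. 0"]) simp

lemma padic_span_sum:
  assumes "\<And>a. a \<in> A \<Longrightarrow> g a \<in> padic_span I f"
  shows "(\<Sum>a\<in>A. padic_of (c a) * g a) \<in> padic_span I f"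
  using assms by (induction A rule: infinite_finite_induct)
    (auto intro: padic_span_add padic_span_scale padic_span_0)

text \<open>The module criterion for integrality: a nonzero finitely generated module over the
  p-adic integers that \<open>x\<close> maps into itself supplies the matrix, one row of
  coefficients for each generator.\<close>

lemma padic_integralI_span:
  assumes "finite I" "i0 \<in> I" "f i0 \<noteq> 0" and "\<And>i. i \<in> I \<Longrightarrow> x * f i \<in> padic_span I f"
  shows "padic_integral x"
proof -
  have "\<forall>i\<in>I. \<exists>c. x * f i = (\<Sum>j\<in>I. padic_of (c j) * f j)"
    using assms(4) unfolding padic_span_def by blast
  then obtain c where "\<And>i. i \<in> I \<Longrightarrow> x * f i = (\<Sum>j\<in>I. padic_of (c i j) * f j)" by metis
  then show ?thesis by (rule padic_integralI_matrix[where f = f, OF assms(1,2,3)])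
qed

text \<open>The rewriting form of a monic equation. The exponent \<open>m\<close> is positive
  because a monic polynomial of degree 0 has no root.\<close>

lemma padic_integral_power_eq:
  assumes "padic_integral x"
  obtains m c where "0 < m" "x ^ m = (\<Sum>i<m. padic_of (c i) * x ^ i)"
proof -
  obtain q :: "'a padic_int poly" where q: "lead_coeff q = 1" "poly (map_poly padic_of q) x = 0"
    using assms unfolding padic_integral_def padic_of_def[abs_def] by blast
  define m where "m = degree q"
  have "poly (map_poly padic_of q) x = (\<Sum>i\<le>m. padic_of (coeff q i) * x ^ i)"
    unfolding poly_altdef by (simp add: m_def coeff_map_poly)
  also have "\<dots> = x ^ m + (\<Sum>i<m. padic_of (coeff q i) * x ^ i)"
    unfolding lessThan_Suc_atMost[symmetric] sum.lessThan_Suc using q(1) by (simp add: m_def)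
  finally have eq: "x ^ m + (\<Sum>i<m. padic_of (coeff q i) * x ^ i) = 0" using q(2) by simp
  then have "0 < m" by (cases m) auto
  moreover have "x ^ m = (\<Sum>i<m. padic_of (- coeff q i) * x ^ i)"
    using eq by (simp only: padic_of.hom_uminus mult_minus_left sum_negf eq_neg_iff_add_eq_0)
  ultimately show thesis by (rule that)
qed

text \<open>The monomials \<open>x ^ i * y ^ j\<close> below the degrees of the two monic equations
  span a module stable under both \<open>x\<close> and \<open>y\<close>, hence under their sum and
  product.\<close>

lemma padic_integral_add_mult:
  assumes "padic_integral x" "padic_integral y"
  shows "padic_integral (x + y)" "padic_integral (x * y)"
proof -
  obtain m c where m: "0 < m" "x ^ m = (\<Sum>i<m. padic_of (c i) * x ^ i)"
    using padic_integral_power_eq[OF assms(1)] .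
  obtain n d where n: "0 < n" "y ^ n = (\<Sum>i<n. padic_of (d i) * y ^ i)"
    using padic_integral_power_eq[OF assms(2)] .
  define I where "I = {..<m} \<times> {..<n}"
  define f where "f = (\<lambda>(i, j). x ^ i * y ^ j)"
  have I: "finite I" by (simp add: I_def)
  have x: "x * f i \<in> padic_span I f" if "i \<in> I" for i
  proof -
    obtain a b where i: "i = (a, b)" "a < m" "b < n" using \<open>i \<in> I\<close> unfolding I_def by (cases i) auto
    show ?thesis
    proof (cases "Suc a < m")
      case True
      then have "f (Suc a, b) \<in> padic_span I f" using i by (intro padic_span_base I) (simp add: I_def)
      then show ?thesis by (simp add: i f_def mult.assoc)
    next
      case False
      then have "Suc a = m" using i by simp
      then have "x * f i = x ^ m * y ^ b" by (auto simp: i f_def)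
      also have "\<dots> = (\<Sum>k<m. padic_of (c k) * f (k, b))"
        by (simp add: m(2) sum_distrib_right f_def mult.assoc)
      also have "\<dots> \<in> padic_span I f"
        using i by (intro padic_span_sum padic_span_base I) (simp add: I_def)
      finally show ?thesis .
    qed
  qed
  have y: "y * f i \<in> padic_span I f" if "i \<in> I" for i
  proof -
    obtain a b where i: "i = (a, b)" "a < m" "b < n" using \<open>i \<in> I\<close> unfolding I_def by (cases i) auto
    show ?thesis
    proof (cases "Suc b < n")
      case True
      then have "f (a, Suc b) \<in> padic_span I f" using i by (intro padic_span_base I) (simp add: I_def)
      then show ?thesis by (simp add: i f_def mult.left_commute)
    next
      case False
      then have "Suc b = n" using i by simp
      then have "y * f i = x ^ a * y ^ n" by (auto simp: i f_def)
      also have "\<dots> = (\<Sum>k<n. padic_of (d k) * f (a, k))"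
        by (simp add: n(2) sum_distrib_left f_def mult.left_commute)
      also have "\<dots> \<in> padic_span I f"
        using i by (intro padic_span_sum padic_span_base I) (simp add: I_def)
      finally show ?thesis .
    qed
  qed
  have x': "x * z \<in> padic_span I f" if z: "z \<in> padic_span I f" for z
  proof -
    obtain e where "z = (\<Sum>i\<in>I. padic_of (e i) * f i)" using z unfolding padic_span_def by blast
    then have "x * z = (\<Sum>i\<in>I. padic_of (e i) * (x * f i))"
      by (simp add: sum_distrib_left mult.left_commute)
    then show ?thesis by (simp only:) (rule padic_span_sum, rule x)
  qed
  have 0: "(0, 0) \<in> I" "f (0, 0) \<noteq> 0" using m n by (simp_all add: I_def f_def)
  show "padic_integral (x + y)"
    by (rule padic_integralI_span[where f = f, OF I 0]) (simp add: distrib_right padic_span_add x y)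
  show "padic_integral (x * y)"
    by (rule padic_integralI_span[where f = f, OF I 0]) (simp add: mult.assoc x' y)
qed

lemma padic_integral_padic_of [simp]: "padic_integral (padic_of c)"
  unfolding padic_integral_def
  by (rule exI[of _ "[:- c, 1:]"]) (simp add: padic_of_def[symmetric, abs_def] padic_of.hom_uminus)

lemma padic_integral_of_nat [simp]: "padic_integral (of_nat n)"
  using padic_integral_padic_of[of "of_nat n"] by simp

lemma padic_integral_0 [simp]: "padic_integral 0" and padic_integral_1 [simp]: "padic_integral 1"
  using padic_integral_of_nat[of 0] padic_integral_of_nat[of 1] by simp_all

lemma padic_integral_uminus: "padic_integral x \<Longrightarrow> padic_integral (- x)"
  using padic_integral_add_mult(2)[OF padic_integral_padic_of[of "- 1"]] by (simp add: padic_of.hom_uminus)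

lemma padic_integral_diff: "padic_integral x \<Longrightarrow> padic_integral y \<Longrightarrow> padic_integral (x - y)"
  using padic_integral_add_mult(1)[of x "- y"] padic_integral_uminus[of y] by simp

lemma padic_integral_sum: "(\<And>a. a \<in> A \<Longrightarrow> padic_integral (f a)) \<Longrightarrow> padic_integral (sum f A)"
  by (induction A rule: infinite_finite_induct) (auto intro: padic_integral_add_mult)

lemma padic_integral_prod: "(\<And>a. a \<in> A \<Longrightarrow> padic_integral (f a)) \<Longrightarrow> padic_integral (prod f A)"
  by (induction A rule: infinite_finite_induct) (auto intro: padic_integral_add_mult)

lemma padic_integral_power: "padic_integral x \<Longrightarrow> padic_integral (x ^ n)"
  by (induction n) (auto intro: padic_integral_add_mult)

text \<open>Multiplying a monic equation of degree \<open>m\<close> for 1/p by the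
  \<open>m\<close>-th power of p would write 1 as p times a p-adic integer, which fails modulo p.
  This keeps the neighbourhoods of a point from being the whole field.\<close>

lemma not_padic_integral_inverse_prime:
  "\<not> padic_integral (1 / of_nat CARD('p) :: 'p :: prime_card padic_closure)"
proof
  let ?p = "of_nat CARD('p) :: 'p padic_closure"
  assume "padic_integral (1 / ?p)"
  then obtain m c where m: "0 < m" "(1 / ?p) ^ m = (\<Sum>i<m. padic_of (c i) * (1 / ?p) ^ i)"
    using padic_integral_power_eq by blast
  have p: "?p \<noteq> 0" by simp
  have "padic_of 1 = ?p ^ m * (1 / ?p) ^ m" by (simp add: power_divide)
  also have "\<dots> = (\<Sum>i<m. padic_of (c i) * (?p ^ m * (1 / ?p) ^ i))"
    unfolding m(2) by (simp add: sum_distrib_left mult.left_commute)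
  also have "\<dots> = (\<Sum>i<m. padic_of (of_nat CARD('p) * (c i * of_nat CARD('p) ^ (m - Suc i))))"
  proof (rule sum.cong)
    fix i assume "i \<in> {..<m}"
    then have "m = Suc (m - Suc i) + i" by simp
    then have "?p ^ m = ?p ^ Suc (m - Suc i) * ?p ^ i" by (metis power_add)
    then have "?p ^ m * (1 / ?p) ^ i = ?p * ?p ^ (m - Suc i)"
      using p by (simp only: power_one_over power_Suc) (simp add: divide_simps)
    then show "padic_of (c i) * (?p ^ m * (1 / ?p) ^ i) =
        padic_of (of_nat CARD('p) * (c i * of_nat CARD('p) ^ (m - Suc i)))"
      by (simp only: padic_of.hom_mult padic_of.hom_power padic_of_of_nat mult.left_commute)
  qed simp
  also have "\<dots> = padic_of (of_nat CARD('p) * (\<Sum>i<m. c i * of_nat CARD('p) ^ (m - Suc i)))"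
    by (simp only: padic_of.hom_sum[symmetric] sum_distrib_left)
  finally have "1 = of_nat CARD('p) * (\<Sum>i<m. c i * of_nat CARD('p) ^ (m - Suc i))"
    by (simp only: padic_of.eq_iff)
  then have "padic_residue (1 :: 'p padic_int) 1 =
      padic_residue (of_nat CARD('p) * (\<Sum>i<m. c i * of_nat CARD('p) ^ (m - Suc i))) 1"
    by (rule arg_cong)
  moreover have "1 < int CARD('p)" using prime_gt_1_nat[OF prime_card[where 'a='p]] by simp
  ultimately show False
    by (simp add: times_padic_int.rep_eq one_padic_int.rep_eq padic_residue_of_nat)
qed

section \<open>Divisibility and binomial coefficients in the $p$-adic integers\<close>

lemma padic_int_eqI:
  fixes x y :: "'p :: prime_card padic_int"
  shows "(\<And>n. padic_residue x n = padic_residue y n) \<Longrightarrow> x = y"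
  by (simp add: padic_residue_inject[symmetric] fun_eq_iff)

lemma padic_residue_mod_le:
  fixes x :: "'p :: prime_card padic_int"
  assumes "n \<le> m"
  shows "padic_residue x m mod int CARD('p) ^ n = padic_residue x n"
  using padic_residue_add[of x n "m - n"] assms by simp

lemma padic_residue_nonneg [simp]: "0 \<le> padic_residue (x :: 'p :: prime_card padic_int) n"
  by (metis padic_residue_mod pos_mod_sign zero_less_power of_nat_0_less_iff zero_less_card_finite)

lemma padic_residue_less: "padic_residue (x :: 'p :: prime_card padic_int) n < int CARD('p) ^ n"
  by (metis padic_residue_mod pos_mod_bound zero_less_power of_nat_0_less_iff zero_less_card_finite)

lemma padic_int_of_residues:
  fixes f :: "nat \<Rightarrow> int"
  assumes "\<And>n. f (Suc n) mod int CARD('p :: prime_card) ^ n = f n"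
  obtains x :: "'p :: prime_card padic_int" where "\<And>n. padic_residue x n = f n"
proof
  show "padic_residue (Abs_padic_int f :: 'p padic_int) n = f n" for n
    using assms by (simp add: Abs_padic_int_inverse)
qed

lemma prime_power_dvd_padic_int:
  fixes x :: "'p :: prime_card padic_int"
  assumes "padic_residue x M = 0"
  shows "of_nat CARD('p) ^ M dvd x"
proof -
  let ?p = "int CARD('p)"
  \<comment> \<open>Dividing by the \<open>M\<close>-th power of p uses up \<open>M\<close> digits,
    so residue \<open>n\<close> of the quotient is read off from residue \<open>n + M\<close> of
    \<open>x\<close>.\<close>
  define f where "f n = padic_residue x (n + M) div ?p ^ M" for n
  have p: "?p > 0" by simp
  have "f (Suc n) mod ?p ^ n = f n" for n
  proof -
    have "padic_residue x (Suc n + M) mod (?p ^ M * ?p ^ n) = padic_residue x (n + M)"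
      using padic_residue_mod_le[of "n + M" "Suc n + M" x] by (simp add: power_add mult.commute)
    moreover have "padic_residue x (Suc n + M) mod (?p ^ M * ?p ^ n) div ?p ^ M = f (Suc n) mod ?p ^ n"
      unfolding f_def zmod_zmult2_eq[OF order.strict_implies_order[OF zero_less_power[OF p]]] by simp
    ultimately show ?thesis by (simp add: f_def)
  qed
  then obtain y :: "'p padic_int" where y: "\<And>n. padic_residue y n = f n"
    using padic_int_of_residues by metis
  have "padic_residue (of_nat CARD('p) ^ M * y) n = padic_residue x n" for n
  proof -
    have "?p ^ M dvd padic_residue x (n + M)"
      using padic_residue_mod_le[of M "n + M" x] assms by (simp add: dvd_eq_mod_eq_0)
    then have "padic_residue x (n + M) = ?p ^ M * f n" by (simp add: f_def)
    moreover have "padic_residue (of_nat CARD('p) ^ M * y) n = ?p ^ M * f n mod ?p ^ n"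
      using padic_residue_of_nat[of "CARD('p) ^ M" n, where 'p = 'p]
      by (simp add: times_padic_int.rep_eq y mod_mult_left_eq)
    ultimately show ?thesis using padic_residue_mod_le[of n "n + M" x] by simp
  qed
  then have "of_nat CARD('p) ^ M * y = x" by (rule padic_int_eqI)
  then show ?thesis by (metis dvd_triv_left)
qed

text \<open>A nonzero p-adic integer is a power of p times a unit. The cofactor \<open>b\<close> is
  assembled from inverses of the unit part modulo each power of p. Thus every denominator may be
  replaced by a power of p, the only denominators the topology knows.\<close>

lemma padic_int_dvd_prime_power:
  fixes a :: "'p :: prime_card padic_int"
  assumes "a \<noteq> 0"
  obtains v where "a dvd of_nat CARD('p) ^ v"
proof -
  let ?p = "int CARD('p)"
  obtain K where "\<not> ?p ^ K dvd padic_residue a (K + 0)"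
    using padic_residue_nonzero[OF assms] by metis
  then have K: "\<not> ?p ^ K dvd padic_residue a K" by simp
  define v where "v = multiplicity ?p (padic_residue a K)"
  have nz: "padic_residue a K \<noteq> 0" using K by auto
  have vK: "v < K" using K multiplicity_dvd' unfolding v_def by (metis not_le)
  \<comment> \<open>Index \<open>K\<close> already detects the valuation: later residues agree with
    residue \<open>K\<close> modulo its modulus, and \<open>v < K\<close>, so they all have the same
    exact power of p.\<close>
  have coprime: "\<exists>u. padic_residue a (n + K) = ?p ^ v * u \<and> coprime u (?p ^ n)" for n
  proof -
    have r: "padic_residue a (n + K) mod ?p ^ K = padic_residue a K"
      by (rule padic_residue_mod_le) simp
    have iff: "?p ^ j dvd padic_residue a (n + K) \<longleftrightarrow> ?p ^ j dvd padic_residue a K" if "j \<le> K" for j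
      using r that by (metis dvd_mod_iff le_imp_power_dvd)
    have "?p ^ v dvd padic_residue a (n + K)"
      using iff[of v] vK by (simp add: v_def multiplicity_dvd)
    then obtain u where u: "padic_residue a (n + K) = ?p ^ v * u" by blast
    have "\<not> ?p ^ Suc v dvd padic_residue a K"
    proof
      assume "?p ^ Suc v dvd padic_residue a K"
      then have "Suc v \<le> v"
        unfolding v_def using multiplicity_geI[OF nz, of ?p] prime_card_int[where 'a = 'p] not_prime_unit by blast
      then show False by simp
    qed
    then have "\<not> ?p ^ Suc v dvd padic_residue a (n + K)" using iff[of "Suc v"] vK by simp
    then have "\<not> ?p dvd u" unfolding u power_Suc2 by (auto simp: mult_dvd_mono)
    then have "coprime u (?p ^ n)"
      using prime_imp_coprime[OF prime_card_int[where 'a = 'p]] by (simp add: coprime_commute[of u])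
    with u show ?thesis by blast
  qed
  have "\<exists>b. 0 \<le> b \<and> b < ?p ^ n \<and> [padic_residue a (n + K) * b = ?p ^ v] (mod ?p ^ (n + v))" for n
  proof -
    obtain u where u: "padic_residue a (n + K) = ?p ^ v * u" "coprime u (?p ^ n)" using coprime by blast
    then obtain b where b: "[u * b = 1] (mod ?p ^ n)" using cong_solve_coprime_int by blast
    have "[u * (b mod ?p ^ n) = 1] (mod ?p ^ n)" using b by (simp add: cong_def mod_mult_right_eq)
    then have "[?p ^ v * (u * (b mod ?p ^ n)) = ?p ^ v * 1] (mod ?p ^ v * ?p ^ n)"
      by (simp add: cong_def mult_mod_right[symmetric])
    then show ?thesis
      unfolding u(1) by (intro exI[of _ "b mod ?p ^ n"]) (simp add: power_add ac_simps)
  qed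
  then obtain f where f: "\<And>n. 0 \<le> f n" "\<And>n. f n < ?p ^ n"
    "\<And>n. [padic_residue a (n + K) * f n = ?p ^ v] (mod ?p ^ (n + v))" by metis
  \<comment> \<open>After cancelling the power of p and the unit \<open>u\<close>, the congruence
    determines \<open>f n\<close> modulo the \<open>n\<close>-th power of p, so independently chosen
    inverses are compatible.\<close>
  have "f (Suc n) mod ?p ^ n = f n" for n
  proof -
    obtain u where u: "padic_residue a (n + K) = ?p ^ v * u" "coprime u (?p ^ n)" using coprime by blast
    have "[padic_residue a (Suc n + K) = padic_residue a (n + K)] (mod ?p ^ (n + K))"
      using padic_residue_mod_le[of "n + K" "Suc n + K" a] by (simp add: cong_def)
    then have "[padic_residue a (Suc n + K) = padic_residue a (n + K)] (mod ?p ^ (n + v))"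
      by (rule cong_dvd_modulus[OF _ le_imp_power_dvd]) (use vK in simp)
    from cong_mult[OF cong_sym[OF this] cong_refl]
    have "[padic_residue a (n + K) * f (Suc n) = padic_residue a (Suc n + K) * f (Suc n)] (mod ?p ^ (n + v))"
      .
    also have "[padic_residue a (Suc n + K) * f (Suc n) = ?p ^ v] (mod ?p ^ (n + v))"
      using f(3)[of "Suc n"] by (rule cong_dvd_modulus[OF _ le_imp_power_dvd]) simp
    also have "[?p ^ v = padic_residue a (n + K) * f n] (mod ?p ^ (n + v))"
      using f(3)[of n] by (rule cong_sym)
    finally have "?p ^ v * ?p ^ n dvd ?p ^ v * (u * f (Suc n) - u * f n)"
      unfolding u(1) cong_iff_dvd_diff by (simp add: power_add algebra_simps)
    then have "?p ^ n dvd u * (f (Suc n) - f n)"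
      unfolding dvd_mult_cancel_left right_diff_distrib[of u] by simp
    moreover have "coprime (?p ^ n) u" using u(2) by (simp only: coprime_commute)
    ultimately have "[f (Suc n) = f n] (mod ?p ^ n)"
      unfolding cong_iff_dvd_diff by (simp only: coprime_dvd_mult_right_iff)
    then show ?thesis using f(1,2)[of n] by (simp add: cong_def)
  qed
  then obtain b :: "'p padic_int" where b: "\<And>n. padic_residue b n = f n"
    using padic_int_of_residues by metis
  have "padic_residue (a * b) n = padic_residue (of_nat CARD('p) ^ v :: 'p padic_int) n" for n
  proof -
    have "padic_residue (a * b) n = padic_residue a (n + K) * f n mod ?p ^ n"
      using padic_residue_mod_le[of n "n + K" a] by (simp add: times_padic_int.rep_eq b) (metis mod_mult_left_eq)
    also have "\<dots> = ?p ^ v mod ?p ^ n"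
      using cong_dvd_modulus[OF f(3)[of n] le_imp_power_dvd, of n] by (simp add: cong_def)
    also have "\<dots> = padic_residue (of_nat CARD('p) ^ v :: 'p padic_int) n"
      using padic_residue_of_nat[of "CARD('p) ^ v" n, where 'p = 'p] by simp
    finally show ?thesis .
  qed
  then have "a * b = of_nat CARD('p) ^ v" by (rule padic_int_eqI)
  then show thesis using that dvd_triv_left by metis
qed

section \<open>Density of the natural numbers and p-adic continuity of binomial coefficients\<close>

lemma padic_int_approx_nat:
  fixes a :: "'p :: prime_card padic_int"
  shows "of_nat CARD('p) ^ M dvd a - of_nat (nat (padic_residue a M))"
proof (rule prime_power_dvd_padic_int)
  have "padic_residue (of_nat (nat (padic_residue a M)) :: 'p padic_int) M = padic_residue a M"
    unfolding padic_residue_of_nat by simp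
  then show "padic_residue (a - of_nat (nat (padic_residue a M))) M = 0"
    unfolding minus_padic_int.rep_eq by simp
qed

lemma fact_mult_gbinomial_to_fract:
  fixes a :: "'p :: prime_card padic_int"
  shows "of_nat (fact k) * (to_fract a gchoose k) = to_fract (\<Prod>i<k. a - of_nat i)"
proof -
  have "to_fract (\<Prod>i<k. a - of_nat i) = (\<Prod>i<k. to_fract a - of_nat i)"
    by (induction k) simp_all
  then show ?thesis using gbinomial_mult_fact[of k "to_fract a"] by (simp add: atLeast0LessThan)
qed

text \<open>The falling factorial is a polynomial with integer coefficients and preserves
  congruences; dividing by k! loses at most \<open>v\<close> digits when k! divides the
  \<open>v\<close>-th power of p. The resulting precision \<open>v + N\<close> depends on
  \<open>k\<close> and \<open>N\<close> but is uniform in \<open>a\<close> and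
  \<open>b\<close>.\<close>

lemma gbinomial_padic_cong:
  fixes N k :: nat
  obtains M where "\<And>a b :: 'p :: prime_card padic_int. of_nat CARD('p) ^ M dvd a - b \<Longrightarrow>
    \<exists>c. (to_fract a gchoose k) - (to_fract b gchoose k) = to_fract (of_nat CARD('p) ^ N * c)"
proof -
  let ?p = "of_nat CARD('p) :: 'p padic_int"
  have "of_nat (fact k) \<noteq> (0 :: 'p padic_int)" by (simp only: of_nat_eq_0_iff fact_nonzero) simp
  then obtain v where "of_nat (fact k) dvd ?p ^ v" by (rule padic_int_dvd_prime_power)
  then obtain u where u: "?p ^ v = of_nat (fact k) * u" by blast
  have p: "?p \<noteq> 0" by simp
  have "\<exists>c. (to_fract a gchoose k) - (to_fract b gchoose k) = to_fract (?p ^ N * c)"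
    if ab: "?p ^ (v + N) dvd a - b" for a b
  proof -
    have "?p ^ (v + N) dvd (\<Prod>i<j. a - of_nat i) - (\<Prod>i<j. b - of_nat i)" for j
    proof (induction j)
      case (Suc j)
      have "(\<Prod>i<Suc j. a - of_nat i) - (\<Prod>i<Suc j. b - of_nat i) =
          ((\<Prod>i<j. a - of_nat i) - (\<Prod>i<j. b - of_nat i)) * (a - of_nat j) + (\<Prod>i<j. b - of_nat i) * (a - b)"
        by (simp add: algebra_simps)
      then show ?case using Suc ab by (metis dvd_add dvd_mult dvd_mult2)
    qed simp
    then obtain d where d: "(\<Prod>i<k. a - of_nat i) - (\<Prod>i<k. b - of_nat i) = ?p ^ (v + N) * d" by blast
    let ?C = "(to_fract a gchoose k) - (to_fract b gchoose k)"
    have "of_nat (fact k) * ?C = to_fract (?p ^ (v + N) * d)"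
      unfolding d[symmetric] right_diff_distrib fact_mult_gbinomial_to_fract by simp
    then have "to_fract u * (of_nat (fact k) * ?C) = to_fract (?p ^ (v + N) * d) * to_fract u" by simp
    moreover have "to_fract u * (of_nat (fact k) * ?C) = to_fract (?p ^ v) * ?C"
      unfolding u by (simp only: to_fract_mult to_fract_of_nat ac_simps)
    ultimately have "to_fract (?p ^ v) * ?C = to_fract (?p ^ v) * to_fract (?p ^ N * (d * u))"
      by (simp only: to_fract_mult power_add mult.assoc)
    moreover have "to_fract (?p ^ v) \<noteq> 0" using p by simp
    ultimately have "?C = to_fract (?p ^ N * (d * u))" by (simp only: mult_cancel_left) simp
    then show ?thesis by blast
  qed
  then show thesis using that by blast
qed

text \<open>Continuity at precision \<open>N = 0\<close> is enough: the value differs by a p-adic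
  integer from the binomial coefficient of a nearby natural number.\<close>

lemma gbinomial_padic_integral:
  fixes a :: "'p :: prime_card padic_int"
  shows "\<exists>c. to_fract a gchoose k = to_fract c"
proof -
  obtain M where M: "\<And>a b :: 'p padic_int. of_nat CARD('p) ^ M dvd a - b \<Longrightarrow>
    \<exists>c. (to_fract a gchoose k) - (to_fract b gchoose k) = to_fract (of_nat CARD('p) ^ 0 * c)"
    using gbinomial_padic_cong[where N = 0] by blast
  define m where "m = nat (padic_residue a M)"
  obtain c where c: "(to_fract a gchoose k) - (to_fract (of_nat m) gchoose k) = to_fract c"
    using M[OF padic_int_approx_nat] by (auto simp: m_def)
  have "to_fract (of_nat m :: 'p padic_int) gchoose k = of_nat (m choose k)"
    by (simp add: binomial_gbinomial)
  with c have "to_fract a gchoose k = to_fract (c + of_nat (m choose k))" by (simp add: algebra_simps)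
  then show ?thesis by blast
qed

section \<open>The $p$-adic topology on the algebraic closure\<close>

lemma fract_poly_common_denominator:
  fixes p :: "'a :: idom fract poly"
  obtains c where "c \<noteq> 0" "\<And>i. \<exists>a. to_fract c * coeff p i = to_fract a"
proof -
  have "\<exists>c. c \<noteq> 0 \<and> (\<forall>i. \<exists>a. to_fract c * coeff p i = to_fract a)"
  proof (induction p)
    case 0
    show ?case by (rule exI[of _ 1]) (auto intro!: exI[of _ 0])
  next
    case (pCons x p)
    then obtain c where c: "c \<noteq> 0" "\<And>i. \<exists>a. to_fract c * coeff p i = to_fract a" by blast
    obtain y b where b: "x = Fract y b" "b \<noteq> 0" by (cases x)
    have x: "to_fract b * x = to_fract y"
      using b by (simp add: Fract_conv_to_fract)
    have "\<exists>a. to_fract (b * c) * coeff (pCons x p) i = to_fract a" for i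
    proof (cases i)
      case 0
      have "to_fract (b * c) * coeff (pCons x p) i = to_fract c * (to_fract b * x)"
        by (simp add: 0 mult.commute mult.left_commute)
      also have "\<dots> = to_fract (c * y)" by (simp add: x)
      finally show ?thesis by blast
    next
      case (Suc j)
      obtain a where "to_fract c * coeff p j = to_fract a" using c by blast
      then have "to_fract (b * c) * coeff (pCons x p) i = to_fract (b * a)"
        by (simp add: Suc mult.assoc)
      then show ?thesis by blast
    qed
    then show ?case using b(2) c(1) by (intro exI[of _ "b * c"]) simp
  qed
  then show thesis using that by blast
qed

text \<open>Clear denominators in an algebraic equation for \<open>z\<close> and let a_n be the
  leading coefficient. Multiplying the equation by the power n - 1 of a_n makes it monic in
  \<open>w\<close>, which is a_n times \<open>z\<close>.\<close>

lemma padic_integral_multiple: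
  fixes z :: "'p :: prime_card padic_closure"
  obtains a where "a \<noteq> 0" "padic_integral (padic_of a * z)"
proof -
  obtain p :: "'p padic poly" where p: "p \<noteq> 0" "poly (map_poly to_ac p) z = 0"
    by (rule alg_closure_algebraic)
  define n where "n = degree p"
  obtain c where c: "c \<noteq> 0" "\<And>i. \<exists>a. to_fract c * coeff p i = to_fract a"
    using fract_poly_common_denominator[of p] by blast
  then obtain a where a: "\<And>i. to_fract c * coeff p i = to_fract (a i)" by metis
  have an: "a n \<noteq> 0" using a[of n] c(1) p(1) by (auto simp: n_def)
  have "padic_of c * poly (map_poly to_ac p) z = (\<Sum>i\<le>n. padic_of (a i) * z ^ i)"
    unfolding poly_altdef
    by (simp add: n_def degree_map_poly coeff_map_poly sum_distrib_left padic_of_def a[symmetric] mult.assoc)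
  then have eq: "(\<Sum>i\<le>n. padic_of (a i) * z ^ i) = 0" using p by simp
  have n: "0 < n"
  proof (rule ccontr)
    assume "\<not> 0 < n"
    then show False using eq an by simp
  qed
  define w where "w = padic_of (a n) * z"
  define m where "m = n - 1"
  have nm: "n = Suc m" using n by (simp add: m_def)
  have scaled: "padic_of (a n) ^ m * (padic_of (a i) * z ^ i) = padic_of (a i * a n ^ (m - i)) * w ^ i" if "i \<le> m" for i
  proof -
    have "padic_of (a n) ^ m = padic_of (a n) ^ (m - i) * padic_of (a n) ^ i"
      using that by (simp flip: power_add)
    then show ?thesis
      by (simp add: w_def power_mult_distrib padic_of.hom_mult padic_of.hom_power)
  qed
  have "padic_of (a n) ^ m * (\<Sum>i\<le>n. padic_of (a i) * z ^ i) =
      (\<Sum>i\<le>m. padic_of (a i * a n ^ (m - i)) * w ^ i) + w ^ n"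
    unfolding nm sum.atMost_Suc distrib_left sum_distrib_left
    using scaled by (intro arg_cong2[where f = "(+)"] sum.cong) (simp_all add: w_def nm power_mult_distrib)
  then have wn: "w ^ n = (\<Sum>i\<le>m. padic_of (- (a i * a n ^ (m - i))) * w ^ i)"
    unfolding eq by (simp add: padic_of.hom_uminus sum_negf eq_neg_iff_add_eq_0 add.commute)
  have "padic_integral w"
  proof (rule padic_integralI_span[of "{..m}" 0 "\<lambda>i. w ^ i"])
    fix i assume i: "i \<in> {..m}"
    show "w * w ^ i \<in> padic_span {..m} (\<lambda>i. w ^ i)"
    proof (cases "i = m")
      case True
      then have "w * w ^ i = (\<Sum>i\<le>m. padic_of (- (a i * a n ^ (m - i))) * w ^ i)"
        using wn by (simp add: nm)
      then show ?thesis by (rule padic_spanI)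
    next
      case False
      then have "w ^ Suc i \<in> padic_span {..m} (\<lambda>i. w ^ i)"
        using i by (intro padic_span_base) auto
      then show ?thesis by simp
    qed
  qed simp_all
  then show thesis using that an by (simp add: w_def)
qed

text \<open>The topology is separated. For nonzero \<open>y\<close> some power of p times 1/y is
  integral; multiplied by \<open>y\<close> over the next higher power of p it would make 1/p
  integral.\<close>

lemma padic_integral_divisible_imp_0:
  fixes y :: "'p :: prime_card padic_closure"
  assumes "\<And>N. padic_integral (y / of_nat CARD('p) ^ N)"
  shows "y = 0"
proof (rule ccontr)
  assume y: "y \<noteq> 0"
  let ?p = "of_nat CARD('p) :: 'p padic_closure"
  obtain a where a: "a \<noteq> 0" "padic_integral (padic_of a * (1 / y))"
    by (rule padic_integral_multiple)
  obtain v where "a dvd of_nat CARD('p) ^ v" using padic_int_dvd_prime_power[OF a(1)] .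
  then obtain b where b: "of_nat CARD('p) ^ v = a * b" by blast
  have "?p ^ v = padic_of a * padic_of b"
    using arg_cong[OF b, of padic_of] by (simp add: padic_of.hom_power padic_of.hom_mult)
  moreover have "1 / ?p = ?p ^ v / ?p ^ Suc v" by simp
  ultimately have "1 / ?p = padic_of b * (padic_of a * (1 / y) * (y / ?p ^ Suc v))"
    using y by (simp add: mult.commute)
  moreover have "padic_integral \<dots>"
    by (intro padic_integral_add_mult padic_integral_padic_of a assms)
  ultimately show False using not_padic_integral_inverse_prime[where 'p = 'p] by simp
qed

lemma padic_has_sum_iff:
  fixes s :: "'p :: prime_card padic_closure"
  shows "padic_has_sum f s \<longleftrightarrow>
    (\<forall>N. \<exists>B. finite B \<and> (\<forall>Y. finite Y \<and> B \<subseteq> Y \<longrightarrow> padic_integral ((sum f Y - s) / of_nat CARD('p) ^ N)))"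
  unfolding padic_has_sum_def padic_nhds_def filterlim_INF filterlim_principal
    eventually_finite_subsets_at_top
  by (simp only: mem_Collect_eq subset_UNIV simp_thms ball_UNIV UNIV_I)

lemma padic_has_sumE:
  fixes s :: "'p :: prime_card padic_closure"
  assumes "padic_has_sum f s"
  obtains B where "finite B"
    "\<And>Y. finite Y \<Longrightarrow> B \<subseteq> Y \<Longrightarrow> padic_integral ((sum f Y - s) / of_nat CARD('p) ^ N)"
proof -
  from assms[unfolded padic_has_sum_iff, THEN spec[of _ N]]
  obtain B where B: "finite B \<and>
    (\<forall>Y. finite Y \<and> B \<subseteq> Y \<longrightarrow> padic_integral ((sum f Y - s) / of_nat CARD('p) ^ N))" ..
  show thesis by (rule that[OF B[THEN conjunct1]]) (rule B[THEN conjunct2, rule_format, OF conjI])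
qed

lemma padic_has_sumI:
  fixes s :: "'p :: prime_card padic_closure"
  assumes "\<And>N. finite (B N)"
    "\<And>N Y. finite Y \<Longrightarrow> B N \<subseteq> Y \<Longrightarrow> padic_integral ((sum f Y - s) / of_nat CARD('p) ^ N)"
  shows "padic_has_sum f s"
  unfolding padic_has_sum_iff
proof
  fix N
  show "\<exists>B. finite B \<and> (\<forall>Y. finite Y \<and> B \<subseteq> Y \<longrightarrow>
      padic_integral ((sum f Y - s) / of_nat CARD('p) ^ N))"
    by (intro exI[of _ "B N"] conjI allI impI) (use assms in blast)+
qed

text \<open>Evaluates the definite description in \<open>mfps_eval\<close>. A finite partial sum
  containing both \<open>B\<close> and \<open>Z\<close> has errors towards \<open>s\<close> and
  \<open>t\<close> whose difference is \<open>t - s\<close>, and this works for every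
  \<open>N\<close>.\<close>

lemma padic_has_sum_unique:
  fixes s t :: "'p :: prime_card padic_closure"
  assumes "padic_has_sum f s" "padic_has_sum f t"
  shows "s = t"
proof -
  have "padic_integral ((t - s) / of_nat CARD('p) ^ N)" for N
  proof -
    obtain B where B: "finite B" "\<And>Y. finite Y \<Longrightarrow> B \<subseteq> Y \<Longrightarrow> padic_integral ((sum f Y - s) / of_nat CARD('p) ^ N)"
      by (rule padic_has_sumE[OF assms(1), of N]) (rule that, assumption, simp)
    obtain Z where Z: "finite Z" "\<And>Y. finite Y \<Longrightarrow> Z \<subseteq> Y \<Longrightarrow> padic_integral ((sum f Y - t) / of_nat CARD('p) ^ N)"
      by (rule padic_has_sumE[OF assms(2), of N]) (rule that, assumption, simp)
    have "padic_integral ((sum f (B \<union> Z) - s) / of_nat CARD('p) ^ N - (sum f (B \<union> Z) - t) / of_nat CARD('p) ^ N)"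
      using B Z by (intro padic_integral_diff) simp_all
    then show ?thesis by (simp add: diff_divide_distrib[symmetric])
  qed
  then have "t - s = 0" by (rule padic_integral_divisible_imp_0)
  then show ?thesis by simp
qed

lemma padic_has_sum_add:
  fixes s t :: "'p :: prime_card padic_closure"
  assumes "padic_has_sum f s" "padic_has_sum g t"
  shows "padic_has_sum (\<lambda>k. f k + g k) (s + t)"
  unfolding padic_has_sum_iff
proof
  fix N
  obtain B where B: "finite B" "\<And>Y. finite Y \<Longrightarrow> B \<subseteq> Y \<Longrightarrow> padic_integral ((sum f Y - s) / of_nat CARD('p) ^ N)"
    by (rule padic_has_sumE[OF assms(1), of N]) (rule that, assumption, simp)
  obtain Z where Z: "finite Z" "\<And>Y. finite Y \<Longrightarrow> Z \<subseteq> Y \<Longrightarrow> padic_integral ((sum g Y - t) / of_nat CARD('p) ^ N)"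
    by (rule padic_has_sumE[OF assms(2), of N]) (rule that, assumption, simp)
  have "padic_integral (((\<Sum>k\<in>Y. f k + g k) - (s + t)) / of_nat CARD('p) ^ N)" if "finite Y" "B \<union> Z \<subseteq> Y" for Y
  proof -
    have "((\<Sum>k\<in>Y. f k + g k) - (s + t)) / of_nat CARD('p) ^ N =
        (sum f Y - s) / of_nat CARD('p) ^ N + (sum g Y - t) / of_nat CARD('p) ^ N"
      by (simp only: sum.distrib add_divide_distrib[symmetric] add_diff_add)
    then show ?thesis using that B Z by (simp only:) (intro padic_integral_add_mult, auto)
  qed
  then show "\<exists>B. finite B \<and> (\<forall>Y. finite Y \<and> B \<subseteq> Y \<longrightarrow>
      padic_integral (((\<Sum>k\<in>Y. f k + g k) - (s + t)) / of_nat CARD('p) ^ N))"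
    using B(1) Z(1) by (intro exI[of _ "B \<union> Z"] conjI allI impI) simp_all
qed

text \<open>The factor \<open>c\<close> need not be integral. If the \<open>v\<close>-th power of p
  times \<open>c\<close> is, then precision \<open>v + N\<close> for the original sum yields
  precision \<open>N\<close> for the multiple.\<close>

lemma padic_has_sum_cmult:
  fixes s c :: "'p :: prime_card padic_closure"
  assumes "padic_has_sum f s"
  shows "padic_has_sum (\<lambda>k. c * f k) (c * s)"
  unfolding padic_has_sum_iff
proof
  fix N
  let ?p = "of_nat CARD('p) :: 'p padic_closure"
  obtain a where a: "a \<noteq> 0" "padic_integral (padic_of a * c)" by (rule padic_integral_multiple)
  obtain v where "a dvd of_nat CARD('p) ^ v" using padic_int_dvd_prime_power[OF a(1)] .
  then obtain b where b: "of_nat CARD('p) ^ v = a * b" by blast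
  have "?p ^ v = padic_of a * padic_of b"
    using arg_cong[OF b, of padic_of] by (simp add: padic_of.hom_power padic_of.hom_mult)
  then have c: "padic_integral (?p ^ v * c)"
    using padic_integral_add_mult(2)[OF padic_integral_padic_of[of b] a(2)] by (simp add: ac_simps)
  obtain B where B: "finite B" "\<And>Y. finite Y \<Longrightarrow> B \<subseteq> Y \<Longrightarrow> padic_integral ((sum f Y - s) / ?p ^ (v + N))"
    by (rule padic_has_sumE[OF assms(1), of "v + N"]) (rule that, assumption, simp)
  have "padic_integral (((\<Sum>k\<in>Y. c * f k) - c * s) / ?p ^ N)" if "finite Y" "B \<subseteq> Y" for Y
  proof -
    have "((\<Sum>k\<in>Y. c * f k) - c * s) / ?p ^ N = (?p ^ v * c) * ((sum f Y - s) / ?p ^ (v + N))"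
      unfolding sum_distrib_left[symmetric] right_diff_distrib[symmetric] power_add by simp
    then show ?thesis using padic_integral_add_mult(2)[OF c B(2)[OF that]] by (simp only:)
  qed
  then show "\<exists>B. finite B \<and> (\<forall>Y. finite Y \<and> B \<subseteq> Y \<longrightarrow> padic_integral (((\<Sum>k\<in>Y. c * f k) - c * s) / ?p ^ N))"
    using B(1) by (intro exI[of _ B] conjI allI impI) simp_all
qed

section \<open>Roots of unity of prime power order and their distance from 1\<close>

text \<open>From k C(P, k) = P C(P - 1, k - 1) with P the prime power: if p did not divide C(P, k),
  then P would divide k, which is too small.\<close>

lemma prime_dvd_choose_prime_power:
  assumes p: "prime (p :: nat)" and k: "0 < k" "k < p ^ n"
  shows "p dvd (p ^ n choose k)"
proof (rule ccontr)
  assume "\<not> p dvd (p ^ n choose k)"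
  then have "coprime (p ^ n) (p ^ n choose k)"
    using prime_imp_coprime[OF p] by simp
  moreover have "p ^ n dvd k * (p ^ n choose k)"
    using times_binomial_minus1_eq[OF k(1), of "p ^ n"] by simp
  ultimately have "p ^ n dvd k" by (simp add: coprime_dvd_mult_left_iff)
  then show False using k by (auto dest: dvd_imp_le)
qed

lemma padic_integral_root_of_unity:
  fixes \<zeta> :: "'p :: prime_card padic_closure"
  assumes \<zeta>: "\<zeta> ^ m = 1" and m: "0 < m"
  shows "padic_integral \<zeta>"
proof (rule padic_integralI_span[of "{..<m}" 0 "\<lambda>i. \<zeta> ^ i"])
  fix i assume i: "i \<in> {..<m}"
  show "\<zeta> * \<zeta> ^ i \<in> padic_span {..<m} (\<lambda>i. \<zeta> ^ i)"
  proof (cases "Suc i = m")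
    case True
    then have "\<zeta> * \<zeta> ^ i = \<zeta> ^ 0" using \<zeta> by (metis power_0 power_Suc)
    also have "\<dots> \<in> padic_span {..<m} (\<lambda>i. \<zeta> ^ i)" using m by (intro padic_span_base) simp_all
    finally show ?thesis .
  next
    case False
    then have "\<zeta> ^ Suc i \<in> padic_span {..<m} (\<lambda>i. \<zeta> ^ i)"
      using i by (intro padic_span_base) auto
    then show ?thesis by simp
  qed
qed (use m in simp_all)

text \<open>Expand 1 = (1 + (\<zeta> - 1))^P for the prime power P. The outer term 1 cancels and all
  inner coefficients are divisible by p, so the top power is p times an integral element.\<close>

lemma padic_integral_root_of_unity_minus_1_power:
  fixes \<zeta> :: "'p :: prime_card padic_closure"
  assumes \<zeta>: "\<zeta> ^ (CARD('p) ^ n) = 1"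
  shows "padic_integral ((\<zeta> - 1) ^ (CARD('p) ^ n) / of_nat CARD('p))"
proof -
  let ?P = "CARD('p) ^ n"
  let ?x = "\<zeta> - 1"
  have P: "0 < ?P" by simp
  have x: "padic_integral ?x"
    using padic_integral_root_of_unity[OF \<zeta> P] by (intro padic_integral_diff) simp_all
  have "1 = (?x + 1) ^ ?P" using \<zeta> by simp
  also have "\<dots> = (\<Sum>k\<le>?P. of_nat (?P choose k) * ?x ^ k)"
    by (simp only: binomial_ring power_one mult_1_right)
  also have "\<dots> = 1 + (\<Sum>k\<in>{0<..<?P}. of_nat (?P choose k) * ?x ^ k) + ?x ^ ?P"
  proof -
    have "{..?P} = insert 0 (insert ?P {0<..<?P})" using P by auto
    then show ?thesis using P by simp
  qed
  finally have "?x ^ ?P = - (\<Sum>k\<in>{0<..<?P}. of_nat (?P choose k) * ?x ^ k)"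
    by (simp add: eq_neg_iff_add_eq_0 add.commute)
  then have "?x ^ ?P / of_nat CARD('p) = - (\<Sum>k\<in>{0<..<?P}. of_nat (?P choose k) / of_nat CARD('p) * ?x ^ k)"
    by (simp add: sum_divide_distrib)
  also have "padic_integral \<dots>"
  proof (intro padic_integral_uminus padic_integral_sum padic_integral_add_mult padic_integral_power x)
    fix k assume "k \<in> {0<..<?P}"
    then have "CARD('p) dvd (?P choose k)"
      using prime_dvd_choose_prime_power[OF prime_card[where 'a = 'p]] by simp
    then obtain j where "?P choose k = CARD('p) * j" by blast
    then show "padic_integral (of_nat (?P choose k) / of_nat CARD('p) :: 'p padic_closure)" by simp
  qed
  finally show ?thesis .
qed

section \<open>Binomial series at roots of unity\<close>

text \<open>Congruence modulo the \<open>N\<close>-th power of p times the integral closure. The two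
  elements themselves may be non-integral, which is why the multiplicative rules below ask for
  integrality of some factors.\<close>

definition padic_cong :: "nat \<Rightarrow> 'p :: prime_card padic_closure \<Rightarrow> 'p padic_closure \<Rightarrow> bool" where
  "padic_cong N x y \<longleftrightarrow> padic_integral ((x - y) / of_nat CARD('p) ^ N)"

lemma padic_cong_refl [simp]: "padic_cong N x x"
  by (simp add: padic_cong_def)

lemma padic_cong_sym: "padic_cong N x y \<Longrightarrow> padic_cong N y x"
  using padic_integral_uminus[of "(x - y) / of_nat CARD('a) ^ N"]
  by (simp add: padic_cong_def minus_divide_left)

lemma padic_cong_trans [trans]: "padic_cong N x y \<Longrightarrow> padic_cong N y z \<Longrightarrow> padic_cong N x z"
  using padic_integral_add_mult(1)[of "(x - y) / of_nat CARD('a) ^ N" "(y - z) / of_nat CARD('a) ^ N"]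
  by (simp add: padic_cong_def add_divide_distrib[symmetric])

lemma padic_cong_0_iff:
  fixes x :: "'p :: prime_card padic_closure"
  shows "padic_cong N x 0 \<longleftrightarrow> padic_integral (x / of_nat CARD('p) ^ N)"
  by (simp add: padic_cong_def)

lemma padic_cong_add:
  "padic_cong N x y \<Longrightarrow> padic_cong N x' y' \<Longrightarrow> padic_cong N (x + x') (y + y')"
  using padic_integral_add_mult(1)[of "(x - y) / of_nat CARD('a) ^ N" "(x' - y') / of_nat CARD('a) ^ N"]
  by (simp add: padic_cong_def add_divide_distrib[symmetric] add_diff_add)

lemma padic_cong_sum:
  "(\<And>a. a \<in> A \<Longrightarrow> padic_cong N (f a) (g a)) \<Longrightarrow> padic_cong N (sum f A) (sum g A)"
  by (induction A rule: infinite_finite_induct) (auto intro: padic_cong_add)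

lemma padic_cong_scale:
  assumes "padic_integral c" "padic_cong N x y"
  shows "padic_cong N (c * x) (c * y)"
proof -
  have "padic_integral (c * ((x - y) / of_nat CARD('a) ^ N))"
    using assms by (intro padic_integral_add_mult) (simp_all add: padic_cong_def)
  then show ?thesis by (simp add: padic_cong_def right_diff_distrib)
qed

lemma padic_cong_mult:
  assumes "padic_integral x'" "padic_integral y" "padic_cong N x y" "padic_cong N x' y'"
  shows "padic_cong N (x * x') (y * y')"
proof (rule padic_cong_trans)
  show "padic_cong N (x * x') (y * x')"
    using padic_cong_scale[OF assms(1,3)] by (simp add: mult.commute)
  show "padic_cong N (y * x') (y * y')" by (rule padic_cong_scale[OF assms(2,4)])
qed

lemma padic_cong_prod:
  assumes "\<And>a. a \<in> A \<Longrightarrow> padic_integral (f a)" "\<And>a. a \<in> A \<Longrightarrow> padic_integral (g a)"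
    and "\<And>a. a \<in> A \<Longrightarrow> padic_cong N (f a) (g a)"
  shows "padic_cong N (prod f A) (prod g A)"
  using assms
  by (induction A rule: infinite_finite_induct) (auto intro!: padic_cong_mult padic_integral_prod)

lemma padic_integral_minus_1_root_of_unity:
  fixes \<zeta> :: "'p :: prime_card padic_closure"
  assumes "\<zeta> ^ (CARD('p) ^ n) = 1"
  shows "padic_integral \<zeta>" "padic_integral (\<zeta> - 1)"
proof -
  show "padic_integral \<zeta>" by (rule padic_integral_root_of_unity[OF assms]) simp
  then show "padic_integral (\<zeta> - 1)" by (rule padic_integral_diff) simp
qed

text \<open>Each block of \<open>CARD('p) ^ n\<close> factors contributes one p, so \<open>N\<close>
  blocks suffice. This is the source of the truncation bound \<open>CARD('p) ^ n * N\<close> in the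
  series below.\<close>

lemma root_of_unity_minus_1_power_cong_0:
  fixes \<zeta> :: "'p :: prime_card padic_closure"
  assumes \<zeta>: "\<zeta> ^ (CARD('p) ^ n) = 1" and k: "CARD('p) ^ n * N \<le> k"
  shows "padic_cong N ((\<zeta> - 1) ^ k) 0"
proof -
  let ?P = "CARD('p) ^ n"
  have "(\<zeta> - 1) ^ k = ((\<zeta> - 1) ^ ?P) ^ N * (\<zeta> - 1) ^ (k - ?P * N)"
    using k by (simp flip: power_mult power_add)
  then have "(\<zeta> - 1) ^ k / of_nat CARD('p) ^ N =
      ((\<zeta> - 1) ^ ?P / of_nat CARD('p)) ^ N * (\<zeta> - 1) ^ (k - ?P * N)"
    by (simp add: power_divide)
  then show ?thesis
    unfolding padic_cong_0_iff using padic_integral_root_of_unity_minus_1_power[OF \<zeta>]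
      padic_integral_minus_1_root_of_unity[OF \<zeta>]
    by (auto intro!: padic_integral_add_mult padic_integral_power)
qed

lemma padic_integral_gbinomial:
  fixes a :: "'p :: prime_card padic_int"
  shows "padic_integral (to_ac (to_fract a gchoose k))"
proof -
  obtain c where "to_fract a gchoose k = to_fract c" using gbinomial_padic_integral by blast
  then show ?thesis using padic_integral_padic_of[of c] by (simp add: padic_of_def)
qed

text \<open>For a natural exponent \<open>m\<close> this is the binomial theorem up to terms that
  vanish modulo the \<open>N\<close>-th power of p. Only finitely many coefficients survive, so a
  single \<open>m\<close> close to \<open>a\<close> matches all of them.\<close>

lemma binomial_series_cong:
  fixes \<zeta> :: "'p :: prime_card padic_closure" and a :: "'p padic_int"
  assumes \<zeta>: "\<zeta> ^ (CARD('p) ^ n) = 1"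
  shows "padic_cong N (\<Sum>k<CARD('p) ^ n * N. to_ac (to_fract a gchoose k) * (\<zeta> - 1) ^ k)
    (\<zeta> ^ nat (padic_residue a n))"
proof -
  define P where "P = CARD('p) ^ n"
  define K where "K = P * N"
  let ?x = "\<zeta> - 1"
  note int = padic_integral_minus_1_root_of_unity[OF \<zeta>]
  have "\<forall>k. \<exists>M. \<forall>a b :: 'p padic_int. of_nat CARD('p) ^ M dvd a - b \<longrightarrow>
    (\<exists>c. (to_fract a gchoose k) - (to_fract b gchoose k) = to_fract (of_nat CARD('p) ^ N * c))"
  proof
    fix k
    obtain M where "\<And>a b :: 'p padic_int. of_nat CARD('p) ^ M dvd a - b \<Longrightarrow>
        \<exists>c. (to_fract a gchoose k) - (to_fract b gchoose k) = to_fract (of_nat CARD('p) ^ N * c)"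
      by (rule gbinomial_padic_cong[where N = N and k = k and 'p = 'p]) (rule that, simp)
    then show "\<exists>M. \<forall>a b :: 'p padic_int. of_nat CARD('p) ^ M dvd a - b \<longrightarrow>
      (\<exists>c. (to_fract a gchoose k) - (to_fract b gchoose k) = to_fract (of_nat CARD('p) ^ N * c))"
      by (intro exI[of _ M] allI impI)
  qed
  from choice[OF this] obtain Mf where Mf: "\<forall>k. \<forall>a b :: 'p padic_int. of_nat CARD('p) ^ Mf k dvd a - b \<longrightarrow>
    (\<exists>c. (to_fract a gchoose k) - (to_fract b gchoose k) = to_fract (of_nat CARD('p) ^ N * c))" ..
  \<comment> \<open>The sum dominates every \<open>Mf k\<close> with \<open>k < K\<close>, so one
    approximation serves all coefficients; the summand \<open>n\<close> also makes \<open>m\<close>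
    congruent to \<open>a\<close> modulo \<open>CARD('p) ^ n\<close>, which fixes the power of
    \<zeta>.\<close>
  define M where "M = n + (\<Sum>k<K. Mf k)"
  define m where "m = nat (padic_residue a M)"
  have *: "padic_cong N (to_ac (to_fract a gchoose k)) (of_nat (m choose k))" if "k < K" for k
  proof -
    have "Mf k \<le> M" using that member_le_sum[of k "{..<K}" Mf] by (simp add: M_def)
    then have "of_nat CARD('p) ^ Mf k dvd a - of_nat m"
      unfolding m_def by (rule dvd_trans[OF le_imp_power_dvd padic_int_approx_nat])
    then obtain c where c: "(to_fract a gchoose k) - (to_fract (of_nat m) gchoose k) = to_fract (of_nat CARD('p) ^ N * c)"
      using Mf by blast
    have "to_ac (to_fract a gchoose k) - of_nat (m choose k) =
        to_ac ((to_fract a gchoose k) - (to_fract (of_nat m) gchoose k))"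
      by (simp add: binomial_gbinomial[symmetric])
    also have "\<dots> = of_nat CARD('p) ^ N * padic_of c"
      unfolding c padic_of_def[symmetric] by (simp add: padic_of.hom_mult padic_of.hom_power)
    finally show ?thesis by (simp add: padic_cong_def)
  qed
  have "padic_cong N (\<Sum>k<K. to_ac (to_fract a gchoose k) * ?x ^ k) (\<Sum>k<K. of_nat (m choose k) * ?x ^ k)"
    by (intro padic_cong_sum padic_cong_mult padic_integral_power int *) simp_all
  \<comment> \<open>The range up to \<open>K + Suc m\<close> contains both the truncation and the
    full expansion of exponent \<open>m\<close>, whichever is longer. The terms added here are 0
    modulo the chosen power of p; those beyond \<open>m\<close> are exactly 0.\<close>
  also have "padic_cong N (\<Sum>k<K. of_nat (m choose k) * ?x ^ k) (\<Sum>k<K + Suc m. of_nat (m choose k) * ?x ^ k)"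
  proof -
    have "padic_cong N (\<Sum>k\<in>{K..<K + Suc m}. of_nat (m choose k) * ?x ^ k) (\<Sum>k\<in>{K..<K + Suc m}. of_nat (m choose k) * 0)"
      by (intro padic_cong_sum padic_cong_scale root_of_unity_minus_1_power_cong_0[OF \<zeta>])
        (simp_all add: K_def P_def)
    then have "padic_cong N ((\<Sum>k<K. of_nat (m choose k) * ?x ^ k) + (\<Sum>k\<in>{K..<K + Suc m}. of_nat (m choose k) * ?x ^ k))
        ((\<Sum>k<K. of_nat (m choose k) * ?x ^ k) + 0)"
      by (intro padic_cong_add padic_cong_refl) (simp only: mult_zero_right sum.neutral_const)
    moreover have "(\<Sum>k<K + Suc m. of_nat (m choose k) * ?x ^ k) =
      (\<Sum>k<K. of_nat (m choose k) * ?x ^ k) + (\<Sum>k\<in>{K..<K + Suc m}. of_nat (m choose k) * ?x ^ k)"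
      unfolding lessThan_atLeast0 by (rule sum.atLeastLessThan_concat[symmetric]) simp_all
    ultimately have "padic_cong N (\<Sum>k<K + Suc m. of_nat (m choose k) * ?x ^ k) (\<Sum>k<K. of_nat (m choose k) * ?x ^ k)"
      by (simp only: add_0_right)
    then show ?thesis by (rule padic_cong_sym)
  qed
  also have "(\<Sum>k<K + Suc m. of_nat (m choose k) * ?x ^ k) = (\<Sum>k\<le>m. of_nat (m choose k) * ?x ^ k)"
    by (rule sum.mono_neutral_right) (auto simp: binomial_eq_0)
  also have "\<dots> = (?x + 1) ^ m"
    by (simp only: binomial_ring power_one mult_1_right)
  also have "\<dots> = \<zeta> ^ nat (padic_residue a n)"
  proof -
    have "int (m mod P) = padic_residue a n"
      using padic_residue_mod_le[of n M a] by (simp add: m_def M_def P_def zmod_int)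
    then have "nat (padic_residue a n) = m mod P" by linarith
    moreover have "\<zeta> ^ m = \<zeta> ^ (P * (m div P) + m mod P)" by simp
    then have "\<zeta> ^ m = \<zeta> ^ (m mod P)"
      unfolding power_add power_mult using \<zeta> by (simp add: P_def)
    ultimately show ?thesis by simp
  qed
  finally show ?thesis by (simp add: K_def P_def)
qed

text \<open>The character sending \<gamma> to the product of the powers of \<zeta>, with each p-adic
  exponent replaced by its representative modulo the \<open>n\<close>-th power of p. It is
  multiplicative when the order of each coordinate of \<zeta> divides that power.\<close>

definition root_character :: "nat \<Rightarrow> ('d :: finite \<Rightarrow> 'p :: prime_card padic_closure) \<Rightarrow> ('d \<Rightarrow> 'p padic_int) \<Rightarrow> 'p padic_closure" where
  "root_character n \<zeta> \<gamma> = (\<Prod>i\<in>UNIV. \<zeta> i ^ nat (padic_residue (\<gamma> i) n))"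

text \<open>On the box \<open>B N\<close> the sum factors into one-variable truncated series. A
  monomial outside the box has some exponent at least \<open>CARD('p) ^ n * N\<close>, and that
  single factor already makes its term 0 modulo the \<open>N\<close>-th power of p.\<close>

lemma padic_has_sum_voltage:
  fixes \<zeta> :: "'d :: finite \<Rightarrow> 'p :: prime_card padic_closure" and \<gamma> :: "'d \<Rightarrow> 'p padic_int"
  assumes \<zeta>: "\<And>i. \<zeta> i ^ (CARD('p) ^ n) = 1"
  shows "padic_has_sum (\<lambda>k. \<Prod>i\<in>UNIV. to_ac (to_fract (\<gamma> i) gchoose k i) * (\<zeta> i - 1) ^ k i) (root_character n \<zeta> \<gamma>)"
    (is "padic_has_sum ?f _")
proof (rule padic_has_sumI)
  note int = padic_integral_minus_1_root_of_unity[OF \<zeta>]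
  define B :: "nat \<Rightarrow> ('d \<Rightarrow> nat) set" where "B N = (UNIV \<rightarrow>\<^sub>E {..<CARD('p) ^ n * N})" for N
  show fin: "finite (B N)" for N unfolding B_def by (intro finite_PiE) simp_all
  fix N Y assume Y: "finite Y" "B N \<subseteq> Y"
  have "sum ?f Y = sum ?f (B N) + sum ?f (Y - B N)"
    using sum.subset_diff[OF Y(2,1), of ?f] by (simp add: add.commute)
  also have "padic_cong N \<dots> (root_character n \<zeta> \<gamma> + 0)"
  proof (rule padic_cong_add)
    have "sum ?f (B N) = (\<Prod>i\<in>UNIV. \<Sum>k<CARD('p) ^ n * N. to_ac (to_fract (\<gamma> i) gchoose k) * (\<zeta> i - 1) ^ k)"
      unfolding B_def by (rule prod_sum_PiE[symmetric]) simp_all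
    also have "padic_cong N \<dots> (root_character n \<zeta> \<gamma>)"
      unfolding root_character_def
      by (intro padic_cong_prod binomial_series_cong padic_integral_sum padic_integral_add_mult
          padic_integral_power padic_integral_gbinomial int \<zeta>)
    finally show "padic_cong N (sum ?f (B N)) (root_character n \<zeta> \<gamma>)" .
    have "padic_cong N (?f k) 0" if k: "k \<in> Y - B N" for k
    proof -
      obtain j where j: "CARD('p) ^ n * N \<le> k j" using k by (auto simp: B_def PiE_def extensional_def Pi_def not_less)
      have "?f k = (to_ac (to_fract (\<gamma> j) gchoose k j) * (\<Prod>i\<in>UNIV - {j}. to_ac (to_fract (\<gamma> i) gchoose k i) * (\<zeta> i - 1) ^ k i)) * (\<zeta> j - 1) ^ k j"
        by (subst prod.remove[of _ j]) (simp_all add: ac_simps)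
      also have "padic_cong N \<dots> ((to_ac (to_fract (\<gamma> j) gchoose k j) * (\<Prod>i\<in>UNIV - {j}. to_ac (to_fract (\<gamma> i) gchoose k i) * (\<zeta> i - 1) ^ k i)) * 0)"
        by (intro padic_cong_scale root_of_unity_minus_1_power_cong_0[OF \<zeta> j] padic_integral_prod padic_integral_add_mult
          padic_integral_power padic_integral_gbinomial int)
      finally show ?thesis by simp
    qed
    then have "padic_cong N (sum ?f (Y - B N)) (\<Sum>k\<in>Y - B N. 0)" by (rule padic_cong_sum)
    then show "padic_cong N (sum ?f (Y - B N)) 0" by simp
  qed
  finally show "padic_integral ((sum ?f Y - root_character n \<zeta> \<gamma>) / of_nat CARD('p) ^ N)"
    by (simp add: padic_cong_def)
qed

section \<open>Specialization of power series\<close>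

lemma mfps_eqI: "(\<And>k. mfps_coeff f k = mfps_coeff g k) \<Longrightarrow> f = g"
  by (simp add: mfps_coeff_inject[symmetric] fun_eq_iff)

lemma mfps_coeff_const_mult [simp]:
  fixes f :: "('a :: comm_ring_1, 'd :: finite) mfps"
  shows "mfps_coeff (mfps_const c * f) k = c * mfps_coeff f k"
proof -
  have "mfps_coeff (mfps_const c * f) k =
      (\<Sum>z\<in>exponent_splits k. (if fst z = (\<lambda>_. 0) then c else 0) * mfps_coeff f (snd z))"
    by (simp add: times_mfps.rep_eq mfps_const.rep_eq case_prod_unfold)
  also have "\<dots> = (\<Sum>z\<in>{((\<lambda>_ :: 'd. 0 :: nat), k)}. (if fst z = (\<lambda>_. 0) then c else 0) * mfps_coeff f (snd z))"
    by (rule sum.mono_neutral_right[OF finite_exponent_splits])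
      (auto simp: exponent_splits_def fun_eq_iff)
  finally show ?thesis by simp
qed

text \<open>A binomial series in one variable is supported on one axis, so among all ways to split
  an exponent only one contributes: its \<open>i\<close>-th coordinate \<open>u\<close> and the
  remainder \<open>w\<close>.\<close>

lemma mfps_coeff_prod_binomial:
  fixes a :: "'d :: finite \<Rightarrow> 'a :: field_char_0"
  shows "mfps_coeff (\<Prod>i\<in>I. mfps_binomial i (a i)) k =
    (if \<forall>j. j \<notin> I \<longrightarrow> k j = 0 then \<Prod>i\<in>I. a i gchoose k i else 0)"
proof (induction I arbitrary: k rule: finite_induct[OF finite])
  case 1
  then show ?case by (simp add: one_mfps.rep_eq fun_eq_iff)
next
  case (2 i I)
  define F where "F = (\<Prod>i\<in>I. mfps_binomial i (a i))"
  define u where "u = (\<lambda>j. if j = i then k i else 0)"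
  define w where "w = k(i := 0)"
  define h where "h z = mfps_coeff (mfps_binomial i (a i)) (fst z) * mfps_coeff F (snd z)" for z
  have "mfps_coeff (mfps_binomial i (a i) * F) k = sum h (exponent_splits k)"
    by (simp add: times_mfps.rep_eq case_prod_unfold h_def)
  also have "\<dots> = sum h {(u, w)}"
  proof (rule sum.mono_neutral_right[OF finite_exponent_splits])
    show "{(u, w)} \<subseteq> exponent_splits k" by (auto simp: exponent_splits_def u_def w_def)
    show "\<forall>z\<in>exponent_splits k - {(u, w)}. h z = 0"
    proof
      fix z assume z: "z \<in> exponent_splits k - {(u, w)}"
      obtain b c where bc: "z = (b, c)" by (cases z)
      have s: "b j + c j = k j" for j using z by (simp add: bc exponent_splits_def)
      show "h z = 0"
      proof (rule ccontr)
        assume "h z \<noteq> 0"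
        then have "mfps_coeff (mfps_binomial i (a i)) b \<noteq> 0" "mfps_coeff F c \<noteq> 0"
          by (auto simp: h_def bc)
        then have b: "\<forall>j. j \<noteq> i \<longrightarrow> b j = 0" and c: "\<forall>j. j \<notin> I \<longrightarrow> c j = 0"
          by (auto simp: mfps_binomial.rep_eq F_def 2 split: if_splits)
        have "b j = u j \<and> c j = w j" for j
          using s[of j] b c \<open>i \<notin> I\<close> by (cases "j = i") (auto simp: u_def w_def)
        then show False using z by (auto simp: bc fun_eq_iff)
      qed
    qed
  qed
  also have "\<dots> = (a i gchoose k i) * mfps_coeff F w"
    by (simp add: h_def mfps_binomial.rep_eq u_def)
  also have "mfps_coeff F w = (if \<forall>j. j \<notin> insert i I \<longrightarrow> k j = 0 then \<Prod>j\<in>I. a j gchoose k j else 0)"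
  proof -
    have "(\<Prod>j\<in>I. a j gchoose w j) = (\<Prod>j\<in>I. a j gchoose k j)"
      using 2 by (intro prod.cong) (auto simp: w_def)
    then show ?thesis by (auto simp: F_def 2 w_def)
  qed
  finally show ?case
    unfolding F_def prod.insert[OF 2(1,2)] if_distrib[of "(*) _"] mult_zero_right .
qed

lemma mfps_coeff_voltage_series:
  "mfps_coeff (voltage_series \<gamma>) k = (\<Prod>i\<in>UNIV. to_fract (\<gamma> i) gchoose k i)"
  by (simp add: voltage_series_def mfps_coeff_prod_binomial)

text \<open>Vandermonde convolution along the \<open>i\<close>-th axis; off the axis all terms
  vanish. It makes \<tau> multiplicative, hence the span of its values closed under
  products.\<close>

lemma mfps_binomial_mult:
  fixes a b :: "'a :: field_char_0"
  shows "mfps_binomial i a * mfps_binomial i b = (mfps_binomial i (a + b) :: ('a, 'd :: finite) mfps)"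
proof (rule mfps_eqI)
  fix k :: "'d \<Rightarrow> nat"
  define single where "single t = (\<lambda>j. if j = i then t else 0)" for t :: nat
  define h where "h z = mfps_coeff (mfps_binomial i a) (fst z) * mfps_coeff (mfps_binomial i b) (snd z)"
    for z :: "('d \<Rightarrow> nat) \<times> ('d \<Rightarrow> nat)"
  have lhs: "mfps_coeff (mfps_binomial i a * mfps_binomial i b) k = sum h (exponent_splits k)"
    by (simp add: times_mfps.rep_eq case_prod_unfold h_def)
  show "mfps_coeff (mfps_binomial i a * mfps_binomial i b) k = mfps_coeff (mfps_binomial i (a + b)) k"
  proof (cases "\<forall>j. j \<noteq> i \<longrightarrow> k j = 0")
    case True
    have "exponent_splits k = (\<lambda>t. (single t, single (k i - t))) ` {0..k i}"
    proof (intro equalityI subsetI)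
      fix z assume "z \<in> exponent_splits k"
      then obtain b c where z: "z = (b, c)" "\<And>j. b j + c j = k j"
        by (auto simp: exponent_splits_def)
      have s: "b j = single (b i) j" "c j = single (k i - b i) j" for j
        using z(2)[of j] True by (cases "j = i"; simp add: single_def)+
      have "z = (single (b i), single (k i - b i))"
        unfolding z(1) prod.inject by (intro conjI ext s)
      moreover have "b i \<le> k i" using z(2)[of i] by simp
      ultimately show "z \<in> (\<lambda>t. (single t, single (k i - t))) ` {0..k i}"
        by (intro image_eqI[of _ _ "b i"]) simp_all
    qed (use True in \<open>auto simp: exponent_splits_def single_def\<close>)
    moreover have "inj_on (\<lambda>t. (single t, single (k i - t))) {0..k i}"
      by (rule inj_onI) (metis prod.inject single_def)
    ultimately have "sum h (exponent_splits k) = (\<Sum>t\<in>{0..k i}. h (single t, single (k i - t)))"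
      by (simp add: sum.reindex)
    also have "\<dots> = (\<Sum>t\<in>{0..k i}. (a gchoose t) * (b gchoose (k i - t)))"
      by (simp add: h_def mfps_binomial.rep_eq single_def)
    also have "\<dots> = (a + b) gchoose k i" by (rule gbinomial_Vandermonde)
    finally show ?thesis unfolding lhs using True by (simp add: mfps_binomial.rep_eq)
  next
    case False
    then obtain j where j: "j \<noteq> i" "k j \<noteq> 0" by blast
    have "h z = 0" if "z \<in> exponent_splits k" for z
    proof -
      have "fst z j + snd z j = k j" using that by (auto simp: exponent_splits_def)
      then have "fst z j \<noteq> 0 \<or> snd z j \<noteq> 0" using j by auto
      then show ?thesis using j(1) by (auto simp: h_def mfps_binomial.rep_eq)
    qed
    then have "sum h (exponent_splits k) = 0" by (intro sum.neutral ballI)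
    then show ?thesis unfolding lhs mfps_binomial.rep_eq if_not_P[OF False] .
  qed
qed

lemma voltage_series_add:
  "voltage_series (\<lambda>i. \<gamma> i + \<delta> i) = voltage_series \<gamma> * voltage_series \<delta>"
  by (simp add: voltage_series_def mfps_binomial_mult prod.distrib[symmetric])

lemma voltage_series_0: "voltage_series (\<lambda>_ :: 'd :: finite. 0 :: 'p :: prime_card padic_int) = 1"
proof (rule mfps_eqI)
  fix k :: "'d \<Rightarrow> nat"
  have g: "(0 :: 'p padic) gchoose m = (if m = 0 then 1 else 0)" for m
    by (cases m) (simp_all add: gbinomial_0)
  have "(\<Prod>i\<in>UNIV. (0 :: 'p padic) gchoose k i) = (if k = (\<lambda>_. 0) then 1 else 0)"
    by (auto simp: g fun_eq_iff)
  then show "mfps_coeff (voltage_series (\<lambda>_ :: 'd. 0 :: 'p padic_int)) k = mfps_coeff 1 k"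
    by (simp add: mfps_coeff_voltage_series one_mfps.rep_eq)
qed

lemma root_character_add:
  fixes \<zeta> :: "'d :: finite \<Rightarrow> 'p :: prime_card padic_closure"
  assumes \<zeta>: "\<And>i. \<zeta> i ^ (CARD('p) ^ n) = 1"
  shows "root_character n \<zeta> (\<lambda>i. \<gamma> i + \<delta> i) = root_character n \<zeta> \<gamma> * root_character n \<zeta> \<delta>"
proof -
  have "\<zeta> i ^ nat (padic_residue (x + y) n) = \<zeta> i ^ nat (padic_residue x n) * \<zeta> i ^ nat (padic_residue y n)"
    for i and x y :: "'p padic_int"
  proof -
    let ?P = "CARD('p) ^ n"
    define m where "m = nat (padic_residue x n) + nat (padic_residue y n)"
    have "int (m mod ?P) = padic_residue (x + y) n"
      by (simp add: m_def plus_padic_int.rep_eq zmod_int)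
    then have *: "nat (padic_residue (x + y) n) = m mod ?P" by linarith
    have "\<zeta> i ^ m = \<zeta> i ^ (?P * (m div ?P) + m mod ?P)" by simp
    also have "\<dots> = \<zeta> i ^ (m mod ?P)"
      unfolding power_add power_mult using \<zeta> by simp
    finally show ?thesis unfolding * by (simp add: m_def power_add)
  qed
  then show ?thesis by (simp add: root_character_def prod.distrib)
qed

lemma root_character_0: "root_character n \<zeta> (\<lambda>_. 0) = 1"
  by (simp add: root_character_def zero_padic_int.rep_eq)

text \<open>
  The graph of specialization at $\zeta - 1$ on the span of the series $\tau(\gamma)$. A relation,
  since a well-defined map on the span would already require linear independence of the
  $\tau(\gamma)$.
\<close>

inductive series_evals ::
    "nat \<Rightarrow> ('d :: finite \<Rightarrow> 'p :: prime_card padic_closure) \<Rightarrow> ('p padic, 'd) mfps \<Rightarrow> 'p padic_closure \<Rightarrow> bool"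
    for n \<zeta> where
  base: "series_evals n \<zeta> (mfps_const c * voltage_series \<gamma>) (to_ac c * root_character n \<zeta> \<gamma>)"
| add: "series_evals n \<zeta> f s \<Longrightarrow> series_evals n \<zeta> g t \<Longrightarrow> series_evals n \<zeta> (f + g) (s + t)"

lemma mfps_const_mult: "mfps_const c * mfps_const d = (mfps_const (c * d) :: ('a :: comm_ring_1, 'd :: finite) mfps)"
  by (rule mfps_eqI) (simp add: mfps_const.rep_eq)

text \<open>On generators both \<tau> and the character turn addition of exponents into
  multiplication; bilinearity, as a nested induction, does the rest. This replaces any argument
  about Cauchy products of convergent sums.\<close>

lemma series_evals_mult:
  assumes \<zeta>: "\<And>i. \<zeta> i ^ (CARD('p :: prime_card) ^ n) = (1 :: 'p padic_closure)"
    and "series_evals n \<zeta> f s" "series_evals n \<zeta> g t"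
  shows "series_evals n \<zeta> (f * g) (s * t)"
  using assms(2)
proof induction
  case (base c \<gamma>)
  show ?case using assms(3)
  proof induction
    case (base d \<delta>)
    have "mfps_const c * voltage_series \<gamma> * (mfps_const d * voltage_series \<delta>) =
        mfps_const (c * d) * voltage_series (\<lambda>i. \<gamma> i + \<delta> i)"
      by (simp add: voltage_series_add mfps_const_mult[symmetric] ac_simps)
    moreover have "to_ac c * root_character n \<zeta> \<gamma> * (to_ac d * root_character n \<zeta> \<delta>) =
        to_ac (c * d) * root_character n \<zeta> (\<lambda>i. \<gamma> i + \<delta> i)"
      by (simp add: root_character_add[OF \<zeta>] ac_simps)
    ultimately show ?case by (simp only: series_evals.base)
  next
    case (add f s g t)
    then show ?case by (simp add: distrib_left series_evals.add)
  qed
next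
  case (add f s g t)
  then show ?case by (simp add: distrib_right series_evals.add)
qed

lemma series_evals_0:
  fixes \<zeta> :: "'d :: finite \<Rightarrow> 'p :: prime_card padic_closure"
  shows "series_evals n \<zeta> 0 0"
proof -
  have "mfps_const 0 * voltage_series (\<lambda>_. 0) = (0 :: ('p padic, 'd) mfps)"
    by (rule mfps_eqI) (simp add: zero_mfps.rep_eq)
  then show ?thesis using series_evals.base[of n \<zeta> 0 "\<lambda>_. 0"] by simp
qed

lemma series_evals_1:
  fixes \<zeta> :: "'d :: finite \<Rightarrow> 'p :: prime_card padic_closure"
  shows "series_evals n \<zeta> 1 1"
proof -
  have "mfps_const 1 = (1 :: ('p padic, 'd) mfps)"
    by (rule mfps_eqI) (simp add: mfps_const.rep_eq one_mfps.rep_eq)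
  then show ?thesis
    using series_evals.base[of n \<zeta> 1 "\<lambda>_. 0"] by (simp add: voltage_series_0 root_character_0)
qed

lemma series_evals_uminus: "series_evals n \<zeta> f s \<Longrightarrow> series_evals n \<zeta> (- f) (- s)"
proof (induction rule: series_evals.induct)
  case (base c \<gamma>)
  have "mfps_const (- c) * voltage_series \<gamma> = - (mfps_const c * voltage_series \<gamma>)"
    by (rule mfps_eqI) (simp add: uminus_mfps.rep_eq)
  then show ?case using series_evals.base[of n \<zeta> "- c" \<gamma>] by simp
next
  case (add f s g t)
  then show ?case using series_evals.add[of n \<zeta> "- f" "- s" "- g" "- t"] by simp
qed

lemma series_evals_sum:
  "(\<And>a. a \<in> A \<Longrightarrow> series_evals n \<zeta> (f a) (g a)) \<Longrightarrow> series_evals n \<zeta> (sum f A) (sum g A)"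
  by (induction A rule: infinite_finite_induct) (auto intro: series_evals.add series_evals_0)

text \<open>Links the relation to \<open>mfps_eval\<close>: every related value is a genuine p-adic
  sum of the series, so uniqueness of sums identifies it. In particular the relation is
  single-valued at such \<zeta>.\<close>

lemma mfps_eval_series_evals:
  fixes \<zeta> :: "'d :: finite \<Rightarrow> 'p :: prime_card padic_closure"
  assumes \<zeta>: "\<And>i. \<zeta> i ^ (CARD('p) ^ n) = 1" and "series_evals n \<zeta> f s"
  shows "mfps_eval f (\<lambda>i. \<zeta> i - 1) = s"
proof -
  have "padic_has_sum (\<lambda>k. to_ac (mfps_coeff f k) * (\<Prod>i\<in>UNIV. (\<zeta> i - 1) ^ k i)) s"
    using assms(2)
  proof induction
    case (base c \<gamma>)
    have "padic_has_sum (\<lambda>k. to_ac c * (\<Prod>i\<in>UNIV. to_ac (to_fract (\<gamma> i) gchoose k i) * (\<zeta> i - 1) ^ k i))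
        (to_ac c * root_character n \<zeta> \<gamma>)"
      by (intro padic_has_sum_cmult padic_has_sum_voltage \<zeta>)
    then show ?case
      by (simp add: mfps_coeff_voltage_series to_ac_prod prod.distrib mult.assoc)
  next
    case (add f s g t)
    from padic_has_sum_add[OF add.IH] show ?case
      by (simp add: plus_mfps.rep_eq distrib_right)
  qed
  then show ?thesis unfolding mfps_eval_def
    by (intro the_equality) (auto intro: padic_has_sum_unique)
qed

section \<open>Specialization of polynomials and determinants\<close>

definition poly_evals ::
    "nat \<Rightarrow> ('d :: finite \<Rightarrow> 'p :: prime_card padic_closure) \<Rightarrow> ('p padic, 'd) mfps poly \<Rightarrow> 'p padic_closure poly \<Rightarrow> bool" where
  "poly_evals n \<zeta> F S \<longleftrightarrow> (\<forall>i. series_evals n \<zeta> (coeff F i) (coeff S i))"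

lemma specialize_poly_evals:
  fixes \<zeta> :: "'d :: finite \<Rightarrow> 'p :: prime_card padic_closure"
  assumes \<zeta>: "\<And>i. \<zeta> i ^ (CARD('p) ^ n) = 1" and "poly_evals n \<zeta> F S"
  shows "specialize F (\<lambda>i. \<zeta> i - 1) = S"
proof (rule poly_eqI)
  fix j
  \<comment> \<open>\<open>coeff_map_poly\<close> commutes with a coefficient map only if that map
    sends 0 to 0, which for a definite description has to be shown.\<close>
  have "mfps_eval 0 (\<lambda>i. \<zeta> i - 1) = 0" by (rule mfps_eval_series_evals[OF \<zeta> series_evals_0])
  then show "coeff (specialize F (\<lambda>i. \<zeta> i - 1)) j = coeff S j"
    using mfps_eval_series_evals[of \<zeta> n "coeff F j" "coeff S j", OF \<zeta>] assms(2)
    by (simp add: specialize_def coeff_map_poly poly_evals_def)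
qed

lemma poly_evals_pCons: "series_evals n \<zeta> f s \<Longrightarrow> poly_evals n \<zeta> F S \<Longrightarrow> poly_evals n \<zeta> (pCons f F) (pCons s S)"
  by (auto simp: poly_evals_def coeff_pCons split: nat.split)

lemma poly_evals_0: "poly_evals n \<zeta> 0 0"
  by (simp add: poly_evals_def series_evals_0)

lemma poly_evals_1: "poly_evals n \<zeta> 1 1"
  unfolding one_pCons by (intro poly_evals_pCons series_evals_1 poly_evals_0)

lemma poly_evals_add: "poly_evals n \<zeta> F S \<Longrightarrow> poly_evals n \<zeta> G T \<Longrightarrow> poly_evals n \<zeta> (F + G) (S + T)"
  by (simp add: poly_evals_def series_evals.add)

lemma poly_evals_uminus: "poly_evals n \<zeta> F S \<Longrightarrow> poly_evals n \<zeta> (- F) (- S)"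
  by (simp add: poly_evals_def series_evals_uminus)

lemma poly_evals_diff: "poly_evals n \<zeta> F S \<Longrightarrow> poly_evals n \<zeta> G T \<Longrightarrow> poly_evals n \<zeta> (F - G) (S - T)"
  using poly_evals_add[of n \<zeta> F S "- G" "- T"] poly_evals_uminus[of n \<zeta> G T] by simp

lemma poly_evals_sum:
  "(\<And>a. a \<in> A \<Longrightarrow> poly_evals n \<zeta> (f a) (g a)) \<Longrightarrow> poly_evals n \<zeta> (sum f A) (sum g A)"
  by (induction A rule: infinite_finite_induct) (auto intro: poly_evals_add poly_evals_0)

context
  fixes n :: nat and \<zeta> :: "'d :: finite \<Rightarrow> 'p :: prime_card padic_closure"
  assumes \<zeta>: "\<And>i. \<zeta> i ^ (CARD('p) ^ n) = 1"
begin

lemma poly_evals_mult: "poly_evals n \<zeta> F S \<Longrightarrow> poly_evals n \<zeta> G T \<Longrightarrow> poly_evals n \<zeta> (F * G) (S * T)"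
  unfolding poly_evals_def coeff_mult by (intro allI series_evals_sum series_evals_mult \<zeta>) simp_all

lemma poly_evals_prod:
  "(\<And>a. a \<in> A \<Longrightarrow> poly_evals n \<zeta> (f a) (g a)) \<Longrightarrow> poly_evals n \<zeta> (prod f A) (prod g A)"
  by (induction A rule: infinite_finite_induct) (auto intro: poly_evals_mult poly_evals_1)

text \<open>By the Leibniz formula a determinant is a signed sum of products of entries, and the
  relation respects sums, products and signs.\<close>

lemma poly_evals_det:
  assumes "\<And>x y. x \<in> set xs \<Longrightarrow> y \<in> set xs \<Longrightarrow> poly_evals n \<zeta> (f x y) (g x y)"
  shows "poly_evals n \<zeta> (det (mat_of xs xs f)) (det (mat_of xs xs g))"
proof -
  have sgn: "poly_evals n \<zeta> (signof p) (signof p)" for p :: "nat \<Rightarrow> nat"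
    by (simp add: sign_def poly_evals_1 poly_evals_uminus)
  have "poly_evals n \<zeta> (mat_of xs xs f $$ (i, p i)) (mat_of xs xs g $$ (i, p i))"
    if "p permutes {0..<length xs}" "i \<in> {0..<length xs}" for p i
    using that permutes_in_image[OF that(1), of i] assms by (simp add: mat_of_def)
  then show ?thesis
    unfolding det_def'[OF mat_of_carrier]
    by (intro poly_evals_sum poly_evals_mult poly_evals_prod sgn) simp
qed

end

section \<open>Characters of the quotient groups\<close>

lemma cosetI: "(\<And>i. x i = \<gamma> i + of_nat CARD('p) ^ n * \<eta> i) \<Longrightarrow> x \<in> coset n \<gamma>"
  for \<gamma> :: "'d \<Rightarrow> 'p :: prime_card padic_int"
  unfolding coset_def by (intro CollectI exI conjI ext) simp_all

lemma cosetE: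
  assumes "x \<in> coset n (\<gamma> :: 'd \<Rightarrow> 'p :: prime_card padic_int)"
  obtains \<eta> where "x = (\<lambda>i. \<gamma> i + of_nat CARD('p) ^ n * \<eta> i)"
  using assms unfolding coset_def by (elim CollectE exE conjE) (rule that)

lemma mem_coset_self: "\<gamma> \<in> coset n \<gamma>"
  by (rule cosetI[where \<eta> = "\<lambda>_. 0"]) simp

lemma coset_eq_iff:
  fixes \<gamma> \<delta> :: "'d \<Rightarrow> 'p :: prime_card padic_int"
  shows "coset n \<gamma> = coset n \<delta> \<longleftrightarrow> (\<forall>i. padic_residue (\<gamma> i) n = padic_residue (\<delta> i) n)"
proof
  have res: "padic_residue (x + of_nat CARD('p) ^ n * y) n = padic_residue x n" for x y :: "'p padic_int"
    using padic_residue_of_nat[of "CARD('p) ^ n" n, where 'p = 'p]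
    by (simp add: plus_padic_int.rep_eq times_padic_int.rep_eq)
  note mem_coset_self[of \<gamma> n]
  moreover assume "coset n \<gamma> = coset n \<delta>"
  ultimately have "\<gamma> \<in> coset n \<delta>" by simp
  then show "\<forall>i. padic_residue (\<gamma> i) n = padic_residue (\<delta> i) n"
    unfolding coset_def by (auto simp: res)
next
  have sub: "coset n \<gamma> \<subseteq> coset n \<delta>" if "\<forall>i. padic_residue (\<gamma> i) n = padic_residue (\<delta> i) n"
    for \<gamma> \<delta> :: "'d \<Rightarrow> 'p padic_int"
  proof
    fix x assume "x \<in> coset n \<gamma>"
    then obtain \<eta> where x: "x = (\<lambda>i. \<gamma> i + of_nat CARD('p) ^ n * \<eta> i)" by (rule cosetE)
    have "of_nat CARD('p) ^ n dvd \<gamma> i - \<delta> i" for i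
      using that by (intro prime_power_dvd_padic_int) (simp add: minus_padic_int.rep_eq)
    then have "\<forall>i. \<exists>y. \<gamma> i - \<delta> i = of_nat CARD('p) ^ n * y" by (auto simp: dvd_def)
    from choice[OF this] obtain y where y: "\<forall>i. \<gamma> i - \<delta> i = of_nat CARD('p) ^ n * y i" ..
    show "x \<in> coset n \<delta>"
    proof (rule cosetI)
      fix i
      have "\<gamma> i = \<delta> i + of_nat CARD('p) ^ n * y i"
        using y[rule_format, of i] by (simp only: diff_eq_eq add.commute)
      then show "x i = \<delta> i + of_nat CARD('p) ^ n * (y i + \<eta> i)"
        unfolding x by (simp only: distrib_left add.assoc)
    qed
  qed
  assume "\<forall>i. padic_residue (\<gamma> i) n = padic_residue (\<delta> i) n"
  then show "coset n \<gamma> = coset n \<delta>" using sub[of \<gamma> \<delta>] sub[of \<delta> \<gamma>] by auto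
qed

lemma coset_add_coset: "coset_add (coset n \<gamma>) (coset n \<delta>) = coset n (\<lambda>i. \<gamma> i + \<delta> i)"
  for \<gamma> \<delta> :: "'d \<Rightarrow> 'p :: prime_card padic_int"
proof (intro equalityI subsetI)
  fix x assume "x \<in> coset_add (coset n \<gamma>) (coset n \<delta>)"
  then obtain \<eta> \<theta> where "x = (\<lambda>i. \<gamma> i + of_nat CARD('p) ^ n * \<eta> i + (\<delta> i + of_nat CARD('p) ^ n * \<theta> i))"
    by (auto simp: coset_add_def coset_def)
  then show "x \<in> coset n (\<lambda>i. \<gamma> i + \<delta> i)"
    by (intro cosetI[where \<eta> = "\<lambda>i. \<eta> i + \<theta> i"]) (simp only: algebra_simps)
next
  fix x assume "x \<in> coset n (\<lambda>i. \<gamma> i + \<delta> i)"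
  then obtain \<eta> where x: "x = (\<lambda>i. \<gamma> i + \<delta> i + of_nat CARD('p) ^ n * \<eta> i)" by (rule cosetE)
  note mem_coset_self[of \<gamma> n]
  moreover have "(\<lambda>i. \<delta> i + of_nat CARD('p) ^ n * \<eta> i) \<in> coset n \<delta>" by (rule cosetI) (rule refl)
  moreover have "x = (\<lambda>i. \<gamma> i + (\<delta> i + of_nat CARD('p) ^ n * \<eta> i))" by (simp add: x add.assoc)
  ultimately show "x \<in> coset_add (coset n \<gamma>) (coset n \<delta>)"
    unfolding coset_add_def by (intro CollectI exI conjI)
qed

text \<open>Standard representatives turn a sum over the quotient group into a sum over a box, which
  factors coordinate by coordinate.\<close>

lemma coset_of_nat_bij:
  "bij_betw (\<lambda>r. coset n (\<lambda>i. of_nat (r i)))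
     (UNIV \<rightarrow>\<^sub>E {..<CARD('p) ^ n}) (quotient_group n :: ('d :: finite \<Rightarrow> 'p :: prime_card padic_int) set set)"
  unfolding bij_betw_def
proof
  have res: "padic_residue (of_nat m :: 'p padic_int) n = int m" if "m < CARD('p) ^ n" for m
    using that by (simp add: padic_residue_of_nat flip: of_nat_power of_nat_mod)
  show "inj_on (\<lambda>r. coset n (\<lambda>i. of_nat (r i)) :: ('d \<Rightarrow> 'p padic_int) set) (UNIV \<rightarrow>\<^sub>E {..<CARD('p) ^ n})"
  proof (rule inj_onI)
    fix r s :: "'d \<Rightarrow> nat"
    assume "r \<in> UNIV \<rightarrow>\<^sub>E {..<CARD('p) ^ n}" "s \<in> UNIV \<rightarrow>\<^sub>E {..<CARD('p) ^ n}"
      and eq: "coset n (\<lambda>i. of_nat (r i) :: 'p padic_int) = coset n (\<lambda>i. of_nat (s i))"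
    then have "r i < CARD('p) ^ n" "s i < CARD('p) ^ n" for i by (auto simp: PiE_def Pi_def)
    then show "r = s" using eq unfolding coset_eq_iff by (simp add: res fun_eq_iff)
  qed
  have "g \<in> (\<lambda>r. coset n (\<lambda>i. of_nat (r i))) ` (UNIV \<rightarrow>\<^sub>E {..<CARD('p) ^ n})"
    if g_in: "g \<in> quotient_group n" for g :: "('d \<Rightarrow> 'p padic_int) set"
  proof -
    obtain \<gamma> where g: "g = coset n \<gamma>" using g_in by (auto simp: quotient_group_def)
    define r where "r i = nat (padic_residue (\<gamma> i) n)" for i
    have r: "r i < CARD('p) ^ n" for i
      using padic_residue_less[of "\<gamma> i" n] padic_residue_nonneg[of "\<gamma> i" n] by (simp add: r_def nat_less_iff)
    have "g = coset n (\<lambda>i. of_nat (r i))"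
      unfolding g coset_eq_iff by (simp add: res[OF r]) (simp add: r_def)
    then show ?thesis using r by (intro image_eqI[where x = r]) auto
  qed
  then show "(\<lambda>r. coset n (\<lambda>i. of_nat (r i))) ` (UNIV \<rightarrow>\<^sub>E {..<CARD('p) ^ n}) =
      (quotient_group n :: ('d \<Rightarrow> 'p padic_int) set set)"
    by (auto simp: quotient_group_def)
qed

lemma finite_quotient_group: "finite (quotient_group n :: ('d :: finite \<Rightarrow> 'p :: prime_card padic_int) set set)"
  using bij_betw_finite[OF coset_of_nat_bij] by (simp add: finite_PiE)

lemma card_quotient_group:
  "card (quotient_group n :: ('d :: finite \<Rightarrow> 'p :: prime_card padic_int) set set) = CARD('p) ^ (CARD('d) * n)"
  using bij_betw_same_card[OF coset_of_nat_bij[where 'd = 'd and 'p = 'p and n = n]]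
  by (simp add: card_PiE power_mult[symmetric] mult.commute)

text \<open>The chosen representative does not matter, because \<open>root_character n\<close> sees
  only residues modulo the \<open>n\<close>-th power of p, and these are constant on a
  coset.\<close>

definition coset_character ::
    "nat \<Rightarrow> ('d :: finite \<Rightarrow> 'p :: prime_card padic_closure) \<Rightarrow> ('d \<Rightarrow> 'p padic_int) set \<Rightarrow> 'p padic_closure" where
  "coset_character n \<zeta> g = root_character n \<zeta> (SOME \<gamma>. coset n \<gamma> = g)"

lemma coset_character_coset: "coset_character n \<zeta> (coset n \<gamma>) = root_character n \<zeta> \<gamma>"
proof -
  define \<delta> where "\<delta> = (SOME \<delta>. coset n \<delta> = coset n \<gamma>)"
  have "coset n \<delta> = coset n \<gamma>"
    unfolding \<delta>_def by (rule someI[where P = "\<lambda>\<delta>. coset n \<delta> = coset n \<gamma>"]) (rule refl)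
  moreover have "coset_character n \<zeta> (coset n \<gamma>) = root_character n \<zeta> \<delta>"
    by (simp only: coset_character_def \<delta>_def)
  ultimately show ?thesis unfolding coset_eq_iff by (simp add: root_character_def)
qed

lemma coset_character_add:
  fixes \<zeta> :: "'d :: finite \<Rightarrow> 'p :: prime_card padic_closure"
  assumes "\<And>i. \<zeta> i ^ (CARD('p) ^ n) = 1" and "g \<in> quotient_group n"
  shows "coset_character n \<zeta> (coset_add g (coset n \<gamma>)) = coset_character n \<zeta> g * root_character n \<zeta> \<gamma>"
  using assms(2) by (auto simp: quotient_group_def coset_add_coset coset_character_coset root_character_add[OF assms(1)])

text \<open>Over standard representatives the sum is a product of geometric sums in the ratios of
  the coordinates of \<xi> and \<zeta>. A ratio different from 1 has order dividing the number of
  terms and makes its factor 0. The inverse plays the part of complex conjugation.\<close>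

lemma coset_character_orthogonal:
  fixes \<zeta> \<xi> :: "'d :: finite \<Rightarrow> 'p :: prime_card padic_closure"
  assumes \<zeta>: "\<And>i. \<zeta> i ^ (CARD('p) ^ n) = 1" and \<xi>: "\<And>i. \<xi> i ^ (CARD('p) ^ n) = 1"
  shows "(\<Sum>g\<in>quotient_group n. inverse (coset_character n \<zeta> g) * coset_character n \<xi> g) =
    (if \<zeta> = \<xi> then of_nat (CARD('p) ^ (CARD('d) * n)) else 0)"
proof -
  let ?P = "CARD('p) ^ n"
  have nz: "\<zeta> i \<noteq> 0" for i
  proof
    assume "\<zeta> i = 0"
    then show False using \<zeta>[of i] by (simp add: zero_power)
  qed
  have char: "coset_character n \<theta> (coset n (\<lambda>i. of_nat (r i))) = (\<Prod>i\<in>UNIV. \<theta> i ^ r i)"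
    if "r \<in> UNIV \<rightarrow>\<^sub>E {..<?P}" for \<theta> :: "'d \<Rightarrow> 'p padic_closure" and r
  proof -
    have "r i < ?P" for i using that by (auto simp: PiE_def Pi_def)
    then have "nat (padic_residue (of_nat (r i) :: 'p padic_int) n) = r i" for i
      by (simp add: padic_residue_of_nat flip: of_nat_power of_nat_mod)
    then show ?thesis by (simp add: coset_character_coset root_character_def)
  qed
  have "(\<Sum>g\<in>quotient_group n. inverse (coset_character n \<zeta> g) * coset_character n \<xi> g) =
      (\<Sum>r\<in>UNIV \<rightarrow>\<^sub>E {..<?P}. inverse (coset_character n \<zeta> (coset n (\<lambda>i. of_nat (r i)))) *
        coset_character n \<xi> (coset n (\<lambda>i. of_nat (r i))))"
    by (rule sum.reindex_bij_betw[OF coset_of_nat_bij, symmetric])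
  also have "\<dots> = (\<Sum>r\<in>UNIV \<rightarrow>\<^sub>E {..<?P}. \<Prod>i\<in>UNIV. (\<xi> i / \<zeta> i) ^ r i)"
    by (rule sum.cong) (simp_all add: char prod_inversef[symmetric] prod.distrib[symmetric] power_mult_distrib power_inverse divide_inverse mult.commute)
  also have "\<dots> = (\<Prod>i\<in>UNIV. \<Sum>t<?P. (\<xi> i / \<zeta> i) ^ t)"
    by (rule prod_sum_PiE[symmetric]) simp_all
  also have "\<dots> = (if \<zeta> = \<xi> then of_nat (CARD('p) ^ (CARD('d) * n)) else 0)"
  proof (cases "\<zeta> = \<xi>")
    case True
    have "(\<Sum>t<?P. (\<xi> i / \<zeta> i) ^ t) = of_nat ?P" for i
      using nz True by simp
    then have "(\<Prod>i\<in>UNIV. \<Sum>t<?P. (\<xi> i / \<zeta> i) ^ t) = of_nat ?P ^ CARD('d)"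
      by (simp only: prod_constant)
    also have "\<dots> = of_nat (CARD('p) ^ (CARD('d) * n))"
      by (simp only: of_nat_power[symmetric] power_mult[symmetric] mult.commute)
    finally show ?thesis using True by simp
  next
    case False
    then obtain i where i: "\<zeta> i \<noteq> \<xi> i" by (auto simp: fun_eq_iff)
    then have "\<xi> i / \<zeta> i \<noteq> 1" using nz[of i] by simp
    moreover have "(\<xi> i / \<zeta> i) ^ ?P = 1" using \<zeta>[of i] \<xi>[of i] by (simp add: power_divide)
    ultimately have "(\<Sum>t<?P. (\<xi> i / \<zeta> i) ^ t) = 0" by (simp add: geometric_sum)
    then show ?thesis using False by (simp only: if_False) (rule prod_zero, auto)
  qed
  finally show ?thesis .
qed

section \<open>The number of characters\<close>

text \<open>The polynomial x^m - 1 splits, and a repeated root would be a root of its derivative m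
  x^(m-1), whose only possible root is 0. The count is needed to know that there are as many
  characters as cosets, so that the character matrix is square.\<close>

lemma card_roots_of_unity:
  assumes "0 < m"
  shows "card {z :: 'a :: {alg_closed_field, field_char_0}. z ^ m = 1} = m"
    and "finite {z :: 'a :: {alg_closed_field, field_char_0}. z ^ m = 1}"
proof -
  define P where "P = monom 1 m - (1 :: 'a poly)"
  have coeff: "coeff P i = (if i = m then 1 else if i = 0 then -1 else 0)" for i
    using assms by (auto simp: P_def coeff_1)
  have "degree P \<le> m" by (rule degree_le) (simp add: coeff)
  moreover have "m \<le> degree P" by (rule le_degree) (simp add: coeff)
  ultimately have deg: "degree P = m" by simp
  have P: "P \<noteq> 0" using deg assms by auto
  obtain A where A: "size A = degree P" "P = smult (lead_coeff P) (\<Prod>x\<in>#A. [:-x, 1:])"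
    using alg_closed_imp_factorization[OF P] by blast
  have lc: "lead_coeff P = 1" using coeff[of m] by (simp add: deg)
  have A2: "P = (\<Prod>x\<in>#A. [:-x, 1:])" using A(2) lc by simp
  have root: "poly P z = 0 \<longleftrightarrow> z ^ m = 1" for z by (simp add: P_def poly_monom)
  have set: "{z. z ^ m = 1} = set_mset A"
  proof -
    have "poly P z = 0 \<longleftrightarrow> z \<in># A" for z
      unfolding A2 poly_prod_mset by (auto simp: prod_mset_zero_iff)
    then show ?thesis using root by auto
  qed
  have count: "count A z = 1" if z: "z \<in># A" for z
  proof (rule ccontr)
    assume "count A z \<noteq> 1"
    moreover have "0 < count A z" using z by simp
    ultimately have "1 < count A z" by linarith
    then have "z \<in># A - {#z#}" by (simp add: in_diff_count)
    then obtain B where "A - {#z#} = add_mset z B" by (metis mset_add)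
    then have "A = add_mset z (add_mset z B)" using z by (metis insert_DiffM)
    then have "P = [:-z, 1:] * ([:-z, 1:] * (\<Prod>x\<in>#B. [:-x, 1:]))" unfolding A2 by simp
    moreover have "poly [:-z, 1:] z = 0" by simp
    ultimately have "poly (pderiv P) z = 0"
      by (simp only: pderiv_mult poly_add poly_mult mult_zero_left mult_zero_right add_0)
    moreover have "pderiv P = monom (of_nat m) (m - 1)" by (simp add: P_def pderiv_diff pderiv_monom)
    moreover have "z ^ m = 1" using z set by blast
    then have "z \<noteq> 0" using assms by (auto simp: zero_power)
    ultimately show False using assms by (simp add: poly_monom)
  qed
  have "size A = card (set_mset A)" unfolding size_multiset_overloaded_eq using count by simp
  then show "card {z :: 'a. z ^ m = 1} = m" using set A(1) deg by simp
  show "finite {z :: 'a. z ^ m = 1}" unfolding set by simp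
qed

lemma root_tuples_eq_PiE:
  "{\<zeta> :: 'd :: finite \<Rightarrow> 'a :: monoid_mult. \<forall>i. \<zeta> i ^ m = 1} = (UNIV \<rightarrow>\<^sub>E {z. z ^ m = 1})"
  by (auto simp: PiE_def Pi_def)

lemma card_root_tuples:
  assumes "0 < m"
  shows "card {\<zeta> :: 'd :: finite \<Rightarrow> 'a :: {alg_closed_field, field_char_0}. \<forall>i. \<zeta> i ^ m = 1} = m ^ CARD('d)"
    and "finite {\<zeta> :: 'd :: finite \<Rightarrow> 'a :: {alg_closed_field, field_char_0}. \<forall>i. \<zeta> i ^ m = 1}"
  unfolding root_tuples_eq_PiE using card_roots_of_unity[OF assms, where 'a = 'a]
  by (simp_all add: card_PiE finite_PiE)

section \<open>The derived graphs\<close>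

lemma coset_uminus_add:
  fixes \<gamma> \<delta> :: "'d \<Rightarrow> 'p :: prime_card padic_int"
  assumes "g \<in> quotient_group n" "\<And>i. \<delta> i = - \<gamma> i"
  shows "coset_add (coset_add g (coset n \<gamma>)) (coset n \<delta>) = g"
  using assms by (auto simp: quotient_group_def coset_add_coset)

lemma coset_add_quotient_group:
  "g \<in> quotient_group n \<Longrightarrow> coset_add g (coset n \<gamma>) \<in> quotient_group n"
  by (auto simp: quotient_group_def coset_add_coset)

text \<open>The covering property: each edge of \<open>G\<close> starting at \<open>v\<close> has
  exactly one lift starting at \<open>(v, g)\<close>. Hence Grover weights upstairs and downstairs
  agree.\<close>

lemma out_degree_derived_digraph:
  fixes \<alpha> :: "'e \<Rightarrow> 'd :: finite \<Rightarrow> 'p :: prime_card padic_int"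
  assumes "g \<in> quotient_group n"
  shows "out_degree (derived_digraph G \<alpha> n) (v, g) = out_degree G v"
proof -
  have "out_arcs (derived_digraph G \<alpha> n) (v, g) = (\<lambda>e. (e, g)) ` out_arcs G v"
    using assms by (auto simp: out_arcs_def derived_digraph_def)
  moreover have "inj_on (\<lambda>e. (e, g)) (out_arcs G v)" by (rule inj_onI) simp
  ultimately show ?thesis by (simp add: out_degree_def card_image)
qed

definition twisted_matrix_entry ::
    "('v, 'e) pre_digraph \<Rightarrow> ('e \<Rightarrow> 'd :: finite \<Rightarrow> 'p :: prime_card padic_int) \<Rightarrow> nat \<Rightarrow>
     ('d \<Rightarrow> 'p padic_closure) \<Rightarrow> 'v \<Rightarrow> 'v \<Rightarrow> 'p padic_closure" where
  "twisted_matrix_entry G \<alpha> n \<zeta> v w =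
     (\<Sum>e | e \<in> arcs G \<and> tail G e = v \<and> head G e = w. grover_weight G e * root_character n \<zeta> (\<alpha> e))"

text \<open>The \<open>(v, w)\<close> entry of (A^2 + 1) I - A W when \<open>c\<close> is that entry
  of W; used for the base graph and the derived graph alike.\<close>

definition char_entry :: "'v \<Rightarrow> 'v \<Rightarrow> 'a :: comm_ring_1 \<Rightarrow> 'a poly" where
  "char_entry v w c = (if v = w then [:1, 0, 1:] else 0) - [:0, 1:] * [:c:]"

lemma specialize_spectral_poly:
  fixes \<zeta> :: "'d :: finite \<Rightarrow> 'p :: prime_card padic_closure"
  assumes \<zeta>: "\<And>i. \<zeta> i ^ (CARD('p) ^ n) = 1" and vs: "distinct vs"
  shows "specialize (spectral_poly G \<alpha> vs) (\<lambda>i. \<zeta> i - 1) =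
    det (mat_of vs vs (\<lambda>v w. char_entry v w (twisted_matrix_entry G \<alpha> n \<zeta> v w)))"
proof (rule specialize_poly_evals[OF \<zeta>])
  have "weighted_matrix G \<alpha> vs = mat_of vs vs (\<lambda>v w. \<Sum>e | e \<in> arcs G \<and> tail G e = v \<and> head G e = w.
      mfps_const (grover_weight G e) * voltage_series (\<alpha> e))"
    by (simp add: weighted_matrix_def mat_of_def)
  then have S: "spectral_poly G \<alpha> vs = det (mat_of vs vs (\<lambda>v w. (if v = w then [:1, 0, 1:] else 0) - [:0, 1:] *
      [:\<Sum>e | e \<in> arcs G \<and> tail G e = v \<and> head G e = w. mfps_const (grover_weight G e) * voltage_series (\<alpha> e):]))"
    by (simp only: spectral_poly_def mat_of_one[OF vs] map_mat_mat_of smult_mat_of mat_of_minus)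
  \<comment> \<open>Both sides name the same rational number, once in the p-adic field and once in
    its closure.\<close>
  have w: "to_ac (grover_weight G e) = grover_weight G e" for e
    by (simp add: grover_weight_def)
  have base: "series_evals n \<zeta> (mfps_const (grover_weight G e) * voltage_series (\<alpha> e))
      (grover_weight G e * root_character n \<zeta> (\<alpha> e))" for e
    using series_evals.base[of n \<zeta> "grover_weight G e" "\<alpha> e"] unfolding w .
  show "poly_evals n \<zeta> (spectral_poly G \<alpha> vs)
      (det (mat_of vs vs (\<lambda>v w. char_entry v w (twisted_matrix_entry G \<alpha> n \<zeta> v w))))"
    unfolding S char_entry_def twisted_matrix_entry_def
    by (intro poly_evals_det[OF \<zeta>] poly_evals_diff poly_evals_mult[OF \<zeta>] poly_evals_pCons poly_evals_0
        series_evals_0 series_evals_1 series_evals_sum base)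
      (auto intro!: poly_evals_pCons poly_evals_0 series_evals_0 series_evals_1)
qed

text \<open>The lift of \<open>e\<close> starting over the coset \<open>g\<close> ends over
  \<open>g\<close> plus the voltage of \<open>e\<close>, where the character has gained the factor
  \<open>root_character n \<zeta> (\<alpha> e)\<close>. Applying the adjacency matrix upstairs to a
  character on the fibre of \<open>w\<close> therefore gives the character times a twisted entry
  downstairs.\<close>

lemma sum_adjacency_derived_digraph:
  fixes \<zeta> :: "'d :: finite \<Rightarrow> 'p :: prime_card padic_closure"
    and \<alpha> :: "'e \<Rightarrow> 'd \<Rightarrow> 'p padic_int"
  assumes \<zeta>: "\<And>i. \<zeta> i ^ (CARD('p) ^ n) = 1" and fin: "finite (arcs G)" and g: "g \<in> quotient_group n"
  shows "(\<Sum>h\<in>quotient_group n. (\<Sum>e | e \<in> arcs (derived_digraph G \<alpha> n) \<and>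
      tail (derived_digraph G \<alpha> n) e = (v, g) \<and> head (derived_digraph G \<alpha> n) e = (w, h).
      grover_weight (derived_digraph G \<alpha> n) e) * coset_character n \<zeta> h) =
    coset_character n \<zeta> g * twisted_matrix_entry G \<alpha> n \<zeta> v w"
proof -
  let ?D = "derived_digraph G \<alpha> n"
  let ?E = "{e \<in> arcs G. tail G e = v \<and> head G e = w}"
  have fE: "finite ?E" using fin by simp
  have "(\<Sum>e | e \<in> arcs ?D \<and> tail ?D e = (v, g) \<and> head ?D e = (w, h). grover_weight ?D e :: 'p padic_closure) =
      (\<Sum>e\<in>?E. if coset_add g (coset n (\<alpha> e)) = h then grover_weight G e else 0)" for h
  proof -
    have "{e. e \<in> arcs ?D \<and> tail ?D e = (v, g) \<and> head ?D e = (w, h)} =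
        (\<lambda>e. (e, g)) ` {e \<in> ?E. coset_add g (coset n (\<alpha> e)) = h}"
      using g by (auto simp: derived_digraph_def)
    moreover have "inj_on (\<lambda>e. (e, g)) {e \<in> ?E. coset_add g (coset n (\<alpha> e)) = h}" by (rule inj_onI) simp
    ultimately have "(\<Sum>e | e \<in> arcs ?D \<and> tail ?D e = (v, g) \<and> head ?D e = (w, h). grover_weight ?D e :: 'p padic_closure) =
        (\<Sum>e\<in>{e \<in> ?E. coset_add g (coset n (\<alpha> e)) = h}. grover_weight ?D (e, g))"
      by (simp add: sum.reindex)
    also have "\<dots> = (\<Sum>e\<in>{e \<in> ?E. coset_add g (coset n (\<alpha> e)) = h}. grover_weight G e)"
      by (rule sum.cong) (simp_all add: grover_weight_def out_degree_derived_digraph[OF g, of G \<alpha>] derived_digraph_def[of G \<alpha> n, THEN arg_cong[where f = tail]])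
    finally show ?thesis by (simp only: sum.inter_filter[OF fE])
  qed
  then have "(\<Sum>h\<in>quotient_group n. (\<Sum>e | e \<in> arcs ?D \<and> tail ?D e = (v, g) \<and> head ?D e = (w, h).
      grover_weight ?D e) * coset_character n \<zeta> h) =
      (\<Sum>h\<in>quotient_group n. \<Sum>e\<in>?E. (if coset_add g (coset n (\<alpha> e)) = h then grover_weight G e else 0) * coset_character n \<zeta> h)"
    by (simp only: sum_distrib_right)
  also have "\<dots> = (\<Sum>e\<in>?E. \<Sum>h\<in>quotient_group n. (if coset_add g (coset n (\<alpha> e)) = h then grover_weight G e else 0) * coset_character n \<zeta> h)"
    by (rule sum.swap)
  also have "\<dots> = (\<Sum>e\<in>?E. grover_weight G e * coset_character n \<zeta> (coset_add g (coset n (\<alpha> e))))"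
    by (intro sum.cong refl sum_if_eq_mult finite_quotient_group coset_add_quotient_group g)
  also have "\<dots> = coset_character n \<zeta> g * twisted_matrix_entry G \<alpha> n \<zeta> v w"
    by (simp only: coset_character_add[OF \<zeta> g] twisted_matrix_entry_def sum_distrib_left ac_simps)
  finally show ?thesis .
qed

lemma const_poly_sum: "[:\<Sum>a\<in>A. f a:] = (\<Sum>a\<in>A. [:f a:])"
proof (induction A rule: infinite_finite_induct)
  case (insert a A)
  have "[:\<Sum>a\<in>insert a A. f a:] = [:f a:] + [:\<Sum>a\<in>A. f a:]" using insert.hyps by simp
  then show ?case using insert by simp
qed simp_all

lemma sum_Times: "(\<Sum>z\<in>A \<times> B. f z) = (\<Sum>a\<in>A. \<Sum>b\<in>B. f (a, b))"
  by (simp add: sum.cartesian_product)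

text \<open>Column \<open>(\<zeta>, w)\<close> of \<open>\<Phi>\<close> is the character \<zeta>
  placed on the fibre over \<open>w\<close>. The intertwining \<open>M * \<Phi> = \<Phi> * B\<close>
  with \<open>B\<close> block diagonal gives equal determinants once that of \<open>\<Phi>\<close>
  is known to be nonzero.\<close>

lemma det_derived_digraph:
  fixes G :: "('v, 'e) pre_digraph" and \<alpha> :: "'e \<Rightarrow> 'd :: finite \<Rightarrow> 'p :: prime_card padic_int"
  assumes fin: "finite (arcs G)" and vs: "distinct vs"
    and gs: "distinct gs" "set gs = (quotient_group n :: ('d \<Rightarrow> 'p padic_int) set set)"
  shows "det (mat_of (List.product vs gs) (List.product vs gs) (\<lambda>x y. char_entry x y
      (\<Sum>e | e \<in> arcs (derived_digraph G \<alpha> n) \<and> tail (derived_digraph G \<alpha> n) e = x \<and>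
        head (derived_digraph G \<alpha> n) e = y. grover_weight (derived_digraph G \<alpha> n) e))) =
    (\<Prod>\<zeta> | \<forall>i. \<zeta> i ^ (CARD('p) ^ n) = (1 :: 'p padic_closure).
      det (mat_of vs vs (\<lambda>v w. char_entry v w (twisted_matrix_entry G \<alpha> n \<zeta> v w))))"
proof -
  let ?Z = "{\<zeta> :: 'd \<Rightarrow> 'p padic_closure. \<forall>i. \<zeta> i ^ (CARD('p) ^ n) = 1}"
  let ?D = "derived_digraph G \<alpha> n"
  let ?q = "CARD('p) ^ (CARD('d) * n)"
  have pn: "0 < CARD('p) ^ n" by simp
  note Z = card_root_tuples[OF pn, where 'd = 'd and 'a = "'p padic_closure"]
  obtain zs where zs: "set zs = ?Z" "distinct zs" using finite_distinct_list[OF Z(2)] by blast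
  define xs where "xs = List.product vs gs"
  \<comment> \<open>The character is the outer index here, so that the entries of \<open>B\<close>
    for one \<zeta> form a contiguous diagonal block; for \<open>xs\<close> the vertex is the outer
    index.\<close>
  define ys where "ys = List.product zs vs"
  have xs: "distinct xs" "set xs = set vs \<times> quotient_group n"
    by (simp_all add: xs_def distinct_product vs gs)
  have ys: "distinct ys" "set ys = ?Z \<times> set vs"
    by (simp_all add: ys_def distinct_product vs zs)
  have "length gs = ?q"
    using distinct_card[OF gs(1)] by (simp add: gs card_quotient_group)
  moreover have "length zs = ?q"
    using distinct_card[OF zs(2)] Z(1) by (simp add: zs(1) power_mult[symmetric] mult.commute)
  \<comment> \<open>Equality of the number of characters and the number of cosets makes
    \<open>\<Phi>\<close> and \<open>\<Psi>\<close> square matrices of the same size.\<close>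
  ultimately have len: "length xs = length ys" by (simp add: xs_def ys_def)
  define a where "a x y = (\<Sum>e | e \<in> arcs ?D \<and> tail ?D e = x \<and> head ?D e = y. grover_weight ?D e :: 'p padic_closure)" for x y
  define b where "b = twisted_matrix_entry G \<alpha> n"
  define \<Phi> where "\<Phi> = mat_of xs ys (\<lambda>x y. if fst x = snd y then [:coset_character n (fst y) (snd x):] else 0)"
  define \<Psi> where "\<Psi> = mat_of ys xs (\<lambda>y x. if fst x = snd y then [:inverse (coset_character n (fst y) (snd x)):] else 0)"
  define M where "M = mat_of xs xs (\<lambda>x y. char_entry x y (a x y))"
  define B where "B = mat_of ys ys (\<lambda>x y. if fst x = fst y then char_entry (snd x) (snd y) (b (fst x) (snd x) (snd y)) else 0)"
  let ?k = "length xs"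
  have carr: "\<Phi> \<in> carrier_mat ?k ?k" "\<Psi> \<in> carrier_mat ?k ?k" "M \<in> carrier_mat ?k ?k" "B \<in> carrier_mat ?k ?k"
    by (auto simp: \<Phi>_def \<Psi>_def M_def B_def len intro!: carrier_matI)
  have "\<Psi> * \<Phi> = mat_of ys ys (\<lambda>x y. if x = y then [:of_nat ?q:] else 0)"
    unfolding \<Psi>_def \<Phi>_def mat_of_mult[OF xs(1)]
  proof (rule mat_of_cong)
    fix x y assume xy: "x \<in> set ys" "y \<in> set ys"
    obtain \<zeta> u \<xi> w where eq: "x = (\<zeta>, u)" "y = (\<xi>, w)" by (cases x, cases y)
    then have \<zeta>: "\<And>i. \<zeta> i ^ (CARD('p) ^ n) = 1" and \<xi>: "\<And>i. \<xi> i ^ (CARD('p) ^ n) = 1" and u: "u \<in> set vs"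
      using xy ys(2) by auto
    have "(\<Sum>z\<in>set xs. (if fst z = snd x then [:inverse (coset_character n (fst x) (snd z)):] else 0) *
        (if fst z = snd y then [:coset_character n (fst y) (snd z):] else 0)) =
      (\<Sum>g\<in>quotient_group n. \<Sum>v\<in>set vs. (if v = u then [:inverse (coset_character n \<zeta> g):] else 0) *
        (if v = w then [:coset_character n \<xi> g:] else 0))"
      unfolding xs(2) sum_Times by (subst sum.swap) (simp only: eq fst_conv snd_conv)
    also have "\<dots> = (\<Sum>g\<in>quotient_group n. [:inverse (coset_character n \<zeta> g):] * (if u = w then [:coset_character n \<xi> g:] else 0))"
      by (intro sum.cong refl sum_if_eq_mult u) simp
    also have "\<dots> = (if u = w then [:\<Sum>g\<in>quotient_group n. inverse (coset_character n \<zeta> g) * coset_character n \<xi> g:] else 0)"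
      unfolding const_poly_sum by simp
    also have "\<dots> = (if x = y then [:of_nat ?q:] else 0)"
      unfolding coset_character_orthogonal[OF \<zeta> \<xi>] by (auto simp: eq)
    finally show "(\<Sum>z\<in>set xs. (if fst z = snd x then [:inverse (coset_character n (fst x) (snd z)):] else 0) *
        (if fst z = snd y then [:coset_character n (fst y) (snd z):] else 0)) = (if x = y then [:of_nat ?q:] else 0)" .
  qed
  also have "\<dots> = [:of_nat ?q:] \<cdot>\<^sub>m 1\<^sub>m ?k" unfolding len mat_of_one[OF ys(1)] ..
  finally have "det (\<Psi> * \<Phi>) = [:of_nat ?q:] ^ ?k" by simp
  moreover have "[:of_nat ?q :: 'p padic_closure:] \<noteq> 0" by simp
  ultimately have "det \<Psi> * det \<Phi> \<noteq> 0" unfolding det_mult[OF carr(2,1)] by simp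
  \<comment> \<open>Orthogonality makes the product of the two determinants a power of the nonzero
    constant \<open>?q\<close>, as the characteristic is 0. In the integral domain of polynomials
    this permits cancelling the determinant of \<open>\<Phi>\<close>.\<close>
  then have nz: "det \<Phi> \<noteq> 0" by simp
  have "M * \<Phi> = \<Phi> * B"
    unfolding M_def \<Phi>_def B_def mat_of_mult[OF xs(1)] mat_of_mult[OF ys(1)]
  proof (rule mat_of_cong)
    fix x y assume xy: "x \<in> set xs" "y \<in> set ys"
    obtain v g \<zeta> w where eq: "x = (v, g)" "y = (\<zeta>, w)" by (cases x, cases y)
    then have \<zeta>: "\<And>i. \<zeta> i ^ (CARD('p) ^ n) = 1" and v: "v \<in> set vs" and w: "w \<in> set vs"
      and g: "g \<in> quotient_group n" and \<zeta>Z: "\<zeta> \<in> ?Z"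
      using xy ys(2) xs(2) by auto
    have "(\<Sum>z\<in>set xs. char_entry x z (a x z) * (if fst z = snd y then [:coset_character n (fst y) (snd z):] else 0)) =
        (\<Sum>h\<in>quotient_group n. \<Sum>u\<in>set vs. (if u = w then [:coset_character n \<zeta> h:] else 0) * char_entry (v, g) (u, h) (a (v, g) (u, h)))"
      unfolding xs(2) sum_Times by (subst sum.swap) (simp only: eq fst_conv snd_conv mult.commute)
    also have "\<dots> = (\<Sum>h\<in>quotient_group n. [:coset_character n \<zeta> h:] * char_entry (v, g) (w, h) (a (v, g) (w, h)))"
      by (intro sum.cong refl sum_if_eq_mult w) simp
    also have "\<dots> = (\<Sum>h\<in>quotient_group n. (if g = h then (if v = w then [:1, 0, 1:] else 0) else 0) * [:coset_character n \<zeta> h:])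
        - [:0, 1:] * [:\<Sum>h\<in>quotient_group n. a (v, g) (w, h) * coset_character n \<zeta> h:]"
      unfolding const_poly_sum sum_distrib_left sum_subtractf[symmetric]
      by (rule sum.cong) (auto simp: char_entry_def algebra_simps)
    also have "(\<Sum>h\<in>quotient_group n. (if g = h then (if v = w then [:1, 0, 1:] else 0) else 0) * [:coset_character n \<zeta> h:]) =
        (if v = w then [:1, 0, 1:] else 0) * [:coset_character n \<zeta> g:]"
      by (intro sum_if_eq_mult finite_quotient_group g)
    also have "(\<Sum>h\<in>quotient_group n. a (v, g) (w, h) * coset_character n \<zeta> h) = coset_character n \<zeta> g * b \<zeta> v w"
      unfolding a_def b_def by (rule sum_adjacency_derived_digraph[OF \<zeta> fin g])
    also have "(if v = w then [:1, 0, 1:] else 0) * [:coset_character n \<zeta> g:] - [:0, 1:] * [:coset_character n \<zeta> g * b \<zeta> v w:] =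
        [:coset_character n \<zeta> g:] * char_entry v w (b \<zeta> v w)"
      by (auto simp: char_entry_def algebra_simps)
    finally have lhs: "(\<Sum>z\<in>set xs. char_entry x z (a x z) * (if fst z = snd y then [:coset_character n (fst y) (snd z):] else 0)) =
        [:coset_character n \<zeta> g:] * char_entry v w (b \<zeta> v w)" .
    have "(\<Sum>z\<in>set ys. (if fst x = snd z then [:coset_character n (fst z) (snd x):] else 0) *
          (if fst z = fst y then char_entry (snd z) (snd y) (b (fst z) (snd z) (snd y)) else 0)) =
        (\<Sum>\<xi>\<in>?Z. \<Sum>u\<in>set vs. (if v = u then [:coset_character n \<xi> g:] else 0) *
          (if \<xi> = \<zeta> then char_entry u w (b \<xi> u w) else 0))"
      unfolding ys(2) sum_Times by (simp only: eq fst_conv snd_conv)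
    also have "\<dots> = (\<Sum>\<xi>\<in>?Z. [:coset_character n \<xi> g:] * (if \<xi> = \<zeta> then char_entry v w (b \<xi> v w) else 0))"
      by (intro sum.cong refl sum_if_eq_mult v) simp
    also have "\<dots> = (\<Sum>\<xi>\<in>?Z. (if \<xi> = \<zeta> then char_entry v w (b \<zeta> v w) else 0) * [:coset_character n \<xi> g:])"
      by (intro sum.cong refl) auto
    also have "\<dots> = char_entry v w (b \<zeta> v w) * [:coset_character n \<zeta> g:]"
      by (intro sum_if_eq_mult Z(2) \<zeta>Z)
    finally show "(\<Sum>z\<in>set xs. char_entry x z (a x z) * (if fst z = snd y then [:coset_character n (fst y) (snd z):] else 0)) =
        (\<Sum>z\<in>set ys. (if fst x = snd z then [:coset_character n (fst z) (snd x):] else 0) *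
          (if fst z = fst y then char_entry (snd z) (snd y) (b (fst z) (snd z) (snd y)) else 0))"
      unfolding lhs by (simp only: mult.commute)
  qed
  then have "det M * det \<Phi> = det \<Phi> * det B"
    by (simp only: det_mult[OF carr(3,1), symmetric] det_mult[OF carr(1,4), symmetric])
  then have "det \<Phi> * det M = det \<Phi> * det B" by (simp only: mult.commute)
  then have "det M = det B" using nz by (simp only: mult_cancel_left) simp
  also have "det B = (\<Prod>\<zeta>\<in>set zs. det (mat_of vs vs (\<lambda>v w. char_entry v w (b \<zeta> v w))))"
    unfolding B_def ys_def using zs(2) by (subst det_mat_of_block_diagonal) simp_all
  finally show ?thesis by (simp only: M_def xs_def a_def b_def zs(1))
qed

text \<open>The maps \<open>to_fract\<close> carry the polynomials in A into the field of rational
  functions, where the possibly negative power of A^2 - 1 lives. The lists \<open>vs\<close> and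
  \<open>es\<close> are arbitrary enumerations.\<close>

theorem theorem3p3:
  fixes G :: "('v, 'e) pre_digraph"
    and arev :: "'e \<Rightarrow> 'e"
    and \<alpha> :: "'e \<Rightarrow> 'd :: finite \<Rightarrow> 'p :: prime_card padic_int"
    and n l q :: nat and \<chi> :: int
    and vs :: "'v list"
    and es :: "('e \<times> ('d \<Rightarrow> 'p padic_int) set) list"
  assumes "fin_digraph G" and "bidirected_digraph G arev" and "connected G"
    and "\<And>v. v \<in> verts G \<Longrightarrow> 1 \<le> out_degree G v"
    and "voltage_assignment G arev \<alpha>"
    and "distinct vs" and "set vs = verts G"
    and "distinct es" and "set es = arcs (derived_digraph G \<alpha> n)"
    and "card (arcs G) = 2 * l" and "\<chi> = int (card (verts G)) - int l"
    and "q = CARD('p) ^ (CARD('d) * n)"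
  shows
    "to_fract (det ([:0, 1:] \<cdot>\<^sub>m 1\<^sub>m (2 * l * q)
        - map_mat (\<lambda>c. [:c:])
            (grover_matrix (derived_digraph G \<alpha> n) (derived_arev arev \<alpha> n) es
              :: 'p padic_closure mat))) =
     to_fract [:-1, 0, 1:] powi (- (int q * \<chi>)) *
     (\<Prod>\<zeta> | \<forall>i. \<zeta> i ^ (CARD('p) ^ n) = 1.
        to_fract (specialize (spectral_poly G \<alpha> vs) (\<lambda>i. \<zeta> i - 1)))"
proof -
  interpret fin_digraph G by (rule assms(1))
  interpret bidirected_digraph G arev by (rule assms(2))
  let ?D = "derived_digraph G \<alpha> n"
  let ?\<Gamma> = "quotient_group n :: ('d \<Rightarrow> 'p padic_int) set set"
  let ?U = "grover_matrix ?D (derived_arev arev \<alpha> n) es :: 'p padic_closure mat"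
  let ?c = "[:-1, 0, 1:] :: 'p padic_closure poly"
  let ?F = "\<lambda>\<zeta>. specialize (spectral_poly G \<alpha> vs) (\<lambda>i. \<zeta> i - 1)"
  let ?Z = "{\<zeta> :: 'd \<Rightarrow> 'p padic_closure. \<forall>i. \<zeta> i ^ (CARD('p) ^ n) = 1}"
  obtain gs where gs: "set gs = ?\<Gamma>" "distinct gs"
    using finite_distinct_list[OF finite_quotient_group[where 'd = 'd and 'p = 'p and n = n]] by blast
  have len_gs: "length gs = q"
    using distinct_card[OF gs(2)] by (simp add: gs card_quotient_group assms(12))
  have D: "verts ?D = verts G \<times> ?\<Gamma>" "arcs ?D = arcs G \<times> ?\<Gamma>"
    "tail ?D (e, g) = (tail G e, g)" "head ?D (e, g) = (head G e, coset_add g (coset n (\<alpha> e)))" for e g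
    by (simp_all add: derived_digraph_def)
  have len_es: "length es = 2 * (l * q)"
    using distinct_card[OF assms(8)] assms(9,10,12) by (simp add: D(2) card_cartesian_product card_quotient_group)
  have volt: "\<alpha> (arev e) i = - \<alpha> e i" if "e \<in> arcs G" for e i
    using assms(5) that by (simp add: voltage_assignment_def)
  \<comment> \<open>The Ihara-Bass identity is applied upstairs, where there are
    \<open>l * q\<close> inverse pairs of edges. Enumerating the vertices as pairs from
    \<open>vs\<close> and \<open>gs\<close> matches the form in which the characters act.\<close>
  have "det ([:0, 1:] \<cdot>\<^sub>m 1\<^sub>m (length es) - map_mat (\<lambda>c. [:c:]) ?U) * ?c ^ length (List.product vs gs) =
      ?c ^ (l * q) * det (mat_of (List.product vs gs) (List.product vs gs) (\<lambda>x y. (if x = y then [:1, 0, 1:] else 0) -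
      [:0, 1:] * [:\<Sum>e | e \<in> arcs ?D \<and> tail ?D e = x \<and> head ?D e = y. grover_weight ?D e:]))"
  proof (rule det_grover_matrix)
    show "distinct (List.product vs gs)" by (rule distinct_product[OF assms(6) gs(2)])
    show "set (List.product vs gs) = verts ?D" by (simp add: gs assms(7) D)
    show "tail ?D e \<in> verts ?D" if "e \<in> arcs ?D" for e
      using that by (cases e) (auto simp: D)
    show "derived_arev arev \<alpha> n e \<in> arcs ?D" "derived_arev arev \<alpha> n e \<noteq> e"
      "derived_arev arev \<alpha> n (derived_arev arev \<alpha> n e) = e"
      "tail ?D (derived_arev arev \<alpha> n e) = head ?D e" if "e \<in> arcs ?D" for e
      \<comment> \<open>An edge upstairs differs from its inverse already in the first component;
        involutivity comes from the voltages of \<open>e\<close> and \<open>arev e\<close>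
        cancelling.\<close>
      using that arev_neq[of "fst e"]
      by (auto simp: D derived_arev_def coset_add_quotient_group split: prod.splits
          intro!: coset_uminus_add volt)
    show "1 \<le> out_degree ?D v" if "v \<in> verts ?D" for v
      using that assms(4) by (cases v) (auto simp: D out_degree_derived_digraph)
  qed (use assms len_es in simp_all)
  also have "det (mat_of (List.product vs gs) (List.product vs gs) (\<lambda>x y. (if x = y then [:1, 0, 1:] else 0) -
      [:0, 1:] * [:\<Sum>e | e \<in> arcs ?D \<and> tail ?D e = x \<and> head ?D e = y. grover_weight ?D e:])) = (\<Prod>\<zeta>\<in>?Z. ?F \<zeta>)"
    unfolding char_entry_def[symmetric] det_derived_digraph[OF finite_arcs assms(6) gs(2,1)]
    by (rule prod.cong) (auto simp: specialize_spectral_poly[where n = n, OF _ assms(6)])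
  finally have main: "det ([:0, 1:] \<cdot>\<^sub>m 1\<^sub>m (length es) - map_mat (\<lambda>c. [:c:]) ?U) * ?c ^ (length vs * q) =
      ?c ^ (l * q) * (\<Prod>\<zeta>\<in>?Z. ?F \<zeta>)"
    by (simp only: length_product len_gs)
  have pow: "to_fract (x ^ k) = to_fract x ^ k" for x :: "'p padic_closure poly" and k
    by (induction k) simp_all
  have prod: "to_fract (prod f A) = (\<Prod>a\<in>A. to_fract (f a))"
    for f :: "('d \<Rightarrow> 'p padic_closure) \<Rightarrow> 'p padic_closure poly" and A
    by (induction A rule: infinite_finite_induct) simp_all
  have eq: "to_fract (det ([:0, 1:] \<cdot>\<^sub>m 1\<^sub>m (length es) - map_mat (\<lambda>c. [:c:]) ?U)) * to_fract ?c ^ (length vs * q) =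
      to_fract ?c ^ (l * q) * (\<Prod>\<zeta>\<in>?Z. to_fract (?F \<zeta>))"
    using arg_cong[OF main, of to_fract] by (simp only: to_fract_mult pow prod)
  have c: "to_fract ?c \<noteq> 0" by simp
  have "length vs = card (verts G)" using distinct_card[OF assms(6)] assms(7) by simp
  \<comment> \<open>The exponent is the number of inverse pairs of edges minus the number of
    vertices of the derived graph, the two powers of A^2 - 1 found in \<open>main\<close>.\<close>
  then have "- (int q * \<chi>) = int (l * q) - int (length vs * q)"
    by (simp add: assms(11) algebra_simps)
  then have powi: "to_fract ?c powi (- (int q * \<chi>)) = to_fract ?c ^ (l * q) / to_fract ?c ^ (length vs * q)"
    by (simp only: power_int_diff[OF disjI1[OF c]] power_int_of_nat)
  have len: "2 * l * q = length es" by (simp add: len_es)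
  have "to_fract ?c ^ (length vs * q) \<noteq> 0" using c by simp
  then show ?thesis
    unfolding powi len times_divide_eq_left by (subst nonzero_eq_divide_eq) (assumption, rule eq)
qed

end
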